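(* Let $\widehat g_n$ be any square integrable function measurable with respect to $\mathcal F_n^y=\sigma\{y_t,0\le t\le n\}$. Then for any $1\le j\le d$, $$\widetilde{\mathbf E}\,(\widehat g_n-g(\theta))^2\ \ge\ \frac{\eta_j^2}{n\,\|\psi_j\|^2\sigma_1^{-2}+I_j},$$ where $$\eta_j=\int_{\mathbb R^d}g_j'(\theta)\,U(\theta)\,d\theta,\qquad I_j=\int_{\mathbb R}\frac{\dot u_j^2(z)}{u_j(z)}\,dz .$$
   Context: Let $\Pi$ be a positive (Lévy) measure on $\mathbb R_0=\mathbb R\setminus\{0\}$ with $\int x^2\,\Pi(dx)=1$ and $\int x^6\,\Pi(dx)<\infty$. Let $(w_t)$ be a standard Brownian motion and $\mu(ds\,dx)$ a jump (Poisson random) measure independent of $w$ with compensator $\widetilde\mu(ds\,dx)=ds\,\Pi(dx)$; $z_t=\int_0^t\int_{\mathbb R_0}x\,(\mu-\widetilde\mu)(ds\,dx)$ and $\xi_t=\sigma_1w_t+\sigma_2z_t$ with constants $\sigma_1\ne0$, $\sigma_2$. For $\theta=(\theta_1,\dots,\theta_d)'\in\mathbb R^d$ the process $(y_t)_{0\le t\le n}$ is given by $dy_t=S(t,\theta)\,dt+d\xi_t$ with $S(t,\theta)=\sum_{i=1}^d\theta_i\psi_i(t)$, where $\psi_1,\dots,\psi_d$ are 1-periodic functions, square integrable on $[0,1]$ and orthogonal; $\|\psi\|^2=\int_0^1\psi^2(t)\,dt$. $\mathbf P_\theta$ is the law of $(y_t)_{0\le t\le n}$ on the Skorokhod space $\mathcal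 X=D[0,n]$. $U(\theta)=\prod_{j=1}^du_j(\theta_j)$ is a prior density on $\mathbb R^d$, where each $u_j$ is a continuously differentiable probability density on $\mathbb R$ with derivative $\dot u_j$. $g:\mathbb R^d\to\mathbb R$ is a continuously differentiable function such that for each $1\le j\le d$, $\lim_{|\theta_j|\to\infty}g(\theta)u_j(\theta_j)=0$ and $\int_{\mathbb R^d}|g_j'(\theta)|U(\theta)\,d\theta<\infty$, where $g_j'=\partial g/\partial\theta_j$. For a jointly measurable integrable function $H(x,\theta)$ on $\mathcal X\times\mathbb R^d$, $\widetilde{\mathbf E}H=\int_{\mathbb R^d}\int_{\mathcal X}H(x,\theta)\,d\mathbf P_\theta(x)\,U(\theta)\,d\theta$. *)

theory Defs
  imports "HOL-Probability.Probability"
begin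

section \<open>Driving processes\<close>

definition cadlag_on :: "real set \<Rightarrow> (real \<Rightarrow> real) \<Rightarrow> bool" where
  "cadlag_on T f \<longleftrightarrow>
     (\<forall>t\<in>T. (f \<longlongrightarrow> f t) (at t within (T \<inter> {t<..})) \<and>
            (\<exists>l. (f \<longlongrightarrow> l) (at t within (T \<inter> {..<t}))))"

definition brownian_motion :: "'w measure \<Rightarrow> (real \<Rightarrow> 'w \<Rightarrow> real) \<Rightarrow> bool" where
  "brownian_motion M w \<longleftrightarrow>
     (\<forall>t\<ge>0. w t \<in> borel_measurable M) \<and>
     (\<forall>\<omega>\<in>space M. w 0 \<omega> = 0 \<and> continuous_on {0..} (\<lambda>t. w t \<omega>)) \<and>
     (\<forall>s t. 0 \<le> s \<longrightarrow> s < t \<longrightarrow>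
        distributed M lborel (\<lambda>\<omega>. w t \<omega> - w s \<omega>)
          (\<lambda>x. ennreal (normal_density 0 (sqrt (t - s)) x))) \<and>
     (\<forall>(\<tau> :: nat \<Rightarrow> real) m. 0 \<le> \<tau> 0 \<longrightarrow> mono \<tau> \<longrightarrow>
        prob_space.indep_vars M (\<lambda>_. borel)
          (\<lambda>i \<omega>. w (\<tau> (Suc i)) \<omega> - w (\<tau> i) \<omega>) {..<m})"

text \<open>
  The Poisson weights are written out so that intensity zero is included;
  the library's \<^const>\<open>poisson_pmf\<close> needs a positive rate.
\<close>

definition poisson_random_measure ::
    "'w measure \<Rightarrow> ('w \<Rightarrow> 'e measure) \<Rightarrow> 'e measure \<Rightarrow> bool" where
  "poisson_random_measure M \<mu> \<nu> \<longleftrightarrow>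
     (\<forall>\<omega>\<in>space M. sets (\<mu> \<omega>) = sets \<nu>) \<and>
     (\<forall>A\<in>sets \<nu>. (\<lambda>\<omega>. emeasure (\<mu> \<omega>) A) \<in> borel_measurable M) \<and>
     (\<forall>A\<in>sets \<nu>. emeasure \<nu> A < \<infinity> \<longrightarrow>
        (\<forall>k :: nat. measure M {\<omega> \<in> space M. emeasure (\<mu> \<omega>) A = of_nat k}
                    = measure \<nu> A ^ k / fact k * exp (- measure \<nu> A))) \<and>
     (\<forall>(A :: nat \<Rightarrow> 'e set) m.
        (\<forall>i<m. A i \<in> sets \<nu>) \<longrightarrow> disjoint_family_on A {..<m} \<longrightarrow>
        prob_space.indep_vars M (\<lambda>_. borel) (\<lambda>i \<omega>. emeasure (\<mu> \<omega>) (A i)) {..<m})"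

text \<open>
  A measure on the punctured line is encoded as a Borel measure on the line
  that does not charge the origin.
\<close>

definition measure_on_R0 :: "real measure \<Rightarrow> bool" where
  "measure_on_R0 L \<longleftrightarrow> sets L = sets borel \<and> emeasure L {0} = 0"

text \<open>The compensator \<open>ds L(dx)\<close>, living on positive times.\<close>

definition jump_compensator :: "real measure \<Rightarrow> (real \<times> real) measure" where
  "jump_compensator L = density lborel (indicator {0<..}) \<Otimes>\<^sub>M L"

text \<open>
  The integral of \<open>x\<close> against \<open>\<mu> - ds L(dx)\<close> need not converge absolutely near
  \<open>x = 0\<close>.  As usual it is the mean-square limit of the integrals over
  \<open>\<bar>x\<bar> > \<epsilon>\<close>, and \<open>z\<close> is a version with cadlag paths.
\<close>

definition compensated_jump_process ::
    "'w measure \<Rightarrow> ('w \<Rightarrow> (real \<times> real) measure) \<Rightarrow> real measure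
      \<Rightarrow> (real \<Rightarrow> 'w \<Rightarrow> real) \<Rightarrow> bool" where
  "compensated_jump_process M \<mu> L z \<longleftrightarrow>
     (\<forall>t\<ge>0. z t \<in> borel_measurable M) \<and>
     (\<forall>\<omega>\<in>space M. cadlag_on {0..} (\<lambda>t. z t \<omega>)) \<and>
     (\<forall>t\<ge>0.
        ((\<lambda>\<epsilon>. \<integral>\<^sup>+ \<omega>. ennreal ((z t \<omega>
              - ((LINT p:({0<..t} \<times> {x. \<epsilon> < \<bar>x\<bar>})|\<mu> \<omega>. snd p)
               - (LINT p:({0<..t} \<times> {x. \<epsilon> < \<bar>x\<bar>})|jump_compensator L. snd p)))\<^sup>2) \<partial>M)
         \<longlongrightarrow> 0) (at_right 0))"

text \<open>
  Independence of the sigma-algebras generated by \<open>(w t)\<close>, \<open>t \<ge> 0\<close>, and by the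
  random variables \<open>\<mu>(A)\<close>, \<open>A\<close> measurable.
\<close>

definition indep_process_random_measure ::
    "'w measure \<Rightarrow> (real \<Rightarrow> 'w \<Rightarrow> real) \<Rightarrow> ('w \<Rightarrow> 'e measure) \<Rightarrow> 'e measure \<Rightarrow> bool" where
  "indep_process_random_measure M w \<mu> \<nu> \<longleftrightarrow>
     prob_space.indep_set M
       (sets (vimage_algebra (space M) (\<lambda>\<omega>. \<lambda>t\<in>{0..}. w t \<omega>) (PiM {0..} (\<lambda>_. borel))))
       (sets (vimage_algebra (space M) (\<lambda>\<omega>. \<lambda>A\<in>sets \<nu>. emeasure (\<mu> \<omega>) A)
                (PiM (sets \<nu>) (\<lambda>_. borel))))"


section \<open>The regression model\<close>

definition square_integrable_01 :: "(real \<Rightarrow> real) \<Rightarrow> bool" where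
  "square_integrable_01 f \<longleftrightarrow>
     f \<in> borel_measurable (lebesgue_on {0..1}) \<and>
     integrable (lebesgue_on {0..1}) (\<lambda>t. (f t)\<^sup>2)"

definition inner_01 :: "(real \<Rightarrow> real) \<Rightarrow> (real \<Rightarrow> real) \<Rightarrow> real" where
  "inner_01 f h = (LINT t|lebesgue_on {0..1}. f t * h t)"

definition norm_sq_01 :: "(real \<Rightarrow> real) \<Rightarrow> real" where
  "norm_sq_01 f = (LINT t|lebesgue_on {0..1}. (f t)\<^sup>2)"

definition signal :: "('d::finite \<Rightarrow> real \<Rightarrow> real) \<Rightarrow> real ^ 'd \<Rightarrow> real \<Rightarrow> real" where
  "signal \<psi> \<theta> t = (\<Sum>i\<in>UNIV. \<theta> $ i * \<psi> i t)"

definition observation ::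
    "real \<Rightarrow> ('d::finite \<Rightarrow> real \<Rightarrow> real) \<Rightarrow> (real \<Rightarrow> 'w \<Rightarrow> real) \<Rightarrow> real ^ 'd
      \<Rightarrow> real \<Rightarrow> 'w \<Rightarrow> real" where
  "observation y0 \<psi> \<xi> \<theta> t \<omega> = y0 + (LINT s|lebesgue_on {0..t}. signal \<psi> \<theta> s) + \<xi> t \<omega>"

text \<open>
  \<open>D[0,n]\<close>: cadlag functions on \<open>{0..n}\<close>, with the sigma-algebra generated by the
  coordinate maps \<open>x \<mapsto> x t\<close>, \<open>0 \<le> t \<le> n\<close>.  It coincides with the Borel sigma-algebra of the
  Skorokhod topology.
\<close>

definition skorokhod_space :: "nat \<Rightarrow> (real \<Rightarrow> real) measure" where
  "skorokhod_space n =
     restrict_space (PiM {0..real n} (\<lambda>_. borel)) {x. cadlag_on {0..real n} x}"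

definition observation_law ::
    "'w measure \<Rightarrow> nat \<Rightarrow> real \<Rightarrow> ('d::finite \<Rightarrow> real \<Rightarrow> real) \<Rightarrow> (real \<Rightarrow> 'w \<Rightarrow> real)
      \<Rightarrow> real ^ 'd \<Rightarrow> (real \<Rightarrow> real) measure" where
  "observation_law M n y0 \<psi> \<xi> \<theta> =
     distr M (skorokhod_space n) (\<lambda>\<omega>. \<lambda>t\<in>{0..real n}. observation y0 \<psi> \<xi> \<theta> t \<omega>)"


section \<open>The prior and the Bayes risk\<close>

definition prior_density :: "('d::finite \<Rightarrow> real \<Rightarrow> real) \<Rightarrow> real ^ 'd \<Rightarrow> real" where
  "prior_density u \<theta> = (\<Prod>j\<in>UNIV. u j (\<theta> $ j))"

text \<open>
  Expectation of a nonnegative \<open>H(x,\<theta>)\<close>, with value \<open>\<infinity>\<close> if \<open>H\<close> is not integrable.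
\<close>

definition bayes_expectation ::
    "(real ^ 'd \<Rightarrow> 'x measure) \<Rightarrow> (real ^ 'd::finite \<Rightarrow> real)
      \<Rightarrow> ('x \<Rightarrow> real ^ 'd \<Rightarrow> ennreal) \<Rightarrow> ennreal" where
  "bayes_expectation P U H =
     (\<integral>\<^sup>+ \<theta>. (\<integral>\<^sup>+ x. H x \<theta> \<partial>P \<theta>) * ennreal (U \<theta>) \<partial>lborel)"

text \<open>
  This may be infinite.  Where \<open>v\<close> vanishes the integrand is \<open>0\<close>, by \<open>x / 0 = 0\<close>; a nonnegative
  differentiable \<open>v\<close> has \<open>v' = 0\<close> there.
\<close>

definition prior_information :: "(real \<Rightarrow> real) \<Rightarrow> (real \<Rightarrow> real) \<Rightarrow> ennreal" where
  "prior_information v v' = (\<integral>\<^sup>+ x. ennreal ((v' x)\<^sup>2 / v x) \<partial>lborel)"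

end

(* This is a van Trees inequality for a single coordinate of theta.  Given the jump part, a change of
   theta_j shifts the Brownian increments over a finite partition by a deterministic vector, so on
   functionals of finitely many values y_t it acts through the explicit Gaussian likelihood ratio
   exp (t b - t^2 q / 2), with q = sum_i (increment of the integral of psi_j)^2 / (sigma_1^2 * step).
   Integrating by parts in theta_j against likelihood ratio times prior gives
   eta_j = E~ ((h - g) * score), where the score has second moment q + I_j, and Cauchy-Schwarz on the
   steps of the partition gives q <= n |psi_j|^2 / sigma_1^2 whatever the partition is.  Functionals of
   finitely many coordinates are dense in L2 of the mixture law of y, so the bound passes to every
   square integrable estimator without any stochastic integral.  If the risk or I_j is infinite, there
   is nothing to prove; finiteness of I_j makes u_j vanish at infinity. *)
theory Submission
  imports Defs
begin

section \<open>Integration by parts against a score\<close>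

text \<open>The likelihood of an observed path would involve the integral of \<psi>_j against the
  continuous martingale part of y, which has to be extracted from the data. The score need not be a
  function of the data, however. It may live on the probability space carrying \<open>w\<close> and
  \<open>\<mu>\<close>, where the Brownian increments and the jumps are separately available; the
  estimator is merely a function of this finer information. The change of measure transfers theta_j
  from the data to the weight. The estimator then no longer depends on theta_j, so no smoothness of
  it is required: only \<open>g\<close>, the weight and the prior are differentiated. The price is a
  boundary term in which an arbitrary constant multiplies \<open>u j\<close>. The decay of
  \<open>g\<close> times \<open>u j\<close> does not control it, which is why \<open>u j\<close>
  itself has to vanish at infinity. The two informations add because, under the tilted law and for
  fixed theta, the Gaussian score is centred while the prior score is constant. The version of the
  jump process is tied to \<open>\<mu>\<close> only through mean-square limits, so the
  representation of the data by increments and jumps holds almost surely and for finitely many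
  times.\<close>

lemma lborel_integral_FTC:
  fixes F f :: "real \<Rightarrow> real"
  assumes F: "\<And>x. (F has_real_derivative f x) (at x)"
    and f: "continuous_on UNIV f" "integrable lborel f"
    and lim: "(F \<longlongrightarrow> a) at_bot" "(F \<longlongrightarrow> b) at_top"
  shows "(LINT x|lborel. f x) = b - a"
proof -
  have "(LBINT x=-\<infinity>..\<infinity>. f x) = b - a"
  proof (rule interval_integral_FTC_integrable)
    show "isCont f x" for x
      using f(1) by (simp add: continuous_on_eq_continuous_at)
    show "set_integrable lborel (einterval (-\<infinity>) \<infinity>) f"
      using f(2) by (simp add: set_integrable_def)
    show "((F \<circ> real_of_ereal) \<longlongrightarrow> a) (at_right (-\<infinity>))"
      using lim(1) by (simp add: ereal_tendsto_simps1)
    show "((F \<circ> real_of_ereal) \<longlongrightarrow> b) (at_left \<infinity>)"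
      using lim(2) by (simp add: ereal_tendsto_simps1)
  qed (use F in \<open>auto simp: has_real_derivative_iff_has_vector_derivative\<close>)
  then show ?thesis
    by (simp add: interval_lebesgue_integral_def set_lebesgue_integral_def)
qed

text \<open>Integrability of \<open>u'\<close> makes \<open>u\<close> converge, to
  \<open>u 0\<close> plus the integral of \<open>u'\<close> over the positive half line. A positive
  limit would contradict integrability of \<open>u\<close>.\<close>

lemma density_tendsto_0_at_top:
  fixes u u' :: "real \<Rightarrow> real"
  assumes u: "\<And>x. (u has_real_derivative u' x) (at x)" and u': "continuous_on UNIV u'"
    and pos: "\<And>x. 0 \<le> u x" and int: "(\<integral>\<^sup>+ x. ennreal (u x) \<partial>lborel) < \<infinity>"
    and int': "integrable lborel u'"
  shows "(u \<longlongrightarrow> 0) at_top"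
proof -
  define c where "c = u 0 + (LINT x:{0..}|lborel. u' x)"
  have i0: "integrable lborel (\<lambda>x. indicator {0..} x *\<^sub>R u' x)"
    using int' by (intro integrable_mult_indicator) auto
  have "((\<lambda>y. LINT x|lborel. indicator {..y} x *\<^sub>R (indicator {0..} x *\<^sub>R u' x)) \<longlongrightarrow>
      (LINT x|lborel. indicator {0..} x *\<^sub>R u' x)) at_top"
    by (rule tendsto_integral_at_top[OF _ i0]) simp
  moreover have "\<forall>\<^sub>F y in at_top. (LINT x|lborel. indicator {..y} x *\<^sub>R (indicator {0..} x *\<^sub>R u' x)) = u y - u 0"
    using eventually_ge_at_top[of 0]
  proof eventually_elim
    case (elim y)
    have "(LINT x|lborel. indicator {0..y} x *\<^sub>R u' x) = u y - u 0"
    proof (rule integral_FTC_atLeastAtMost[OF elim])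
      show "(u has_vector_derivative u' x) (at x within {0..y})" for x
        using u[of x] by (auto simp: has_real_derivative_iff_has_vector_derivative
            intro: has_vector_derivative_at_within)
      show "continuous_on {0..y} u'" using u' continuous_on_subset by blast
    qed
    moreover have "(\<lambda>x. indicator {..y} x *\<^sub>R (indicator {0..} x *\<^sub>R u' x)) = (\<lambda>x. indicator {0..y} x *\<^sub>R u' x)"
      by (auto simp: indicator_def)
    ultimately show ?case by simp
  qed
  ultimately have "((\<lambda>y. u y - u 0) \<longlongrightarrow> (LINT x:{0..}|lborel. u' x)) at_top"
    unfolding set_lebesgue_integral_def by (rule Lim_transform_eventually)
  then have lim: "(u \<longlongrightarrow> c) at_top"
    unfolding c_def using tendsto_add[OF tendsto_const[of "u 0"]] by fastforce
  have "c \<ge> 0" using lim by (rule tendsto_lowerbound) (use pos in auto)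
  have "c = 0"
  proof (rule ccontr)
    assume "c \<noteq> 0"
    with \<open>c \<ge> 0\<close> have c: "c > 0" by simp
    have "\<forall>\<^sub>F y in at_top. u y > c / 2"
      using order_tendstoD(1)[OF lim, of "c/2"] c by simp
    then obtain K where K: "\<And>y. y \<ge> K \<Longrightarrow> u y > c / 2"
      by (auto simp: eventually_at_top_linorder)
    \<comment> \<open>The half line contains an interval of length \<open>m\<close> for every
      \<open>m\<close>, so it has infinite measure, and \<open>u\<close> exceeds
      \<open>c / 2\<close> on it.\<close>
    have "of_nat m \<le> emeasure lborel {K..}" for m
      using emeasure_mono[of "{K..K + real m}" "{K..}" lborel] by (auto simp: ennreal_of_nat_eq_real_of_nat)
    then have "emeasure lborel {K..} = top"
      using SUP_least[of UNIV of_nat "emeasure lborel {K..}"] by (simp add: ennreal_SUP_of_nat_eq_top top_unique)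
    then have "\<infinity> = (\<integral>\<^sup>+ x. ennreal (c/2) * indicator {K..} x \<partial>lborel)"
      using c by (simp add: nn_integral_cmult ennreal_mult_top)
    also have "\<dots> \<le> (\<integral>\<^sup>+ x. ennreal (u x) \<partial>lborel)"
      by (intro nn_integral_mono) (auto simp: indicator_def intro!: ennreal_leI dest!: K)
    finally show False using int by simp
  qed
  with lim show ?thesis by simp
qed

text \<open>The limit at minus infinity is the limit at plus infinity of the reflected function
  \<open>u (- x)\<close>.\<close>

lemma density_tendsto_0_at_infinity:
  fixes u u' :: "real \<Rightarrow> real"
  assumes u: "\<And>x. (u has_real_derivative u' x) (at x)" and u': "continuous_on UNIV u'"
    and pos: "\<And>x. 0 \<le> u x" and int: "(\<integral>\<^sup>+ x. ennreal (u x) \<partial>lborel) < \<infinity>"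
    and int': "integrable lborel u'"
  shows "(u \<longlongrightarrow> 0) at_infinity"
proof -
  have "((\<lambda>x. u (- x)) \<longlongrightarrow> 0) at_top"
  proof (rule density_tendsto_0_at_top)
    show "((\<lambda>x. u (- x)) has_real_derivative - u' (- x)) (at x)" for x
      using DERIV_chain2[OF u[of "- x"] DERIV_minus[OF DERIV_ident]] by simp
    show "continuous_on UNIV (\<lambda>x. - u' (- x))"
      by (intro continuous_intros continuous_on_compose2[OF u']) auto
    have [measurable]: "u \<in> borel_measurable borel"
      using u by (intro borel_measurable_continuous_onI DERIV_continuous_on) (auto intro: has_field_derivative_at_within)
    show "(\<integral>\<^sup>+ x. ennreal (u (- x)) \<partial>lborel) < \<infinity>"
      using int nn_integral_real_affine[of "\<lambda>x. ennreal (u x)" "-1" 0] by simp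
    show "integrable lborel (\<lambda>x. - u' (- x))"
      using int' lborel_integrable_real_affine[of u' "-1" 0] by simp
  qed (use pos in auto)
  then have "(u \<longlongrightarrow> 0) at_bot" by (simp add: filterlim_at_bot_mirror)
  with density_tendsto_0_at_top[OF assms] show ?thesis
    by (simp add: at_infinity_eq_at_top_bot filterlim_sup)
qed

text \<open>
  Integration by parts in the first variable: the derivative of \<open>D * W\<close> integrates to \<open>0\<close>, so the
  integral of \<open>G * W\<close> is the \<open>W\<close>-weighted inner product of \<open>D\<close> with the score \<open>S\<close>.
\<close>

lemma score_cauchy_schwarz:
  fixes N :: "'p measure" and D W S G :: "real \<times> 'p \<Rightarrow> real"
  assumes N: "sigma_finite_measure N"
    and [measurable]: "D \<in> borel_measurable (lborel \<Otimes>\<^sub>M N)" "W \<in> borel_measurable (lborel \<Otimes>\<^sub>M N)"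
      "S \<in> borel_measurable (lborel \<Otimes>\<^sub>M N)" 
    and W: "\<And>x. 0 \<le> W x"
    and deriv: "\<And>s p. p \<in> space N \<Longrightarrow> ((\<lambda>s. D (s, p) * W (s, p)) has_real_derivative
        D (s, p) * S (s, p) * W (s, p) - G (s, p) * W (s, p)) (at s)"
    and cont: "\<And>p. p \<in> space N \<Longrightarrow> continuous_on UNIV (\<lambda>s. D (s, p) * S (s, p) * W (s, p) - G (s, p) * W (s, p))"
    and lim: "\<And>p. p \<in> space N \<Longrightarrow> ((\<lambda>s. D (s, p) * W (s, p)) \<longlongrightarrow> 0) at_infinity"
    and G: "integrable (lborel \<Otimes>\<^sub>M N) (\<lambda>x. G x * W x)"
    and A: "(\<integral>\<^sup>+ x. ennreal ((D x)\<^sup>2 * W x) \<partial>(lborel \<Otimes>\<^sub>M N)) = ennreal A" "0 \<le> A"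
    and B: "(\<integral>\<^sup>+ x. ennreal ((S x)\<^sup>2 * W x) \<partial>(lborel \<Otimes>\<^sub>M N)) = ennreal B" "0 \<le> B"
  shows "(LINT x|(lborel \<Otimes>\<^sub>M N). G x * W x)\<^sup>2 \<le> A * B"
proof -
  interpret N: sigma_finite_measure N by fact
  interpret P: pair_sigma_finite lborel N by standard
  let ?R = "lborel \<Otimes>\<^sub>M N"
  have "(\<integral>\<^sup>+ x. ennreal \<bar>D x * S x * W x\<bar> \<partial>?R)\<^sup>2
      = (\<integral>\<^sup>+ x. ennreal (\<bar>D x\<bar> * sqrt (W x)) * ennreal (\<bar>S x\<bar> * sqrt (W x)) \<partial>?R)\<^sup>2"
    using W by (intro arg_cong[where f="\<lambda>x. x\<^sup>2"] nn_integral_cong)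
      (auto simp: ennreal_mult'[symmetric] abs_mult algebra_simps)
  \<comment> \<open>Both factors carry \<open>sqrt (W x)\<close>, so this is Cauchy-Schwarz in the
    space weighted by \<open>W\<close>. It also yields the integrability of \<open>D * S * W\<close>
    that Fubini needs.\<close>
  also have "\<dots> \<le> (\<integral>\<^sup>+ x. (ennreal (\<bar>D x\<bar> * sqrt (W x)))\<^sup>2 \<partial>?R) * (\<integral>\<^sup>+ x. (ennreal (\<bar>S x\<bar> * sqrt (W x)))\<^sup>2 \<partial>?R)"
    by (rule Cauchy_Schwarz_nn_integral) measurable
  also have "\<dots> = ennreal A * ennreal B"
    using W by (simp add: ennreal_power power_mult_distrib A B)
  finally have le: "(\<integral>\<^sup>+ x. ennreal \<bar>D x * S x * W x\<bar> \<partial>?R)\<^sup>2 \<le> ennreal (A * B)"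
    using A B by (simp add: ennreal_mult)
  then have fin: "(\<integral>\<^sup>+ x. ennreal \<bar>D x * S x * W x\<bar> \<partial>?R) < top"
    using le_less_trans[OF le ennreal_less_top] by (simp add: power_less_top_ennreal)
  have int: "integrable ?R (\<lambda>x. D x * S x * W x)"
    by (rule integrableI_bounded) (use fin in auto)
  let ?f = "\<lambda>x. D x * S x * W x - G x * W x"
  have intf: "integrable ?R ?f" using int G by (rule Bochner_Integration.integrable_diff)
  have pair_eta: "(\<lambda>(s, p). ?f (s, p)) = ?f" by auto
  have intf': "integrable ?R (\<lambda>(s, p). ?f (s, p))" using intf unfolding pair_eta .
  \<comment> \<open>Fubini provides integrable slices for almost every \<open>p\<close> only. On
    such a slice the integrand is the derivative of \<open>D * W\<close>, which vanishes at both
    ends.\<close>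
  have AE0: "AE p in N. (LINT s|lborel. ?f (s, p)) = 0"
    using P.AE_integrable_snd[OF intf'] AE_space
  proof eventually_elim
    case (elim p)
    have l: "((\<lambda>s. D (s, p) * W (s, p)) \<longlongrightarrow> 0) at_bot" "((\<lambda>s. D (s, p) * W (s, p)) \<longlongrightarrow> 0) at_top"
      using lim[OF elim(2)] by (auto intro: tendsto_mono[rotated] at_bot_le_at_infinity at_top_le_at_infinity)
    have "(LINT s|lborel. ?f (s, p)) = 0 - 0"
      by (rule lborel_integral_FTC[OF deriv[OF elim(2)] cont[OF elim(2)] elim(1) l])
    then show ?case by simp
  qed
  have "(LINT x|?R. ?f x) = (LINT x|?R. (\<lambda>(s, p). ?f (s, p)) x)"
    unfolding pair_eta ..
  also have "\<dots> = (LINT p|N. LINT s|lborel. ?f (s, p))"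
    by (rule P.integral_snd[OF intf', symmetric])
  also have "\<dots> = 0" using integral_eq_zero_AE[OF AE0] .
  finally have eq: "(LINT x|?R. G x * W x) = (LINT x|?R. D x * S x * W x)"
    using int G by simp
  have "ennreal ((LINT x|?R. D x * S x * W x)\<^sup>2) \<le> (ennreal (LINT x|?R. \<bar>D x * S x * W x\<bar>))\<^sup>2"
    using integral_abs_bound[of ?R "\<lambda>x. D x * S x * W x"]
    by (simp add: ennreal_power abs_le_square_iff[symmetric])
  also have "\<dots> = (\<integral>\<^sup>+ x. ennreal \<bar>D x * S x * W x\<bar> \<partial>?R)\<^sup>2"
    using int by (subst nn_integral_eq_integral) auto
  also note le
  finally show ?thesis
    using A(2) B(2) by (simp add: eq ennreal_le_iff)
qed

section \<open>Coordinates of Lebesgue measure and product priors\<close>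

text \<open>Separates the coordinate to be integrated by parts from the others. The others form a
  function on which only the values off \<open>j\<close> matter, so that they can be integrated
  against a product measure indexed by \<open>UNIV - {j}\<close>.\<close>

definition vec_insert :: "'d::finite \<Rightarrow> real \<times> ('d \<Rightarrow> real) \<Rightarrow> real ^ 'd" where
  "vec_insert j x = (\<chi> i. if i = j then fst x else snd x i)"

lemma vec_insert_nth: "vec_insert j (s, f) $ i = (if i = j then s else f i)"
  by (simp add: vec_insert_def)

lemma measurable_vec_insert[measurable]:
  "vec_insert j \<in> borel_measurable (lborel \<Otimes>\<^sub>M (\<Pi>\<^sub>M i\<in>UNIV - {j}. lborel))"
proof (subst borel_measurable_euclidean_space, intro ballI)
  fix b :: "real ^ 'a" assume "b \<in> Basis"
  then obtain i where b: "b = axis i 1" by (auto simp: Basis_vec_def)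
  have "(\<lambda>x::real \<times> ('a \<Rightarrow> real). if i = j then fst x else snd x i) \<in>
      borel_measurable (lborel \<Otimes>\<^sub>M (\<Pi>\<^sub>M i\<in>UNIV - {j}. lborel))"
    by (cases "i = j") auto
  then show "(\<lambda>x. vec_insert j x \<bullet> b) \<in> borel_measurable (lborel \<Otimes>\<^sub>M (\<Pi>\<^sub>M i\<in>UNIV - {j}. lborel))"
    by (simp add: b inner_axis vec_insert_def)
qed

text \<open>Lebesgue measure is determined by the volumes of boxes, and the preimage of a box is an
  interval times a product of intervals.\<close>

lemma distr_vec_insert:
  "distr (lborel \<Otimes>\<^sub>M (\<Pi>\<^sub>M i\<in>UNIV - {j}. lborel)) borel (vec_insert j) = (lborel :: (real ^ 'd::finite) measure)"
proof (rule lborel_eqI[symmetric])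
  fix l v :: "real ^ 'd" assume le: "\<And>b. b \<in> Basis \<Longrightarrow> l \<bullet> b \<le> v \<bullet> b"
  interpret product_sigma_finite "\<lambda>_. lborel :: real measure" by standard
  interpret F: finite_product_sigma_finite "\<lambda>_. lborel :: real measure" "UNIV - {j}" by standard auto
  have le': "l $ i \<le> v $ i" for i
    using le[of "axis i 1"] by (auto simp: inner_axis Basis_vec_def)
  let ?P = "\<Pi>\<^sub>M i\<in>UNIV - {j}. lborel :: real measure"
  have eq: "vec_insert j -` box l v \<inter> space (lborel \<Otimes>\<^sub>M ?P)
      = {l $ j <..< v $ j} \<times> (\<Pi>\<^sub>E i\<in>UNIV - {j}. {l $ i <..< v $ i})" (is "?L = ?R")
  proof (rule set_eqI)
    fix x show "x \<in> ?L \<longleftrightarrow> x \<in> ?R"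
      by (cases x) (auto simp: space_pair_measure space_PiM mem_box_cart vec_insert_nth PiE_iff split: if_splits)
  qed
  have "emeasure (distr (lborel \<Otimes>\<^sub>M ?P) borel (vec_insert j)) (box l v)
      = emeasure (lborel \<Otimes>\<^sub>M ?P) ({l $ j <..< v $ j} \<times> (\<Pi>\<^sub>E i\<in>UNIV - {j}. {l $ i <..< v $ i}))"
    by (subst emeasure_distr) (auto simp: eq)
  also have "\<dots> = emeasure lborel {l $ j <..< v $ j} * emeasure ?P (\<Pi>\<^sub>E i\<in>UNIV - {j}. {l $ i <..< v $ i})"
    by (rule F.emeasure_pair_measure_Times) auto
  also have "\<dots> = ennreal (v $ j - l $ j) * (\<Prod>i\<in>UNIV - {j}. ennreal (v $ i - l $ i))"
    using le' by (subst emeasure_PiM) auto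
  also have "\<dots> = (\<Prod>i\<in>UNIV. ennreal (v $ i - l $ i))"
    by (subst prod.remove[of UNIV j]) auto
  also have "\<dots> = ennreal (\<Prod>i\<in>UNIV. (v - l) $ i)"
    using le' by (subst prod_ennreal) auto
  also have "(\<Prod>i\<in>UNIV. (v - l) $ i) = (\<Prod>b\<in>Basis. (v - l) \<bullet> b)"
  proof -
    have "(\<Prod>b\<in>(\<lambda>i. axis i 1) ` UNIV. (v - l) \<bullet> b) = (\<Prod>i\<in>UNIV. (v - l) \<bullet> axis i 1)"
      by (subst prod.reindex) (auto simp: inj_on_def axis_eq_axis)
    moreover have "(Basis :: (real ^ 'd) set) = (\<lambda>i. axis i 1) ` UNIV"
      by (auto simp: Basis_vec_def)
    ultimately show ?thesis by (simp add: inner_axis)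
  qed
  finally show "emeasure (distr (lborel \<Otimes>\<^sub>M ?P) borel (vec_insert j)) (box l v) = ennreal (\<Prod>b\<in>Basis. (v - l) \<bullet> b)" .
qed simp

lemma nn_integral_vec_insert:
  fixes F :: "real ^ 'd::finite \<Rightarrow> ennreal"
  assumes [measurable]: "F \<in> borel_measurable borel"
  shows "(\<integral>\<^sup>+\<theta>. F \<theta> \<partial>lborel) = (\<integral>\<^sup>+s. \<integral>\<^sup>+f. F (vec_insert j (s, f)) \<partial>(\<Pi>\<^sub>M i\<in>UNIV - {j}. lborel) \<partial>lborel)"
proof -
  interpret product_sigma_finite "\<lambda>_. lborel :: real measure" by standard
  interpret F: finite_product_sigma_finite "\<lambda>_. lborel :: real measure" "UNIV - {j}" by standard auto
  show ?thesis
    by (subst distr_vec_insert[symmetric, of j], subst nn_integral_distr)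
       (auto simp: F.nn_integral_fst[symmetric])
qed

text \<open>Puts theta_j first and groups the other coordinates with \<open>\<omega>\<close>, which
  is the shape in which integration by parts takes place. Both measures are compared on
  rectangles.\<close>

lemma distr_vec_insert_pair:
  fixes M :: "'w measure"
  assumes "sigma_finite_measure M"
  shows "distr (lborel \<Otimes>\<^sub>M ((\<Pi>\<^sub>M i\<in>UNIV - {j}. lborel) \<Otimes>\<^sub>M M)) (borel \<Otimes>\<^sub>M M)
      (\<lambda>x. (vec_insert j (fst x, fst (snd x)), snd (snd x))) = (lborel :: (real ^ 'd::finite) measure) \<Otimes>\<^sub>M M"
    (is "distr ?N _ ?T = _")
proof (rule pair_measure_eqI[symmetric])
  interpret product_sigma_finite "\<lambda>_. lborel :: real measure" by standard
  interpret F: finite_product_sigma_finite "\<lambda>_. lborel :: real measure" "UNIV - {j}" by standard auto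
  interpret M: sigma_finite_measure M by fact
  interpret FM: pair_sigma_finite "\<Pi>\<^sub>M i\<in>UNIV - {j}. lborel :: real measure" M by standard
  show "sigma_finite_measure (lborel :: (real ^ 'd) measure)" "sigma_finite_measure M"
    by standard
  show "sets (lborel \<Otimes>\<^sub>M M) = sets (distr ?N (borel \<Otimes>\<^sub>M M) ?T)"
    by (simp cong: sets_pair_measure_cong)
  fix A B assume A: "A \<in> sets (lborel :: (real ^ 'd) measure)" and B[measurable]: "B \<in> sets M"
  have [measurable]: "A \<in> sets borel" using A by simp
  have T[measurable]: "?T \<in> measurable ?N (borel \<Otimes>\<^sub>M M)" by measurable
  have "emeasure (distr ?N (borel \<Otimes>\<^sub>M M) ?T) (A \<times> B) = (\<integral>\<^sup>+x. indicator (A \<times> B) (?T x) \<partial>?N)"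
    by (subst nn_integral_indicator[symmetric], simp, subst nn_integral_distr) auto
  also have "\<dots> = (\<integral>\<^sup>+s. \<integral>\<^sup>+y. indicator (A \<times> B) (?T (s, y)) \<partial>((\<Pi>\<^sub>M i\<in>UNIV - {j}. lborel) \<Otimes>\<^sub>M M) \<partial>lborel)"
    by (subst FM.nn_integral_fst) auto
  also have "\<dots> = (\<integral>\<^sup>+s. \<integral>\<^sup>+f. \<integral>\<^sup>+\<omega>. indicator A (vec_insert j (s, f)) * indicator B \<omega> \<partial>M \<partial>(\<Pi>\<^sub>M i\<in>UNIV - {j}. lborel) \<partial>lborel)"
    by (intro nn_integral_cong, subst M.nn_integral_fst[symmetric]) (auto simp: indicator_times)
  also have "\<dots> = (\<integral>\<^sup>+s. \<integral>\<^sup>+f. indicator A (vec_insert j (s, f)) \<partial>(\<Pi>\<^sub>M i\<in>UNIV - {j}. lborel) \<partial>lborel) * emeasure M B"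
    by (simp add: nn_integral_cmult nn_integral_multc)
  also have "\<dots> = emeasure lborel A * emeasure M B"
    by (subst nn_integral_vec_insert[symmetric]) auto
  finally show "emeasure lborel A * emeasure M B = emeasure (distr ?N (borel \<Otimes>\<^sub>M M) ?T) (A \<times> B)"
    by simp
qed

text \<open>Cauchy-Schwarz for \<open>\<bar>v'\<bar> = (\<bar>v'\<bar> / sqrt v) * sqrt v\<close>.
  At zeros of \<open>v\<close> the factorisation survives because \<open>v'\<close> vanishes there
  too.\<close>

lemma prior_information_finite_imp_integrable:
  assumes [measurable]: "v \<in> borel_measurable borel" "v' \<in> borel_measurable borel"
    and v: "\<And>x. 0 \<le> v x" "\<And>x. v x = 0 \<Longrightarrow> v' x = 0"
    and int: "(\<integral>\<^sup>+ x. ennreal (v x) \<partial>lborel) < top"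
    and fin: "prior_information v v' < top"
  shows "integrable lborel v'"
proof (rule integrableI_bounded)
  have "(\<integral>\<^sup>+ x. ennreal \<bar>v' x\<bar> \<partial>lborel)\<^sup>2
      = (\<integral>\<^sup>+ x. ennreal (\<bar>v' x\<bar> / sqrt (v x)) * ennreal (sqrt (v x)) \<partial>lborel)\<^sup>2"
    by (intro arg_cong[where f="\<lambda>x. x\<^sup>2"] nn_integral_cong)
      (use v in \<open>auto simp: ennreal_mult'[symmetric]\<close>)
  also have "\<dots> \<le> (\<integral>\<^sup>+ x. (ennreal (\<bar>v' x\<bar> / sqrt (v x)))\<^sup>2 \<partial>lborel) * (\<integral>\<^sup>+ x. (ennreal (sqrt (v x)))\<^sup>2 \<partial>lborel)"
    by (rule Cauchy_Schwarz_nn_integral) measurable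
  also have "\<dots> = prior_information v v' * (\<integral>\<^sup>+ x. ennreal (v x) \<partial>lborel)"
    using v by (simp add: ennreal_power power_divide prior_information_def)
  also have "\<dots> < top" using int fin by (simp add: ennreal_mult_less_top)
  finally show "(\<integral>\<^sup>+ x. ennreal (norm (v' x)) \<partial>lborel) < \<infinity>"
    by (simp add: power_less_top_ennreal)
qed measurable

text \<open>The point \<open>x\<close> is a minimum of \<open>v\<close>, hence critical.\<close>

lemma nonneg_deriv_zero:
  fixes v :: "real \<Rightarrow> real"
  assumes "\<And>x. 0 \<le> v x" "(v has_real_derivative d) (at x)" "v x = 0"
  shows "d = 0"
  by (rule DERIV_local_min[OF assms(2), of 1]) (use assms in auto)

lemma prior_density_vec_insert:
  "prior_density u (vec_insert j (s, f)) = u j s * (\<Prod>i\<in>UNIV - {j}. u i (f i))"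
  unfolding prior_density_def by (subst prod.remove[of _ j]) (auto simp: vec_insert_nth intro!: prod.cong)

text \<open>All factors of the product prior other than \<open>u j\<close> integrate to one.\<close>

lemma nn_integral_prior_marginal:
  fixes u :: "'d::finite \<Rightarrow> real \<Rightarrow> real"
  assumes [measurable]: "\<And>i. u i \<in> borel_measurable borel" "h \<in> borel_measurable borel"
    and u: "\<And>i x. 0 \<le> u i x" "\<And>i. (\<integral>\<^sup>+ x. ennreal (u i x) \<partial>lborel) = 1"
  shows "(\<integral>\<^sup>+\<theta>. h (\<theta> $ j) * ennreal (prior_density u \<theta>) \<partial>lborel) = (\<integral>\<^sup>+s. h s * ennreal (u j s) \<partial>lborel)"
proof -
  interpret product_sigma_finite "\<lambda>_. lborel :: real measure" by standard
  have [measurable]: "(\<lambda>\<theta>::real ^ 'd. \<theta> $ i) \<in> borel_measurable borel" for i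
    by (intro borel_measurable_continuous_onI continuous_intros)
  have [measurable]: "prior_density u \<in> borel_measurable borel"
    unfolding prior_density_def by measurable
  have "(\<integral>\<^sup>+\<theta>. h (\<theta> $ j) * ennreal (prior_density u \<theta>) \<partial>lborel)
     = (\<integral>\<^sup>+s. \<integral>\<^sup>+f. (h s * ennreal (u j s)) * (\<Prod>i\<in>UNIV - {j}. ennreal (u i (f i))) \<partial>(\<Pi>\<^sub>M i\<in>UNIV - {j}. lborel) \<partial>lborel)"
    using u by (subst nn_integral_vec_insert[where j=j])
      (auto simp: prior_density_vec_insert vec_insert_nth ennreal_mult' prod_ennreal prod_nonneg mult.assoc)
  also have "\<dots> = (\<integral>\<^sup>+s. h s * ennreal (u j s) \<partial>lborel)"
  proof -
    have "(\<integral>\<^sup>+f. (\<Prod>i\<in>UNIV - {j}. ennreal (u i (f i))) \<partial>(\<Pi>\<^sub>M i\<in>UNIV - {j}. lborel)) = 1"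
      by (subst product_nn_integral_prod) (auto simp: u)
    then show ?thesis by (subst nn_integral_cmult) auto
  qed
  finally show ?thesis .
qed

text \<open>
  The factor \<open>exp (t * b \<omega> - t\<^sup>2 * q / 2)\<close> is the likelihood ratio of the parameter value \<open>\<theta> $ j = t\<close> to
  \<open>\<theta> $ j = 0\<close>, and \<open>k \<theta>\<close> is the estimator evaluated at the data generated with \<open>\<theta> $ j\<close> replaced by \<open>0\<close>.
  Then \<open>b \<omega> - t * q\<close> is the score and \<open>q\<close> the Fisher information.
\<close>

lemma van_trees_inequality:
  fixes M :: "'w measure" and u u' :: "'d::finite \<Rightarrow> real \<Rightarrow> real"
    and g :: "real ^ 'd \<Rightarrow> real" and g' :: "real ^ 'd \<Rightarrow> real ^ 'd"
    and k :: "real ^ 'd \<Rightarrow> 'w \<Rightarrow> real" and b :: "'w \<Rightarrow> real" and q :: real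
  assumes "prob_space M"
    and k[measurable]: "(\<lambda>x. k (fst x) (snd x)) \<in> borel_measurable (borel \<Otimes>\<^sub>M M)"
    and k_indep: "\<And>s s' f \<omega>. k (vec_insert j (s, f)) \<omega> = k (vec_insert j (s', f)) \<omega>"
    and b[measurable]: "b \<in> borel_measurable M" and q: "0 \<le> q" "\<And>\<omega>. q = 0 \<Longrightarrow> b \<omega> = 0"
    and E1: "\<And>t. (\<integral>\<^sup>+\<omega>. ennreal (exp (t * b \<omega> - t\<^sup>2 * q / 2)) \<partial>M) = 1"
    and E2: "\<And>t r. (\<integral>\<^sup>+\<omega>. ennreal ((b \<omega> - t * q + r)\<^sup>2 * exp (t * b \<omega> - t\<^sup>2 * q / 2)) \<partial>M) = ennreal (q + r\<^sup>2)"
    and u: "\<And>i x. 0 \<le> u i x" "\<And>i. (\<integral>\<^sup>+ x. ennreal (u i x) \<partial>lborel) = 1"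
      "\<And>i x. (u i has_real_derivative u' i x) (at x)" "\<And>i. continuous_on UNIV (u' i)"
    and g: "\<And>\<theta>. (g has_derivative (\<lambda>h. g' \<theta> \<bullet> h)) (at \<theta>)" "continuous_on UNIV g'"
      "\<And>\<theta>. ((\<lambda>s. g (\<chi> k. if k = j then s else \<theta> $ k) * u j s) \<longlongrightarrow> 0) at_infinity"
      "integrable lborel (\<lambda>\<theta>. \<bar>g' \<theta> $ j\<bar> * prior_density u \<theta>)"
  shows "ennreal ((LINT \<theta>|lborel. g' \<theta> $ j * prior_density u \<theta>)\<^sup>2) / (ennreal q + prior_information (u j) (u' j))
     \<le> (\<integral>\<^sup>+\<theta>. (\<integral>\<^sup>+\<omega>. ennreal ((k \<theta> \<omega> - g \<theta>)\<^sup>2 * exp (\<theta> $ j * b \<omega> - (\<theta> $ j)\<^sup>2 * q / 2)) \<partial>M)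
          * ennreal (prior_density u \<theta>) \<partial>lborel)"
    (is "_ / (_ + ?I) \<le> ?B")
proof (cases "?I = top \<or> ?B = top")
  \<comment> \<open>Division by \<open>top\<close> gives \<open>0\<close>, and anything is at most
    \<open>top\<close>.\<close>
  case True
  then show ?thesis by (auto simp: ennreal_divide_top)
next
  case False
  then have I: "?I < top" and B: "?B < top" by (auto simp: top.not_eq_extremum)
  interpret prob_space M by fact
  interpret product_sigma_finite "\<lambda>_. lborel :: real measure" by standard
  interpret F: finite_product_sigma_finite "\<lambda>_. lborel :: real measure" "UNIV - {j}" by standard auto
  let ?P = "\<Pi>\<^sub>M i\<in>UNIV - {j}. lborel :: real measure"
  interpret FM: pair_sigma_finite ?P M by standard
  let ?N = "lborel \<Otimes>\<^sub>M (?P \<Otimes>\<^sub>M M)"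
  define T :: "real \<times> ('d \<Rightarrow> real) \<times> 'w \<Rightarrow> (real ^ 'd) \<times> 'w"
    where "T x = (vec_insert j (fst x, fst (snd x)), snd (snd x))" for x
  have T[measurable]: "T \<in> measurable ?N (borel \<Otimes>\<^sub>M M)"
    unfolding T_def by measurable
  have distrT: "distr ?N (borel \<Otimes>\<^sub>M M) T = lborel \<Otimes>\<^sub>M M"
    unfolding T_def by (rule distr_vec_insert_pair) standard
  have [measurable]: "(\<lambda>\<theta>::real ^ 'd. \<theta> $ i) \<in> borel_measurable borel" for i
    by (intro borel_measurable_continuous_onI continuous_intros)
  have [measurable]: "u i \<in> borel_measurable borel" for i
    using u(3) by (intro borel_measurable_continuous_onI DERIV_continuous_on) (auto intro: has_field_derivative_at_within)
  have [measurable]: "u' i \<in> borel_measurable borel" for i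
    using u(4) by (intro borel_measurable_continuous_onI)
  have [measurable]: "g \<in> borel_measurable borel"
    using g(1) by (intro borel_measurable_continuous_onI has_derivative_continuous_on) (auto intro: has_derivative_at_withinI)
  have [measurable]: "g' \<in> borel_measurable borel"
    using g(2) by (intro borel_measurable_continuous_onI)
  have [measurable]: "k \<theta> \<in> borel_measurable M" for \<theta>
    using measurable_compose[OF measurable_Pair1'[of \<theta> borel M] k] by simp
  have U[measurable]: "prior_density u \<in> borel_measurable borel"
    unfolding prior_density_def by measurable
  have U0: "0 \<le> prior_density u \<theta>" for \<theta> unfolding prior_density_def using u(1) by (simp add: prod_nonneg)
  have u'0: "u' i x = 0" if "u i x = 0" for i x
    using nonneg_deriv_zero[OF u(1) u(3) that] .
  define E where "E t \<omega> = exp (t * b \<omega> - t\<^sup>2 * q / 2)" for t \<omega>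
  \<comment> \<open>Score of the prior. Division by zero sets it to \<open>0\<close> where
    \<open>u j\<close> vanishes, in agreement with \<open>u' j\<close> being \<open>0\<close>
    there.\<close>
  define r where "r s = u' j s / u j s" for s
  define D where "D = (\<lambda>(\<theta>, \<omega>). k \<theta> \<omega> - g \<theta>)"
  \<comment> \<open>Joint density of the parameter and the underlying randomness, relative to
    Lebesgue measure times \<open>M\<close>.\<close>
  define W where "W = (\<lambda>(\<theta>, \<omega>). E (\<theta> $ j) \<omega> * prior_density u \<theta>)"
  define S where "S = (\<lambda>(\<theta>, \<omega>). b \<omega> - \<theta> $ j * q + r (\<theta> $ j))"
  define G where "G = (\<lambda>(\<theta>, \<omega>::'w). g' \<theta> $ j)"
  have [measurable]: "r \<in> borel_measurable borel" unfolding r_def by measurable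
  have E[measurable]: "(\<lambda>x. E (f x) (h x)) \<in> borel_measurable K"
    if [measurable]: "f \<in> borel_measurable K" "h \<in> measurable K M" for f h and K :: "'k measure"
    unfolding E_def by measurable
  have [measurable]: "D \<in> borel_measurable (borel \<Otimes>\<^sub>M M)" "W \<in> borel_measurable (borel \<Otimes>\<^sub>M M)"
    "S \<in> borel_measurable (borel \<Otimes>\<^sub>M M)" "G \<in> borel_measurable (borel \<Otimes>\<^sub>M M)"
    unfolding D_def W_def S_def G_def split_beta' by measurable
  have E0: "0 < E t \<omega>" for t \<omega> by (simp add: E_def)
  have W0: "0 \<le> W x" for x using U0 E0 by (auto simp: W_def split_beta' less_imp_le)
  have transT: "(\<integral>\<^sup>+x. H (T x) \<partial>?N) = (\<integral>\<^sup>+\<theta>. \<integral>\<^sup>+\<omega>. H (\<theta>, \<omega>) \<partial>M \<partial>lborel)"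
    if [measurable]: "H \<in> borel_measurable (borel \<Otimes>\<^sub>M M)" for H :: "(real ^ 'd) \<times> 'w \<Rightarrow> ennreal"
  proof -
    have "(\<integral>\<^sup>+x. H (T x) \<partial>?N) = (\<integral>\<^sup>+x. H x \<partial>(lborel \<Otimes>\<^sub>M M))"
      by (subst distrT[symmetric], subst nn_integral_distr) auto
    also have "\<dots> = (\<integral>\<^sup>+\<theta>. \<integral>\<^sup>+\<omega>. H (\<theta>, \<omega>) \<partial>M \<partial>lborel)"
      by (subst nn_integral_fst) (auto cong: measurable_cong_sets sets_pair_measure_cong)
    finally show ?thesis .
  qed
  have D2: "(\<integral>\<^sup>+x. ennreal ((D (T x))\<^sup>2 * W (T x)) \<partial>?N) = ?B"
    by (subst transT[of "\<lambda>x. ennreal ((D x)\<^sup>2 * W x)"], measurable, intro nn_integral_cong, subst nn_integral_multc[symmetric])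
      (auto simp: D_def W_def E_def U0 ennreal_mult'[symmetric] mult.assoc intro!: nn_integral_cong)
  \<comment> \<open>For fixed theta, \<open>E2\<close> with the constant
    \<open>r (\<theta> $ j)\<close> contains no mixed term. Averaging over the prior keeps
    \<open>q\<close> and turns the square of the prior score into the prior information.\<close>
  have S2: "(\<integral>\<^sup>+x. ennreal ((S (T x))\<^sup>2 * W (T x)) \<partial>?N) = ennreal q + ?I"
  proof -
    have "(\<integral>\<^sup>+x. ennreal ((S (T x))\<^sup>2 * W (T x)) \<partial>?N)
        = (\<integral>\<^sup>+\<theta>. \<integral>\<^sup>+\<omega>. ennreal ((b \<omega> - \<theta> $ j * q + r (\<theta> $ j))\<^sup>2 * E (\<theta> $ j) \<omega>) * ennreal (prior_density u \<theta>) \<partial>M \<partial>lborel)"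
      by (subst transT[of "\<lambda>x. ennreal ((S x)\<^sup>2 * W x)"], measurable, intro nn_integral_cong)
       (auto simp: S_def W_def U0 ennreal_mult''[symmetric] mult.assoc)
    also have "\<dots> = (\<integral>\<^sup>+\<theta>. ennreal (q + (r (\<theta> $ j))\<^sup>2) * ennreal (prior_density u \<theta>) \<partial>lborel)"
      by (intro nn_integral_cong, subst nn_integral_multc) (auto simp: E_def E2)
    also have "\<dots> = (\<integral>\<^sup>+s. ennreal (q + (r s)\<^sup>2) * ennreal (u j s) \<partial>lborel)"
      by (rule nn_integral_prior_marginal) (use u in auto)
    also have "\<dots> = (\<integral>\<^sup>+s. ennreal q * ennreal (u j s) + ennreal ((u' j s)\<^sup>2 / u j s) \<partial>lborel)"
    proof (rule nn_integral_cong)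
      fix s
      have "(r s)\<^sup>2 * u j s = (u' j s)\<^sup>2 / u j s"
        by (simp add: r_def power2_eq_square)
      then show "ennreal (q + (r s)\<^sup>2) * ennreal (u j s) = ennreal q * ennreal (u j s) + ennreal ((u' j s)\<^sup>2 / u j s)"
        using q(1) u(1)[of j s] by (simp add: ennreal_mult'[symmetric] ennreal_plus[symmetric] algebra_simps del: ennreal_plus)
    qed
    also have "\<dots> = ennreal q + ?I"
      using u(2)[of j] by (subst nn_integral_add) (auto simp: nn_integral_cmult prior_information_def)
    finally show ?thesis .
  qed
  have GWnn: "(\<integral>\<^sup>+x. ennreal (norm (G (T x) * W (T x))) \<partial>?N) < \<infinity>"
  proof -
    have "(\<integral>\<^sup>+x. ennreal (norm (G (T x) * W (T x))) \<partial>?N)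
      = (\<integral>\<^sup>+\<theta>. \<integral>\<^sup>+\<omega>. ennreal (\<bar>g' \<theta> $ j\<bar> * prior_density u \<theta>) * ennreal (E (\<theta> $ j) \<omega>) \<partial>M \<partial>lborel)"
      using E0 by (subst transT[of "\<lambda>x. ennreal (norm (G x * W x))"], measurable, intro nn_integral_cong)
       (auto simp: G_def W_def U0 ennreal_mult'[symmetric] abs_mult less_imp_le algebra_simps)
    also have "\<dots> = (\<integral>\<^sup>+\<theta>. ennreal (\<bar>g' \<theta> $ j\<bar> * prior_density u \<theta>) \<partial>lborel)"
      by (intro nn_integral_cong, subst nn_integral_cmult) (auto simp: E_def E1)
    also have "\<dots> < \<infinity>"
      using g(4) U0 by (simp add: integrable_iff_bounded abs_mult)
    finally show ?thesis .
  qed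
  have GWint: "integrable ?N (\<lambda>x. G (T x) * W (T x))"
    by (rule integrableI_bounded[OF _ GWnn]) measurable
  have GW: "(LINT x|?N. G (T x) * W (T x)) = (LINT \<theta>|lborel. g' \<theta> $ j * prior_density u \<theta>)"
  proof -
    have i: "integrable (lborel \<Otimes>\<^sub>M M) (\<lambda>x. G x * W x)"
      using GWint by (subst distrT[symmetric], subst integrable_distr_eq) auto
    interpret LM: pair_sigma_finite "lborel :: (real ^ 'd) measure" M by standard
    have "(LINT x|?N. G (T x) * W (T x)) = (LINT x|(lborel \<Otimes>\<^sub>M M). G x * W x)"
      by (subst distrT[symmetric], subst integral_distr) auto
    also have "\<dots> = (LINT \<theta>|lborel. LINT \<omega>|M. G (\<theta>, \<omega>) * W (\<theta>, \<omega>))"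
      using LM.integral_fst[of "\<lambda>\<theta> \<omega>. G (\<theta>, \<omega>) * W (\<theta>, \<omega>)"] i by (simp add: split_beta')
    also have "\<dots> = (LINT \<theta>|lborel. g' \<theta> $ j * prior_density u \<theta>)"
    proof (rule Bochner_Integration.integral_cong[OF refl])
      fix \<theta> :: "real ^ 'd"
      have "(LINT \<omega>|M. E (\<theta> $ j) \<omega>) = 1"
        using E1[of "\<theta> $ j"] by (intro integral_eq_nn_integral[THEN trans]) (auto simp: E_def)
      then show "(LINT \<omega>|M. G (\<theta>, \<omega>) * W (\<theta>, \<omega>)) = g' \<theta> $ j * prior_density u \<theta>"
        by (simp add: G_def W_def mult.assoc[symmetric] mult.commute[of "E _ _"])
    qed
    finally show ?thesis .
  qed
  \<comment> \<open>Prepares the boundary term: the decay hypothesis speaks of \<open>g\<close>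
    times \<open>u j\<close> only.\<close>
  have u_lim: "(u j \<longlongrightarrow> 0) at_infinity"
  proof (rule density_tendsto_0_at_infinity[OF u(3,4,1)])
    show "(\<integral>\<^sup>+ x. ennreal (u j x) \<partial>lborel) < \<infinity>" using u(2) by simp
    show "integrable lborel (u' j)"
      by (rule prior_information_finite_imp_integrable[OF _ _ u(1) u'0 _ I]) (use u(2) in auto)
  qed
  obtain A where A: "?B = ennreal A" "0 \<le> A" using B by (cases ?B) auto
  obtain C where C: "?I = ennreal C" "0 \<le> C" using I by (cases ?I) auto
  have "(LINT x|?N. G (T x) * W (T x))\<^sup>2 \<le> A * (q + C)"
  proof (rule score_cauchy_schwarz[where D="\<lambda>x. D (T x)" and S="\<lambda>x. S (T x)"])
    show "sigma_finite_measure (?P \<Otimes>\<^sub>M M)" by standard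
    fix p assume p: "p \<in> space (?P \<Otimes>\<^sub>M M)"
    obtain f \<omega> where fw: "p = (f, \<omega>)" by (cases p)
    define V where "V = (\<Prod>i\<in>UNIV - {j}. u i (f i))"
    \<comment> \<open>Along the line through theta in direction \<open>j\<close>, with
      \<open>\<omega>\<close> fixed, the estimator is this constant; the choice of \<open>0\<close>
      as base point is immaterial by \<open>k_indep\<close>.\<close>
    define c where "c = k (vec_insert j (0, f)) \<omega>"
    define h where "h s = g (vec_insert j (s, f))" for s
    have V0: "0 \<le> V" unfolding V_def using u(1) by (simp add: prod_nonneg)
    have DT: "D (T (s, p)) = c - h s" for s
      using k_indep[of s f \<omega> 0] by (simp add: D_def T_def fw c_def h_def)
    have WT: "W (T (s, p)) = E s \<omega> * u j s * V" for s
      by (simp add: W_def T_def fw vec_insert_nth prior_density_vec_insert V_def)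
    have ST: "S (T (s, p)) = b \<omega> - s * q + r s" for s
      by (simp add: S_def T_def fw vec_insert_nth)
    have GT: "G (T (s, p)) = g' (vec_insert j (s, f)) $ j" for s
      by (simp add: G_def T_def fw)
    have vi: "(\<lambda>s. vec_insert j (s, f)) = (\<lambda>s. vec_insert j (0, f) + s *\<^sub>R axis j 1)"
      by (rule ext) (simp add: vec_eq_iff vec_insert_nth axis_def)
    have vd: "((\<lambda>s. vec_insert j (s, f)) has_derivative (\<lambda>t. t *\<^sub>R axis j 1)) (at s)" for s
      by (subst vi) (rule derivative_eq_intros refl | simp)+
    have h': "(h has_real_derivative g' (vec_insert j (s, f)) $ j) (at s)" for s
    proof -
      have "h = g \<circ> (\<lambda>s. vec_insert j (s, f))"
        and "(*) (g' (vec_insert j (s, f)) $ j) = (\<lambda>t. g' (vec_insert j (s, f)) \<bullet> t) \<circ> (\<lambda>t. t *\<^sub>R axis j 1)"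
        by (simp_all add: fun_eq_iff h_def inner_axis)
      then show ?thesis
        using diff_chain_at[OF vd g(1), of s] by (simp only: has_field_derivative_def)
    qed
    have E': "((\<lambda>s. E s \<omega>) has_real_derivative (b \<omega> - s * q) * E s \<omega>) (at s)" for s
      unfolding E_def by (auto intro!: derivative_eq_intros simp: algebra_simps)
    \<comment> \<open>Rewrites the score without division: \<open>r s * u j s = u' j s\<close> holds
      at zeros of \<open>u j\<close> as well. Differentiability and continuity are read off from
      this form.\<close>
    have form: "D (T (s, p)) * S (T (s, p)) * W (T (s, p)) - G (T (s, p)) * W (T (s, p))
      = (c - h s) * ((b \<omega> - s * q) * u j s + u' j s) * E s \<omega> * V
          - g' (vec_insert j (s, f)) $ j * (E s \<omega> * u j s * V)" for s
    proof -
      have "r s * u j s = u' j s" using u'0 by (cases "u j s = 0") (auto simp: r_def)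
      then have "(b \<omega> - s * q) * u j s + u' j s = (b \<omega> - s * q + r s) * u j s" by (simp add: algebra_simps)
      then show ?thesis by (simp add: DT WT ST GT)
    qed
    show "((\<lambda>s. D (T (s, p)) * W (T (s, p))) has_real_derivative
       D (T (s, p)) * S (T (s, p)) * W (T (s, p)) - G (T (s, p)) * W (T (s, p))) (at s)" for s
      unfolding form unfolding DT WT
      by (rule derivative_eq_intros h' E' u(3) refl)+ (simp add: algebra_simps)
    have "continuous_on UNIV (\<lambda>s. vec_insert j (s, f))"
      by (subst vi) (intro continuous_intros)
    then have "continuous_on UNIV (\<lambda>s. g' (vec_insert j (s, f)))"
      by (rule continuous_on_compose2[OF g(2)]) auto
    moreover have "continuous_on UNIV h" "continuous_on UNIV (u j)" "continuous_on UNIV (\<lambda>s. E s \<omega>)"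
      by (rule continuous_at_imp_continuous_on, rule ballI, rule DERIV_isCont, rule h' u(3) E')+
    ultimately show "continuous_on UNIV (\<lambda>s. D (T (s, p)) * S (T (s, p)) * W (T (s, p)) - G (T (s, p)) * W (T (s, p)))"
      unfolding form by (intro continuous_intros u(4)) 
    \<comment> \<open>Completing the square in \<open>s\<close> bounds the likelihood ratio
      uniformly in \<open>s\<close>. For \<open>q = 0\<close> both sides equal one, since then
      \<open>b \<omega> = 0\<close>.\<close>
    have "E s \<omega> \<le> exp ((b \<omega>)\<^sup>2 / (2 * q))" for s
    proof (cases "q = 0")
      case False
      then have "q > 0" using q(1) by simp
      moreover have "0 \<le> (b \<omega> - s * q)\<^sup>2" by simp
      ultimately show ?thesis
        by (simp add: E_def field_simps power2_eq_square)
    qed (simp add: E_def q(2))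
    then obtain K where K: "\<And>s. E s \<omega> \<le> K" by blast
    \<comment> \<open>The boundary term splits into \<open>c\<close> times \<open>u j\<close>,
      controlled by \<open>u_lim\<close>, and \<open>h\<close> times \<open>u j\<close>, controlled
      by the decay hypothesis. The likelihood ratio is a bounded factor.\<close>
    have "((\<lambda>s. g (\<chi> i. if i = j then s else vec_insert j (0, f) $ i) * u j s) \<longlongrightarrow> 0) at_infinity"
      by (rule g(3))
    moreover have "(\<chi> i. if i = j then s else vec_insert j (0, f) $ i) = vec_insert j (s, f)" for s
      by (simp add: vec_eq_iff vec_insert_nth)
    ultimately have "((\<lambda>s. h s * u j s) \<longlongrightarrow> 0) at_infinity" by (simp add: h_def)
    then have "((\<lambda>s. c * u j s - h s * u j s) \<longlongrightarrow> c * 0 - 0) at_infinity"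
      by (intro tendsto_intros u_lim)
    then have lim: "((\<lambda>s. (c - h s) * u j s) \<longlongrightarrow> 0) at_infinity" by (simp add: algebra_simps)
    show "((\<lambda>s. D (T (s, p)) * W (T (s, p))) \<longlongrightarrow> 0) at_infinity"
    proof (rule tendsto_0_le[OF lim])
      show "\<forall>\<^sub>F s in at_infinity. norm (D (T (s, p)) * W (T (s, p))) \<le> norm ((c - h s) * u j s) * (K * V)"
      proof (rule always_eventually, rule allI)
        fix s
        have "E s \<omega> * V \<le> K * V" using K V0 by (intro mult_right_mono) auto
        then have "norm ((c - h s) * u j s) * (E s \<omega> * V) \<le> norm ((c - h s) * u j s) * (K * V)"
          by (intro mult_left_mono) auto
        then show "norm (D (T (s, p)) * W (T (s, p))) \<le> norm ((c - h s) * u j s) * (K * V)"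
          using E0[of s \<omega>] V0 by (simp add: DT WT abs_mult mult_ac)
      qed
    qed
  next
    show "(\<integral>\<^sup>+x. ennreal ((D (T x))\<^sup>2 * W (T x)) \<partial>?N) = ennreal A" using D2 A by simp
    show "(\<integral>\<^sup>+x. ennreal ((S (T x))\<^sup>2 * W (T x)) \<partial>?N) = ennreal (q + C)" using S2 C q by simp
  qed (use W0 GWint A C q in auto)
  then have le: "(LINT \<theta>|lborel. g' \<theta> $ j * prior_density u \<theta>)\<^sup>2 \<le> A * (q + C)" (is "?e \<le> _")
    by (simp add: GW)
  show ?thesis
  proof (cases "q + C = 0")
    \<comment> \<open>Zero total information forces the numerator to vanish, and
      \<open>0 / 0\<close> is \<open>0\<close>.\<close>
    case True
    then show ?thesis using le by simp
  next
    case False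
    then have "q + C > 0" using q(1) C(2) by simp
    then have "ennreal ?e / ennreal (q + C) \<le> ennreal A"
      using le A(2) by (subst divide_ennreal) (auto simp: field_simps intro!: ennreal_leI)
    then show ?thesis using A C q(1) by simp
  qed
qed

section \<open>Shifts of Gaussian vectors\<close>

text \<open>The one-dimensional Cameron-Martin formula: expanding the square in the shifted density
  leaves the original density times the exponential.\<close>

lemma normal_density_shift:
  fixes \<sigma> c :: real
  assumes \<sigma>: "0 < \<sigma>"
  defines "N \<equiv> density lborel (normal_density 0 \<sigma>)"
  shows "distr N borel (\<lambda>x. x + c) = density N (\<lambda>x. ennreal (exp (c * x / \<sigma>\<^sup>2 - c\<^sup>2 / (2 * \<sigma>\<^sup>2))))"
proof (rule measure_eqI)
  fix A assume "A \<in> sets (distr N borel (\<lambda>x. x + c))"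
  then have A[measurable]: "A \<in> sets borel" by simp
  have "emeasure (distr N borel (\<lambda>x. x + c)) A = (\<integral>\<^sup>+x. indicator A (x + c) \<partial>N)"
    by (subst nn_integral_indicator[symmetric], simp, subst nn_integral_distr) (auto simp: N_def)
  also have "\<dots> = (\<integral>\<^sup>+x. ennreal (normal_density 0 \<sigma> x) * indicator A (x + c) \<partial>lborel)"
    unfolding N_def by (subst nn_integral_density) auto
  also have "\<dots> = (\<integral>\<^sup>+x. ennreal (normal_density 0 \<sigma> (x - c)) * indicator A x \<partial>lborel)"
    by (subst nn_integral_real_affine[where c=1 and t="-c"]) auto
  also have "\<dots> = (\<integral>\<^sup>+x. ennreal (normal_density 0 \<sigma> x) * (ennreal (exp (c * x / \<sigma>\<^sup>2 - c\<^sup>2 / (2 * \<sigma>\<^sup>2))) * indicator A x) \<partial>lborel)"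
  proof (rule nn_integral_cong)
    fix x
    have "- (x - c)\<^sup>2 / (2 * \<sigma>\<^sup>2) = - x\<^sup>2 / (2 * \<sigma>\<^sup>2) + (c * x / \<sigma>\<^sup>2 - c\<^sup>2 / (2 * \<sigma>\<^sup>2))"
      using \<sigma> by (simp add: field_simps power2_eq_square)
    then have "normal_density 0 \<sigma> (x - c) = normal_density 0 \<sigma> x * exp (c * x / \<sigma>\<^sup>2 - c\<^sup>2 / (2 * \<sigma>\<^sup>2))"
      unfolding normal_density_def by (simp add: exp_add[symmetric])
    then show "ennreal (normal_density 0 \<sigma> (x - c)) * indicator A x
        = ennreal (normal_density 0 \<sigma> x) * (ennreal (exp (c * x / \<sigma>\<^sup>2 - c\<^sup>2 / (2 * \<sigma>\<^sup>2))) * indicator A x)"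
      by (simp add: ennreal_mult mult.assoc)
  qed
  also have "\<dots> = emeasure (density N (\<lambda>x. ennreal (exp (c * x / \<sigma>\<^sup>2 - c\<^sup>2 / (2 * \<sigma>\<^sup>2))))) A"
    unfolding N_def by (subst emeasure_density, measurable, subst nn_integral_density) auto
  finally show "emeasure (distr N borel (\<lambda>x. x + c)) A =
      emeasure (density N (\<lambda>x. ennreal (exp (c * x / \<sigma>\<^sup>2 - c\<^sup>2 / (2 * \<sigma>\<^sup>2))))) A" .
qed (simp add: N_def)

text \<open>Both sides are identified with the product of the one-dimensional shifted laws
  \<open>K i\<close>, by comparison on product sets.\<close>

lemma PiM_normal_shift:
  fixes \<sigma> c :: "'i \<Rightarrow> real"
  assumes I: "finite I" and \<sigma>: "\<And>i. 0 < \<sigma> i"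
  defines "N \<equiv> \<lambda>i. density lborel (normal_density 0 (\<sigma> i))"
  shows "distr (PiM I N) (\<Pi>\<^sub>M i\<in>I. borel) (\<lambda>x. \<lambda>i\<in>I. x i + c i)
    = density (PiM I N) (\<lambda>x. \<Prod>i\<in>I. ennreal (exp (c i * x i / (\<sigma> i)\<^sup>2 - (c i)\<^sup>2 / (2 * (\<sigma> i)\<^sup>2))))"
    (is "?L = ?R")
proof -
  have pN: "prob_space (N i)" for i unfolding N_def using \<sigma> by (rule prob_space_normal_density)
  have sN[measurable_cong, simp]: "sets (N i) = sets borel" for i by (simp add: N_def)
  define K where "K i = distr (N i) borel (\<lambda>x. x + c i)" for i
  define e where "e i x = ennreal (exp (c i * x / (\<sigma> i)\<^sup>2 - (c i)\<^sup>2 / (2 * (\<sigma> i)\<^sup>2)))" for i x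
  have e[measurable]: "e i \<in> borel_measurable borel" for i unfolding e_def by measurable
  have K: "K i = density (N i) (e i)" for i
    unfolding K_def N_def e_def using \<sigma> by (rule normal_density_shift)
  have pK: "prob_space (K i)" for i unfolding K_def by (rule prob_space.prob_space_distr[OF pN]) simp
  interpret N: product_sigma_finite N
    by (simp add: product_sigma_finite_def pN prob_space_imp_sigma_finite)
  interpret K: product_sigma_finite K
    by (simp add: product_sigma_finite_def pK prob_space_imp_sigma_finite)
  have sK[simp]: "sets (K i) = sets borel" for i by (simp add: K_def)
  have spN[simp]: "space (N i) = UNIV" for i by (simp add: N_def)
  have T[measurable]: "(\<lambda>x. \<lambda>i\<in>I. x i + c i) \<in> measurable (PiM I N) (\<Pi>\<^sub>M i\<in>I. borel)"
    by measurable
  have "?L = PiM I K"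
  proof (rule K.PiM_eqI[OF I])
    show "sets ?L = sets (PiM I K)" by (simp cong: sets_PiM_cong)
    fix A assume A: "\<And>i. i \<in> I \<Longrightarrow> A i \<in> sets (K i)"
    have [measurable]: "i \<in> I \<Longrightarrow> A i \<in> sets borel" for i using A[of i] by simp
    have eq: "(\<lambda>x. \<lambda>i\<in>I. x i + c i) -` (Pi\<^sub>E I A) \<inter> space (PiM I N) = (\<Pi>\<^sub>E i\<in>I. (\<lambda>x. x + c i) -` A i)"
      by (auto simp: space_PiM PiE_iff)
    have m: "(\<lambda>x. x + c i) -` A i \<in> sets borel" if "i \<in> I" for i
      using measurable_sets[of "\<lambda>x. x + c i" borel borel "A i"] that by simp
    have "emeasure ?L (Pi\<^sub>E I A) = emeasure (PiM I N) (\<Pi>\<^sub>E i\<in>I. (\<lambda>x. x + c i) -` A i)"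
      using I by (subst emeasure_distr) (auto simp: eq intro!: sets_PiM_I_finite)
    also have "\<dots> = (\<Prod>i\<in>I. emeasure (N i) ((\<lambda>x. x + c i) -` A i))"
      using I m by (subst N.emeasure_PiM) auto
    also have "\<dots> = (\<Prod>i\<in>I. emeasure (K i) (A i))"
      unfolding K_def by (intro prod.cong refl) (auto simp: emeasure_distr)
    finally show "emeasure ?L (Pi\<^sub>E I A) = (\<Prod>i\<in>I. emeasure (K i) (A i))" .
  qed
  also have "PiM I K = density (PiM I N) (\<lambda>x. \<Prod>i\<in>I. e i (x i))"
  proof (rule K.PiM_eqI[OF I, symmetric])
    show "sets (density (PiM I N) (\<lambda>x. \<Prod>i\<in>I. e i (x i))) = sets (PiM I K)" by (simp cong: sets_PiM_cong)
    fix A assume A: "\<And>i. i \<in> I \<Longrightarrow> A i \<in> sets (K i)"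
    have [measurable]: "i \<in> I \<Longrightarrow> A i \<in> sets borel" for i using A[of i] by simp
    have "emeasure (density (PiM I N) (\<lambda>x. \<Prod>i\<in>I. e i (x i))) (Pi\<^sub>E I A)
       = (\<integral>\<^sup>+x. (\<Prod>i\<in>I. e i (x i)) * indicator (Pi\<^sub>E I A) x \<partial>PiM I N)"
      using I by (intro emeasure_density) (auto intro!: sets_PiM_I_finite)
    also have "\<dots> = (\<integral>\<^sup>+x. (\<Prod>i\<in>I. e i (x i) * indicator (A i) (x i)) \<partial>PiM I N)"
    proof (rule nn_integral_cong)
      fix x assume x: "x \<in> space (PiM I N)"
      have "(indicator (Pi\<^sub>E I A) x :: ennreal) = (\<Prod>i\<in>I. indicator (A i) (x i))"
      proof (cases "x \<in> Pi\<^sub>E I A")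
        case True then show ?thesis by (auto simp: PiE_iff)
      next
        case False
        with x obtain i where i: "i \<in> I" "x i \<notin> A i" by (auto simp: PiE_iff space_PiM)
        then have "\<exists>i\<in>I. (indicator (A i) (x i) :: ennreal) = 0" by (intro bexI[of _ i]) simp_all
        then show ?thesis using False I by (subst prod_zero) auto
      qed
      then show "(\<Prod>i\<in>I. e i (x i)) * indicator (Pi\<^sub>E I A) x = (\<Prod>i\<in>I. e i (x i) * indicator (A i) (x i))"
        by (simp add: prod.distrib)
    qed
    also have "\<dots> = (\<Prod>i\<in>I. \<integral>\<^sup>+x. e i x * indicator (A i) x \<partial>N i)"
      using I by (intro N.product_nn_integral_prod) auto
    also have "\<dots> = (\<Prod>i\<in>I. emeasure (K i) (A i))"
      unfolding K by (intro prod.cong refl) (auto simp: emeasure_density)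
    finally show "emeasure (density (PiM I N) (\<lambda>x. \<Prod>i\<in>I. e i (x i))) (Pi\<^sub>E I A) = (\<Prod>i\<in>I. emeasure (K i) (A i))" .
  qed
  finally show ?thesis unfolding e_def .
qed

text \<open>By \<open>XY\<close> the joint law is a product, so Tonelli allows \<open>Y\<close> to
  be held fixed while the Gaussian vector is shifted. \<open>Y\<close> stands for the jump
  information and may take values in any space.\<close>

lemma (in prob_space) gaussian_shift:
  fixes X :: "'i \<Rightarrow> 'a \<Rightarrow> real" and \<sigma> c :: "'i \<Rightarrow> real" and G :: "'b measure"
  assumes I: "finite I" "I \<noteq> {}" and \<sigma>: "\<And>i. i \<in> I \<Longrightarrow> 0 < \<sigma> i"
    and X: "\<And>i. i \<in> I \<Longrightarrow> distributed M lborel (X i) (normal_density 0 (\<sigma> i))"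
    and indep: "indep_vars (\<lambda>_. borel) X I"
    and Y[measurable]: "Y \<in> measurable M G"
    and XY: "distr M ((\<Pi>\<^sub>M i\<in>I. borel) \<Otimes>\<^sub>M G) (\<lambda>\<omega>. (\<lambda>i\<in>I. X i \<omega>, Y \<omega>))
      = distr M (\<Pi>\<^sub>M i\<in>I. borel) (\<lambda>\<omega>. \<lambda>i\<in>I. X i \<omega>) \<Otimes>\<^sub>M distr M G Y"
    and F[measurable]: "F \<in> borel_measurable ((\<Pi>\<^sub>M i\<in>I. borel) \<Otimes>\<^sub>M G)"
  shows "(\<integral>\<^sup>+\<omega>. F (\<lambda>i\<in>I. X i \<omega> + c i, Y \<omega>) \<partial>M)
    = (\<integral>\<^sup>+\<omega>. F (\<lambda>i\<in>I. X i \<omega>, Y \<omega>) *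
         ennreal (exp (\<Sum>i\<in>I. c i * X i \<omega> / (\<sigma> i)\<^sup>2 - (c i)\<^sup>2 / (2 * (\<sigma> i)\<^sup>2))) \<partial>M)"
proof -
  let ?B = "\<Pi>\<^sub>M i\<in>I. borel :: real measure"
  \<comment> \<open>Off \<open>I\<close> the standard deviation is set to \<open>1\<close>: the
    product-measure locale wants a sigma-finite measure at every index.\<close>
  define s where "s i = (if i \<in> I then \<sigma> i else 1)" for i
  have s: "0 < s i" for i using \<sigma> by (simp add: s_def)
  define N where "N = (\<lambda>i. density lborel (normal_density 0 (s i)))"
  have pN: "prob_space (N i)" for i unfolding N_def using s by (rule prob_space_normal_density)
  have sN[measurable_cong, simp]: "sets (N i) = sets borel" for i by (simp add: N_def)
  have rvX[measurable]: "X i \<in> borel_measurable M" if "i \<in> I" for i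
    using distributed_measurable[OF X[OF that]] by simp
  have "distr M ?B (\<lambda>\<omega>. \<lambda>i\<in>I. X i \<omega>) = (\<Pi>\<^sub>M i\<in>I. distr M borel (X i))"
    using indep indep_vars_iff_distr_eq_PiM'[OF I(2), where X=X and M'="\<lambda>_. borel"] by simp
  also have "\<dots> = PiM I N"
  proof (rule PiM_cong[OF refl])
    fix i assume i: "i \<in> I"
    then show "distr M borel (X i) = N i"
      using distributed_distr_eq_density[OF X[OF i]]
      by (simp add: N_def s_def distr_cong[OF refl _ refl, of borel lborel])
  qed
  finally have dX: "distr M ?B (\<lambda>\<omega>. \<lambda>i\<in>I. X i \<omega>) = PiM I N" .
  have dXY: "distr M (?B \<Otimes>\<^sub>M G) (\<lambda>\<omega>. (\<lambda>i\<in>I. X i \<omega>, Y \<omega>)) = PiM I N \<Otimes>\<^sub>M distr M G Y"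
    unfolding XY dX ..
  interpret Q: prob_space "distr M G Y" by (rule prob_space_distr) simp
  interpret N: product_sigma_finite N
    by (simp add: product_sigma_finite_def pN prob_space_imp_sigma_finite)
  interpret PN: sigma_finite_measure "PiM I N" by (rule N.sigma_finite[OF I(1)])
  interpret P: pair_sigma_finite "PiM I N" "distr M G Y" by standard
  have iterated: "(\<integral>\<^sup>+\<omega>. H (\<lambda>i\<in>I. X i \<omega>, Y \<omega>) \<partial>M) = (\<integral>\<^sup>+y. \<integral>\<^sup>+x. H (x, y) \<partial>PiM I N \<partial>distr M G Y)"
    if [measurable]: "H \<in> borel_measurable (?B \<Otimes>\<^sub>M G)" for H
  proof -
    have "(\<integral>\<^sup>+\<omega>. H (\<lambda>i\<in>I. X i \<omega>, Y \<omega>) \<partial>M) = (\<integral>\<^sup>+p. H p \<partial>(PiM I N \<Otimes>\<^sub>M distr M G Y))"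
      by (subst dXY[symmetric], subst nn_integral_distr) auto
    also have "\<dots> = (\<integral>\<^sup>+y. \<integral>\<^sup>+x. H (x, y) \<partial>PiM I N \<partial>distr M G Y)"
      by (subst P.nn_integral_snd[symmetric]) auto
    finally show ?thesis .
  qed
  define e where "e x = (\<Prod>i\<in>I. ennreal (exp (c i * x i / (s i)\<^sup>2 - (c i)\<^sup>2 / (2 * (s i)\<^sup>2))))" for x
  have e[measurable]: "e \<in> borel_measurable ?B" unfolding e_def by measurable
  have T[measurable]: "(\<lambda>x. \<lambda>i\<in>I. x i + c i) \<in> measurable ?B ?B" by measurable
  have sh: "distr (PiM I N) ?B (\<lambda>x. \<lambda>i\<in>I. x i + c i) = density (PiM I N) e"
    unfolding N_def e_def[abs_def] by (rule PiM_normal_shift[OF I(1) s])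
  have "(\<integral>\<^sup>+\<omega>. F (\<lambda>i\<in>I. X i \<omega> + c i, Y \<omega>) \<partial>M) = (\<integral>\<^sup>+\<omega>. (\<lambda>(x, y). F (\<lambda>i\<in>I. x i + c i, y)) (\<lambda>i\<in>I. X i \<omega>, Y \<omega>) \<partial>M)"
    by (intro nn_integral_cong) (auto intro!: arg_cong[where f=F])
  also have "\<dots> = (\<integral>\<^sup>+y. \<integral>\<^sup>+x. F (\<lambda>i\<in>I. x i + c i, y) \<partial>PiM I N \<partial>distr M G Y)"
    by (subst iterated) auto
  also have "\<dots> = (\<integral>\<^sup>+y. \<integral>\<^sup>+x. F (x, y) * e x \<partial>PiM I N \<partial>distr M G Y)"
  proof (rule nn_integral_cong)
    fix y assume "y \<in> space (distr M G Y)"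
    then have [measurable]: "(\<lambda>x. F (x, y)) \<in> borel_measurable ?B" by simp
    have "(\<integral>\<^sup>+x. F (\<lambda>i\<in>I. x i + c i, y) \<partial>PiM I N) = (\<integral>\<^sup>+x. F (x, y) \<partial>distr (PiM I N) ?B (\<lambda>x. \<lambda>i\<in>I. x i + c i))"
      by (subst nn_integral_distr) auto
    also have "\<dots> = (\<integral>\<^sup>+x. F (x, y) * e x \<partial>PiM I N)"
      unfolding sh by (subst nn_integral_density) (auto simp: mult.commute)
    finally show "(\<integral>\<^sup>+x. F (\<lambda>i\<in>I. x i + c i, y) \<partial>PiM I N) = (\<integral>\<^sup>+x. F (x, y) * e x \<partial>PiM I N)" .
  qed
  also have "\<dots> = (\<integral>\<^sup>+\<omega>. (\<lambda>(x, y). F (x, y) * e x) (\<lambda>i\<in>I. X i \<omega>, Y \<omega>) \<partial>M)"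
    by (subst iterated) auto
  also have "\<dots> = (\<integral>\<^sup>+\<omega>. F (\<lambda>i\<in>I. X i \<omega>, Y \<omega>) *
         ennreal (exp (\<Sum>i\<in>I. c i * X i \<omega> / (\<sigma> i)\<^sup>2 - (c i)\<^sup>2 / (2 * (\<sigma> i)\<^sup>2))) \<partial>M)"
    using I(1) by (intro nn_integral_cong) (simp add: e_def s_def exp_sum prod_ennreal cong: prod.cong)
  finally show ?thesis .
qed

text \<open>Joint laws are determined on rectangles, where independence of the set systems gives the
  product formula. Independence is thus used directly in terms of generated sigma-algebras.\<close>

lemma (in prob_space) distr_pair_indep_set:
  assumes X[measurable]: "X \<in> measurable M S" and Y[measurable]: "Y \<in> measurable M T"
    and A: "\<And>a. a \<in> sets S \<Longrightarrow> X -` a \<inter> space M \<in> A" and B: "\<And>b. b \<in> sets T \<Longrightarrow> Y -` b \<inter> space M \<in> B"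
    and indep: "indep_set A B"
  shows "distr M (S \<Otimes>\<^sub>M T) (\<lambda>\<omega>. (X \<omega>, Y \<omega>)) = distr M S X \<Otimes>\<^sub>M distr M T Y"
proof (rule pair_measure_eqI[symmetric])
  interpret X: prob_space "distr M S X" by (rule prob_space_distr) simp
  interpret Y: prob_space "distr M T Y" by (rule prob_space_distr) simp
  show "sigma_finite_measure (distr M S X)" "sigma_finite_measure (distr M T Y)" by standard+
  show "sets (distr M S X \<Otimes>\<^sub>M distr M T Y) = sets (distr M (S \<Otimes>\<^sub>M T) (\<lambda>\<omega>. (X \<omega>, Y \<omega>)))"
    by (simp cong: sets_pair_measure_cong)
  fix a b assume "a \<in> sets (distr M S X)" "b \<in> sets (distr M T Y)"
  then have [measurable]: "a \<in> sets S" "b \<in> sets T" by auto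
  have "(\<lambda>\<omega>. (X \<omega>, Y \<omega>)) -` (a \<times> b) \<inter> space M = (X -` a \<inter> space M) \<inter> (Y -` b \<inter> space M)"
    by auto
  moreover have "prob ((X -` a \<inter> space M) \<inter> (Y -` b \<inter> space M)) = prob (X -` a \<inter> space M) * prob (Y -` b \<inter> space M)"
    using indep A[of a] B[of b] unfolding indep_sets2_eq by auto
  ultimately show "emeasure (distr M S X) a * emeasure (distr M T Y) b
      = emeasure (distr M (S \<Otimes>\<^sub>M T) (\<lambda>\<omega>. (X \<omega>, Y \<omega>))) (a \<times> b)"
    by (simp add: emeasure_distr emeasure_eq_measure ennreal_mult)
qed

lemma (in prob_space) normal_second_moment:
  assumes s: "0 < s" and X: "distributed M lborel X (normal_density 0 s)"
  shows "(\<integral>\<^sup>+\<omega>. ennreal ((X \<omega> + r)\<^sup>2) \<partial>M) = ennreal (s\<^sup>2 + r\<^sup>2)"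
proof -
  have i1: "integrable M X"
    using integrable_normal_moment[OF s, of 0 1] distributed_integrable[OF X, of "\<lambda>x. x"] by simp
  have i2: "integrable M (\<lambda>\<omega>. (X \<omega>)\<^sup>2)"
    using integrable_normal_moment[OF s, of 0 2] distributed_integrable[OF X, of "\<lambda>x. x\<^sup>2"] by simp
  have e1: "expectation X = 0" using s X by (rule normal_distributed_expectation)
  have e2: "expectation (\<lambda>\<omega>. (X \<omega>)\<^sup>2) = s\<^sup>2" using normal_distributed_variance[OF s X] e1 by simp
  have eq: "(\<lambda>\<omega>. (X \<omega> + r)\<^sup>2) = (\<lambda>\<omega>. (X \<omega>)\<^sup>2 + (2 * r) * X \<omega> + r\<^sup>2)"
    by (auto simp: power2_eq_square algebra_simps)
  have "integrable M (\<lambda>\<omega>. (X \<omega> + r)\<^sup>2)" unfolding eq using i1 i2 by simp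
  moreover have "expectation (\<lambda>\<omega>. (X \<omega> + r)\<^sup>2) = s\<^sup>2 + r\<^sup>2"
    unfolding eq using i1 i2 e1 e2 by (simp add: prob_space)
  ultimately show ?thesis by (subst nn_integral_eq_integral) auto
qed

text \<open>A linear combination of independent centred normal variables is centred normal and the
  variances add.\<close>

lemma (in prob_space) gaussian_linear_second_moment:
  fixes X :: "'i \<Rightarrow> 'a \<Rightarrow> real" and \<sigma> c :: "'i \<Rightarrow> real"
  assumes I: "finite I" and \<sigma>: "\<And>i. i \<in> I \<Longrightarrow> 0 < \<sigma> i"
    and X: "\<And>i. i \<in> I \<Longrightarrow> distributed M lborel (X i) (normal_density 0 (\<sigma> i))"
    and indep: "indep_vars (\<lambda>_. borel) X I"
  shows "(\<integral>\<^sup>+\<omega>. ennreal (((\<Sum>i\<in>I. c i * X i \<omega>) + r)\<^sup>2) \<partial>M) = ennreal ((\<Sum>i\<in>I. (c i * \<sigma> i)\<^sup>2) + r\<^sup>2)"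
proof -
  \<comment> \<open>Zero coefficients are dropped, because a normal density needs a positive
    standard deviation. If none is left, the combination is the constant \<open>r\<close>.\<close>
  define J where "J = {i\<in>I. c i \<noteq> 0}"
  have J: "finite J" "J \<subseteq> I" using I by (auto simp: J_def)
  have s1: "(\<Sum>i\<in>I. c i * X i \<omega>) = (\<Sum>i\<in>J. c i * X i \<omega>)" for \<omega>
    using I J by (intro sum.mono_neutral_right) (auto simp: J_def)
  have s2: "(\<Sum>i\<in>I. (c i * \<sigma> i)\<^sup>2) = (\<Sum>i\<in>J. (c i * \<sigma> i)\<^sup>2)"
    using I J by (intro sum.mono_neutral_right) (auto simp: J_def)
  show ?thesis
  proof (cases "J = {}")
    case True
    then show ?thesis unfolding s1 s2 by (simp add: emeasure_space_1)
  next
    case False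
    have "distributed M lborel (\<lambda>\<omega>. \<Sum>i\<in>J. c i * X i \<omega>) (normal_density (\<Sum>i\<in>J. 0) (sqrt (\<Sum>i\<in>J. (\<bar>c i\<bar> * \<sigma> i)\<^sup>2)))"
    proof (rule sum_indep_normal[OF J(1) False])
      show "indep_vars (\<lambda>i. borel) (\<lambda>i \<omega>. c i * X i \<omega>) J"
        by (rule indep_vars_compose2[OF indep_vars_subset[OF indep J(2)], where Y="\<lambda>i x. c i * x"]) simp
      fix i assume i: "i \<in> J"
      then show "0 < \<bar>c i\<bar> * \<sigma> i" using \<sigma> by (auto simp: J_def)
      show "distributed M lborel (\<lambda>\<omega>. c i * X i \<omega>) (normal_density 0 (\<bar>c i\<bar> * \<sigma> i))"
        using normal_density_affine[OF X \<sigma>, of i "c i" 0] i by (auto simp: J_def)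
    qed
    then have D: "distributed M lborel (\<lambda>\<omega>. \<Sum>i\<in>J. c i * X i \<omega>) (normal_density 0 (sqrt (\<Sum>i\<in>J. (c i * \<sigma> i)\<^sup>2)))"
      by (simp add: power_mult_distrib)
    have pos: "0 < (\<Sum>i\<in>J. (c i * \<sigma> i)\<^sup>2)"
    proof (rule sum_pos[OF J(1) False])
      fix i assume "i \<in> J"
      then have "c i \<noteq> 0" "\<sigma> i > 0" using \<sigma> by (auto simp: J_def)
      then show "0 < (c i * \<sigma> i)\<^sup>2" by simp
    qed
    show ?thesis
      unfolding s1 s2 using normal_second_moment[OF _ D, of r] pos by simp
  qed
qed

section \<open>Density of cylinder functions\<close>

text \<open>Closure of \<open>V\<close> in mean square. The distance is a nonnegative integral, so
  the definition demands no square integrability of \<open>f\<close> or of the members of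
  \<open>V\<close>.\<close>

definition L2_approximable :: "'a measure \<Rightarrow> ('a \<Rightarrow> real) set \<Rightarrow> ('a \<Rightarrow> real) \<Rightarrow> bool" where
  "L2_approximable M V f \<longleftrightarrow> f \<in> borel_measurable M \<and>
     (\<forall>e>0. \<exists>h\<in>V. (\<integral>\<^sup>+ x. ennreal ((f x - h x)\<^sup>2) \<partial>M) < ennreal e)"

lemma square_add_le: "(a + b)\<^sup>2 \<le> 2 * a\<^sup>2 + 2 * (b::real)\<^sup>2"
proof -
  have "0 \<le> (a - b)\<^sup>2" by simp
  then show ?thesis by (simp add: power2_eq_square algebra_simps)
qed

lemma L2_approximable_trans:
  assumes V: "V \<subseteq> borel_measurable M" and f: "f \<in> borel_measurable M"
    and approx: "\<And>e. e > 0 \<Longrightarrow> \<exists>h. L2_approximable M V h \<and> (\<integral>\<^sup>+ x. ennreal ((f x - h x)\<^sup>2) \<partial>M) < ennreal e"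
  shows "L2_approximable M V f"
  unfolding L2_approximable_def
proof (intro conjI allI impI f)
  fix e :: real assume e: "e > 0"
  \<comment> \<open>Two errors of \<open>e / 4\<close> each enter with the factor \<open>2\<close>
    of \<open>square_add_le\<close>.\<close>
  then obtain h where h: "L2_approximable M V h" "(\<integral>\<^sup>+ x. ennreal ((f x - h x)\<^sup>2) \<partial>M) < ennreal (e / 4)"
    using approx[of "e/4"] by auto
  obtain k where k: "k \<in> V" "(\<integral>\<^sup>+ x. ennreal ((h x - k x)\<^sup>2) \<partial>M) < ennreal (e / 4)"
    using h(1) e unfolding L2_approximable_def by (auto dest!: spec[of _ "e/4"])
  have [measurable]: "h \<in> borel_measurable M" "k \<in> borel_measurable M" "f \<in> borel_measurable M"
    using h(1) k V f by (auto simp: L2_approximable_def)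
  have "(\<integral>\<^sup>+ x. ennreal ((f x - k x)\<^sup>2) \<partial>M) \<le> (\<integral>\<^sup>+ x. 2 * ennreal ((f x - h x)\<^sup>2) + 2 * ennreal ((h x - k x)\<^sup>2) \<partial>M)"
  proof (rule nn_integral_mono)
    fix x
    have "(f x - k x)\<^sup>2 \<le> 2 * (f x - h x)\<^sup>2 + 2 * (h x - k x)\<^sup>2"
      using square_add_le[of "f x - h x" "h x - k x"] by simp
    then have "ennreal ((f x - k x)\<^sup>2) \<le> ennreal (2 * (f x - h x)\<^sup>2 + 2 * (h x - k x)\<^sup>2)"
      by (rule ennreal_leI)
    then show "ennreal ((f x - k x)\<^sup>2) \<le> 2 * ennreal ((f x - h x)\<^sup>2) + 2 * ennreal ((h x - k x)\<^sup>2)"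
      by (simp add: ennreal_mult)
  qed
  also have "\<dots> = 2 * (\<integral>\<^sup>+ x. ennreal ((f x - h x)\<^sup>2) \<partial>M) + 2 * (\<integral>\<^sup>+ x. ennreal ((h x - k x)\<^sup>2) \<partial>M)"
    by (simp add: nn_integral_add nn_integral_cmult)
  also have "\<dots> < 2 * ennreal (e / 4) + 2 * ennreal (e / 4)"
    by (intro add_strict_mono ennreal_mult_strict_left_mono h(2) k(2)) auto
  also have "\<dots> = ennreal e"
    using e by (simp add: ennreal_mult[symmetric] ennreal_plus[symmetric] numeral_mult_ennreal del: ennreal_plus)
  finally show "\<exists>h\<in>V. (\<integral>\<^sup>+ x. ennreal ((f x - h x)\<^sup>2) \<partial>M) < ennreal e" using k(1) by blast
qed

lemma L2_approximable_cong:
  assumes "L2_approximable M V f" "\<And>x. x \<in> space M \<Longrightarrow> f x = g x"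
  shows "L2_approximable M V g"
proof -
  have "(\<integral>\<^sup>+ x. ennreal ((f x - h x)\<^sup>2) \<partial>M) = (\<integral>\<^sup>+ x. ennreal ((g x - h x)\<^sup>2) \<partial>M)" for h
    using assms(2) by (intro nn_integral_cong) simp
  moreover have "f \<in> borel_measurable M \<longleftrightarrow> g \<in> borel_measurable M"
    using assms(2) by (rule measurable_cong)
  ultimately show ?thesis using assms(1) unfolding L2_approximable_def by simp
qed

lemma L2_approximable_add:
  assumes V: "V \<subseteq> borel_measurable M" "\<forall>h\<in>V. \<forall>k\<in>V. (\<lambda>x. h x + k x) \<in> V"
    and f: "L2_approximable M V f" and g: "L2_approximable M V g"
  shows "L2_approximable M V (\<lambda>x. f x + g x)"
  unfolding L2_approximable_def
proof (intro conjI allI impI)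
  have [measurable]: "f \<in> borel_measurable M" "g \<in> borel_measurable M" using f g by (auto simp: L2_approximable_def)
  then show "(\<lambda>x. f x + g x) \<in> borel_measurable M" by measurable
  fix e :: real assume e: "e > 0"
  obtain h where h: "h \<in> V" "(\<integral>\<^sup>+ x. ennreal ((f x - h x)\<^sup>2) \<partial>M) < ennreal (e / 4)"
    using f e unfolding L2_approximable_def by (auto dest!: spec[of _ "e/4"])
  obtain k where k: "k \<in> V" "(\<integral>\<^sup>+ x. ennreal ((g x - k x)\<^sup>2) \<partial>M) < ennreal (e / 4)"
    using g e unfolding L2_approximable_def by (auto dest!: spec[of _ "e/4"])
  have [measurable]: "h \<in> borel_measurable M" "k \<in> borel_measurable M"
    using h k V(1) by auto
  have "(\<integral>\<^sup>+ x. ennreal ((f x + g x - (h x + k x))\<^sup>2) \<partial>M) \<le> (\<integral>\<^sup>+ x. 2 * ennreal ((f x - h x)\<^sup>2) + 2 * ennreal ((g x - k x)\<^sup>2) \<partial>M)"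
  proof (rule nn_integral_mono)
    fix x
    have "(f x + g x - (h x + k x))\<^sup>2 \<le> 2 * (f x - h x)\<^sup>2 + 2 * (g x - k x)\<^sup>2"
      using square_add_le[of "f x - h x" "g x - k x"] by (simp add: algebra_simps)
    then have "ennreal ((f x + g x - (h x + k x))\<^sup>2) \<le> ennreal (2 * (f x - h x)\<^sup>2 + 2 * (g x - k x)\<^sup>2)"
      by (rule ennreal_leI)
    then show "ennreal ((f x + g x - (h x + k x))\<^sup>2) \<le> 2 * ennreal ((f x - h x)\<^sup>2) + 2 * ennreal ((g x - k x)\<^sup>2)"
      by (simp add: ennreal_mult)
  qed
  also have "\<dots> = 2 * (\<integral>\<^sup>+ x. ennreal ((f x - h x)\<^sup>2) \<partial>M) + 2 * (\<integral>\<^sup>+ x. ennreal ((g x - k x)\<^sup>2) \<partial>M)"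
    by (simp add: nn_integral_add nn_integral_cmult)
  also have "\<dots> < 2 * ennreal (e / 4) + 2 * ennreal (e / 4)"
    by (intro add_strict_mono ennreal_mult_strict_left_mono h(2) k(2)) auto
  also have "\<dots> = ennreal e"
    using e by (simp add: ennreal_mult[symmetric] ennreal_plus[symmetric] numeral_mult_ennreal del: ennreal_plus)
  finally show "\<exists>h\<in>V. (\<integral>\<^sup>+ x. ennreal ((f x + g x - h x)\<^sup>2) \<partial>M) < ennreal e"
    using V(2) h(1) k(1) by (intro bexI[of _ "\<lambda>x. h x + k x"]) auto
qed

lemma L2_approximable_cmult:
  assumes V: "V \<subseteq> borel_measurable M" "\<forall>h\<in>V. \<forall>c. (\<lambda>x. c * h x) \<in> V"
    and f: "L2_approximable M V f"
  shows "L2_approximable M V (\<lambda>x. c * f x)"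
  unfolding L2_approximable_def
proof (intro conjI allI impI)
  have [measurable]: "f \<in> borel_measurable M" using f by (auto simp: L2_approximable_def)
  then show "(\<lambda>x. c * f x) \<in> borel_measurable M" by measurable
  fix e :: real assume e: "e > 0"
  \<comment> \<open>The summand \<open>1\<close> makes \<open>c\<^sup>2 * d < e\<close> hold
    strictly and keeps the denominator positive when \<open>c = 0\<close>.\<close>
  define d where "d = e / (1 + c\<^sup>2)"
  have pos: "0 < 1 + c\<^sup>2" by (rule add_pos_nonneg) simp_all
  have "d > 0" unfolding d_def using e pos by (rule divide_pos_pos)
  moreover have "d * (1 + c\<^sup>2) = e" unfolding d_def using less_imp_neq[OF pos] by (metis nonzero_eq_divide_eq)
  ultimately have d: "d > 0" "c\<^sup>2 * d < e" by (simp_all add: algebra_simps)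
  obtain h where h: "h \<in> V" "(\<integral>\<^sup>+ x. ennreal ((f x - h x)\<^sup>2) \<partial>M) < ennreal d"
    using f d unfolding L2_approximable_def by auto
  have [measurable]: "h \<in> borel_measurable M" using h V(1) by auto
  have "(\<integral>\<^sup>+ x. ennreal ((c * f x - c * h x)\<^sup>2) \<partial>M) = (\<integral>\<^sup>+ x. ennreal (c\<^sup>2) * ennreal ((f x - h x)\<^sup>2) \<partial>M)"
    by (intro nn_integral_cong) (simp add: ennreal_mult[symmetric] power_mult_distrib[symmetric] right_diff_distrib)
  also have "\<dots> = ennreal (c\<^sup>2) * (\<integral>\<^sup>+ x. ennreal ((f x - h x)\<^sup>2) \<partial>M)"
    by (simp add: nn_integral_cmult)
  also have "\<dots> \<le> ennreal (c\<^sup>2) * ennreal d" by (rule mult_left_mono[OF less_imp_le[OF h(2)]]) simp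
  also have "\<dots> = ennreal (c\<^sup>2 * d)" using d by (simp add: ennreal_mult)
  also have "\<dots> < ennreal e" using d e by (intro ennreal_lessI) auto
  finally show "\<exists>h\<in>V. (\<integral>\<^sup>+ x. ennreal ((c * f x - h x)\<^sup>2) \<partial>M) < ennreal e"
    using V(2) h(1) by (intro bexI[of _ "\<lambda>x. c * h x"]) auto
qed

lemma L2_approximable_sum:
  assumes V: "V \<subseteq> borel_measurable M" "\<forall>h\<in>V. \<forall>k\<in>V. (\<lambda>x. h x + k x) \<in> V"
    and zero: "L2_approximable M V (\<lambda>x. 0)" and f: "\<And>i. i \<in> I \<Longrightarrow> L2_approximable M V (f i)"
  shows "L2_approximable M V (\<lambda>x. \<Sum>i\<in>I. f i x)"
  using f by (induction I rule: infinite_finite_induct) (auto simp: zero intro!: L2_approximable_add[OF V])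

text \<open>Dominated convergence for the squared error. The majorant \<open>b\<close> bounds the
  error itself rather than the approximating functions.\<close>

lemma L2_approximable_lim:
  assumes V: "V \<subseteq> borel_measurable M" and f[measurable]: "f \<in> borel_measurable M"
    and s: "\<And>i. L2_approximable M V (s i)" and lim: "\<And>x. x \<in> space M \<Longrightarrow> (\<lambda>i. s i x) \<longlonglongrightarrow> f x"
    and bound: "\<And>i x. x \<in> space M \<Longrightarrow> \<bar>f x - s i x\<bar> \<le> b x" and b[measurable]: "b \<in> borel_measurable M"
    and fin: "(\<integral>\<^sup>+ x. ennreal ((b x)\<^sup>2) \<partial>M) < \<infinity>"
  shows "L2_approximable M V f"
proof (rule L2_approximable_trans[OF V f])
  fix e :: real assume e: "e > 0"
  have [measurable]: "s i \<in> borel_measurable M" for i using s by (auto simp: L2_approximable_def)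
  have "(\<lambda>i. \<integral>\<^sup>+ x. ennreal ((f x - s i x)\<^sup>2) \<partial>M) \<longlonglongrightarrow> (\<integral>\<^sup>+ x. 0 \<partial>M)"
  proof (rule nn_integral_dominated_convergence[where w="\<lambda>x. ennreal ((b x)\<^sup>2)"])
    show "AE x in M. ennreal ((f x - s i x)\<^sup>2) \<le> ennreal ((b x)\<^sup>2)" for i
    proof (rule AE_I2, rule ennreal_leI)
      fix x assume "x \<in> space M"
      then show "(f x - s i x)\<^sup>2 \<le> (b x)\<^sup>2"
        using bound[of x i] by (intro abs_le_square_iff[THEN iffD1]) linarith
    qed
    show "AE x in M. (\<lambda>i. ennreal ((f x - s i x)\<^sup>2)) \<longlonglongrightarrow> 0"
    proof (rule AE_I2)
      fix x assume "x \<in> space M"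
      then have "(\<lambda>i. (f x - s i x)\<^sup>2) \<longlonglongrightarrow> (f x - f x)\<^sup>2" by (intro tendsto_intros lim)
      then show "(\<lambda>i. ennreal ((f x - s i x)\<^sup>2)) \<longlonglongrightarrow> 0"
        using tendsto_ennrealI by fastforce
    qed
  qed (use fin in auto)
  then have "(\<lambda>i. \<integral>\<^sup>+ x. ennreal ((f x - s i x)\<^sup>2) \<partial>M) \<longlonglongrightarrow> 0" by simp
  from order_tendstoD(2)[OF this, of "ennreal e"] e
  obtain i where "(\<integral>\<^sup>+ x. ennreal ((f x - s i x)\<^sup>2) \<partial>M) < ennreal e"
    by (auto simp: eventually_sequentially)
  then show "\<exists>h. L2_approximable M V h \<and> (\<integral>\<^sup>+ x. ennreal ((f x - h x)\<^sup>2) \<partial>M) < ennreal e"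
    using s by blast
qed

text \<open>The sets whose indicators can be approximated form a Dynkin system containing the
  intersection-stable generator, hence contain every measurable set. Simple functions and then
  dominated limits follow.\<close>

lemma L2_dense:
  assumes "finite_measure M"
    and V: "V \<subseteq> borel_measurable M" "\<forall>h\<in>V. \<forall>k\<in>V. (\<lambda>x. h x + k x) \<in> V"
      "\<forall>h\<in>V. \<forall>c. (\<lambda>x. c * h x) \<in> V" "(\<lambda>x. 1) \<in> V"
    and \<A>: "Int_stable \<A>" "\<A> \<subseteq> sets M" "sets M \<subseteq> sigma_sets (space M) \<A>"
      "\<And>A. A \<in> \<A> \<Longrightarrow> indicator A \<in> V"
    and f[measurable]: "f \<in> borel_measurable M" and fin: "(\<integral>\<^sup>+ x. ennreal ((f x)\<^sup>2) \<partial>M) < \<infinity>"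
  shows "L2_approximable M V f"
proof -
  interpret finite_measure M by fact
  note add = L2_approximable_add[OF V(1,2)] and cmult = L2_approximable_cmult[OF V(1,3)]
  have inV: "L2_approximable M V h" if "h \<in> V" for h
    using that V(1) unfolding L2_approximable_def by (auto intro!: bexI[of _ h])
  have one: "L2_approximable M V (\<lambda>x. 1)" using V(4) by (rule inV)
  have zero: "L2_approximable M V (\<lambda>x. 0)" using cmult[OF one, of 0] by simp
  note sum = L2_approximable_sum[OF V(1,2) zero]
  have ind: "L2_approximable M V (indicator A)" if "A \<in> sets M" for A
  proof -
    have sub: "\<A> \<subseteq> Pow (space M)" using \<A>(2) sets.space_closed by blast
    have eq: "sigma_sets (space M) \<A> = sets M"
      using \<A>(2,3) sets.sigma_sets_subset by blast
    show ?thesis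
      using \<A>(1) sub that[folded eq]
    proof (induction A rule: sigma_sets_induct_disjoint)
      case (basic A) then show ?case using \<A>(4) inV by blast
    next
      case empty then show ?case using zero by (simp add: indicator_def)
    next
      case (compl A)
      have "L2_approximable M V (\<lambda>x. 1 + (-1) * indicator A x)"
        by (intro add cmult one compl)
      then show ?case by (rule L2_approximable_cong) (auto simp: indicator_def)
    next
      case (union A)
      have [measurable]: "A i \<in> sets M" for i using union(2) eq by auto
      show ?case
      \<comment> \<open>The partial sums are indicators of finite unions, so the error is at most
        \<open>1\<close>, which is square integrable for a finite measure.\<close>
      proof (rule L2_approximable_lim[OF V(1), where b="\<lambda>x. 1"])
        show "L2_approximable M V (\<lambda>x. \<Sum>i<n. indicator (A i) x)" for n :: nat
          by (intro sum union)
        have part: "(\<Sum>i<n. indicator (A i) x) = (indicator (\<Union>i<n. A i) x :: real)" for n x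
          using union(1) by (subst indicator_UN_disjoint) (auto simp: disjoint_family_on_def)
        show "(\<lambda>n. \<Sum>i<n. indicator (A i) x) \<longlonglongrightarrow> (indicator (\<Union>(range A)) x :: real)" for x
          unfolding part using LIMSEQ_indicator_UN[of A x] by simp
        show "\<bar>indicator (\<Union>(range A)) x - (\<Sum>i<n. indicator (A i) x)\<bar> \<le> (1::real)" for n x
          unfolding part by (auto simp: indicator_def)
        show "(\<integral>\<^sup>+ x. ennreal (1\<^sup>2) \<partial>M) < \<infinity>" by (simp add: less_top[symmetric])
      qed measurable
    qed
  qed
  obtain s where s: "\<And>i. simple_function M (s i)" "\<And>x. x \<in> space M \<Longrightarrow> (\<lambda>i. s i x) \<longlonglongrightarrow> f x"
      "\<And>i x. x \<in> space M \<Longrightarrow> norm (s i x) \<le> 2 * norm (f x)"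
    using borel_measurable_implies_sequence_metric[OF f, of 0] unfolding norm_conv_dist by metis
  show ?thesis
  \<comment> \<open>The simple functions are bounded by \<open>2 * \<bar>f\<bar>\<close>, so their
    distance to \<open>f\<close> is at most \<open>3 * \<bar>f\<bar>\<close>.\<close>
  proof (rule L2_approximable_lim[OF V(1) f _ s(2), where b="\<lambda>x. 3 * \<bar>f x\<bar>"])
    fix i
    have fs: "finite (s i ` space M)" using s(1) by (rule simple_functionD)
    have "L2_approximable M V (\<lambda>x. \<Sum>y\<in>s i ` space M. y * indicator (s i -` {y} \<inter> space M) x)"
      by (intro sum cmult ind simple_functionD[OF s(1)])
    then show "L2_approximable M V (s i)"
    proof (rule L2_approximable_cong)
      fix x assume x: "x \<in> space M"
      have "(\<Sum>y\<in>s i ` space M. y * indicator (s i -` {y} \<inter> space M) x) = (\<Sum>y\<in>s i ` space M. if y = s i x then y else 0)"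
        using x by (intro sum.cong) (auto simp: indicator_def)
      also have "\<dots> = s i x" using fs x by (simp add: sum.delta)
      finally show "(\<Sum>y\<in>s i ` space M. y * indicator (s i -` {y} \<inter> space M) x) = s i x" .
    qed
  next
    show "\<bar>f x - s i x\<bar> \<le> 3 * \<bar>f x\<bar>" if "x \<in> space M" for i x
      using s(3)[OF that, of i] by (simp add: abs_if split: if_splits)
    have "(\<integral>\<^sup>+ x. ennreal ((3 * \<bar>f x\<bar>)\<^sup>2) \<partial>M) = 9 * (\<integral>\<^sup>+ x. ennreal ((f x)\<^sup>2) \<partial>M)"
      by (simp add: power_mult_distrib ennreal_mult nn_integral_cmult)
    then show "(\<integral>\<^sup>+ x. ennreal ((3 * \<bar>f x\<bar>)\<^sup>2) \<partial>M) < \<infinity>"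
      using fin by (simp add: ennreal_mult_less_top)
  qed measurable
qed

text \<open>Restricting the argument to \<open>J\<close> places it in the space of the product over
  \<open>J\<close>, so measurability of \<open>k\<close> there is all that has to be known about
  it.\<close>

definition cylinder_functions :: "'i set \<Rightarrow> (('i \<Rightarrow> real) \<Rightarrow> real) set" where
  "cylinder_functions T = {h. \<exists>J k. finite J \<and> J \<subseteq> T \<and> k \<in> borel_measurable (\<Pi>\<^sub>M t\<in>J. borel) \<and> h = (\<lambda>x. k (restrict x J))}"

text \<open>Allows two cylinder functions to be written over the union of their index sets.\<close>

lemma cylinder_functions_superset:
  assumes k: "k \<in> borel_measurable (\<Pi>\<^sub>M t\<in>J. borel)" and K: "J \<subseteq> K"
  obtains k' where "k' \<in> borel_measurable (\<Pi>\<^sub>M t\<in>K. borel)" "\<And>x. k' (restrict x K) = k (restrict x J)"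
proof
  show "(\<lambda>x. k (restrict x J)) \<in> borel_measurable (\<Pi>\<^sub>M t\<in>K. borel)"
    using measurable_compose[OF measurable_restrict_subset[OF K] k] .
  show "k (restrict (restrict x K) J) = k (restrict x J)" for x
    using K by (simp add: inf_absorb2)
qed

lemma cylinder_functions_binop:
  assumes h: "h \<in> cylinder_functions T" and h': "h' \<in> cylinder_functions T"
    and F: "(\<lambda>x. F (fst x) (snd x)) \<in> borel_measurable (borel \<Otimes>\<^sub>M borel)"
  shows "(\<lambda>x. F (h x) (h' x)) \<in> cylinder_functions T"
proof -
  obtain J k where J: "finite J" "J \<subseteq> T" and k: "k \<in> borel_measurable (\<Pi>\<^sub>M t\<in>J. borel)" "h = (\<lambda>x. k (restrict x J))"
    using h unfolding cylinder_functions_def by blast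
  obtain J' k' where J': "finite J'" "J' \<subseteq> T" and k': "k' \<in> borel_measurable (\<Pi>\<^sub>M t\<in>J'. borel)" "h' = (\<lambda>x. k' (restrict x J'))"
    using h' unfolding cylinder_functions_def by blast
  obtain l where l[measurable]: "l \<in> borel_measurable (\<Pi>\<^sub>M t\<in>J \<union> J'. borel)" and l': "\<And>x. l (restrict x (J \<union> J')) = k (restrict x J)"
    using cylinder_functions_superset[OF k(1), of "J \<union> J'"] by blast
  obtain m where m[measurable]: "m \<in> borel_measurable (\<Pi>\<^sub>M t\<in>J \<union> J'. borel)" and m': "\<And>x. m (restrict x (J \<union> J')) = k' (restrict x J')"
    using cylinder_functions_superset[OF k'(1), of "J \<union> J'"] by blast
  have "(\<lambda>x. (l x, m x)) \<in> measurable (\<Pi>\<^sub>M t\<in>J \<union> J'. borel) (borel \<Otimes>\<^sub>M borel)" by measurable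
  from measurable_compose[OF this F]
  have "(\<lambda>x. F (l x) (m x)) \<in> borel_measurable (\<Pi>\<^sub>M t\<in>J \<union> J'. borel)" by simp
  moreover have "(\<lambda>x. F (h x) (h' x)) = (\<lambda>x. (\<lambda>x. F (l x) (m x)) (restrict x (J \<union> J')))"
    by (simp add: l' m' k(2) k'(2))
  ultimately show ?thesis
    unfolding cylinder_functions_def using J J' by (intro CollectI exI[of _ "J \<union> J'"] exI[of _ "\<lambda>x. F (l x) (m x)"]) auto
qed

lemma cylinder_functions_measurable:
  assumes "h \<in> cylinder_functions T"
  shows "h \<in> borel_measurable (\<Pi>\<^sub>M t\<in>T. borel)"
proof -
  obtain J k where J: "finite J" "J \<subseteq> T" and k: "k \<in> borel_measurable (\<Pi>\<^sub>M t\<in>J. borel)" "h = (\<lambda>x. k (restrict x J))"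
    using assms unfolding cylinder_functions_def by blast
  show ?thesis unfolding k(2) by (rule measurable_compose[OF measurable_restrict_subset[OF J(2)] k(1)])
qed

lemma cylinder_functions_L2_dense:
  fixes X :: "('i \<Rightarrow> real) set"
  assumes "finite_measure M" and sets: "sets M = sets (restrict_space (\<Pi>\<^sub>M t\<in>T. borel) X)"
    and f: "f \<in> borel_measurable M" "(\<integral>\<^sup>+ x. ennreal ((f x)\<^sup>2) \<partial>M) < \<infinity>"
  shows "L2_approximable M (cylinder_functions T) f"
proof -
  \<comment> \<open>The generator consists of the sets cut out by cylinder functions with values in
    {0, 1}; products of such functions give intersections.\<close>
  let ?\<A> = "{A. \<exists>h\<in>cylinder_functions T. A = {x\<in>space M. h x = 1} \<and> (\<forall>x. h x = 0 \<or> h x = 1)}"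
  \<comment> \<open>Agreement is asked on \<open>space M\<close> only: the indicator of a set in the
    generator vanishes outside that space, while the cylinder function defining the set need
    not.\<close>
  let ?V = "{h. \<exists>k\<in>cylinder_functions T. \<forall>x\<in>space M. h x = k x}"
  have meas: "h \<in> borel_measurable M" if "h \<in> cylinder_functions T" for h
    using measurable_restrict_space1[OF cylinder_functions_measurable[OF that]]
    by (simp add: measurable_cong_sets[OF sets refl])
  have const: "(\<lambda>x. c) \<in> cylinder_functions T" for c
    unfolding cylinder_functions_def by (intro CollectI exI[of _ "{}"] exI[of _ "\<lambda>x. c"]) auto
  have add: "(\<lambda>x. h x + k x) \<in> cylinder_functions T" if "h \<in> cylinder_functions T" "k \<in> cylinder_functions T" for h k
    using that by (rule cylinder_functions_binop) measurable
  have mult: "(\<lambda>x. h x * k x) \<in> cylinder_functions T" if "h \<in> cylinder_functions T" "k \<in> cylinder_functions T" for h k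
    using that by (rule cylinder_functions_binop) measurable
  have "L2_approximable M ?V f"
  proof (rule L2_dense[where \<A>="?\<A>"])
    show "?V \<subseteq> borel_measurable M"
    proof
      fix h assume "h \<in> ?V"
      then obtain k where "k \<in> cylinder_functions T" "\<And>x. x \<in> space M \<Longrightarrow> h x = k x" by blast
      then show "h \<in> borel_measurable M" using meas[of k] by (simp cong: measurable_cong)
    qed
    show "\<forall>h\<in>?V. \<forall>k\<in>?V. (\<lambda>x. h x + k x) \<in> ?V"
    proof (intro ballI)
      fix h k assume hk: "h \<in> ?V" "k \<in> ?V"
      obtain h' k' where "h' \<in> cylinder_functions T" "\<forall>x\<in>space M. h x = h' x" "k' \<in> cylinder_functions T" "\<forall>x\<in>space M. k x = k' x"
        using hk by blast
      then show "(\<lambda>x. h x + k x) \<in> ?V" using add[of h' k'] by (intro CollectI bexI[of _ "\<lambda>x. h' x + k' x"]) auto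
    qed
    show "\<forall>h\<in>?V. \<forall>c. (\<lambda>x. c * h x) \<in> ?V"
    proof (intro ballI allI)
      fix h c assume hk: "h \<in> ?V"
      obtain h' where "h' \<in> cylinder_functions T" "\<forall>x\<in>space M. h x = h' x"
        using hk by blast
      then show "(\<lambda>x. c * h x) \<in> ?V" using mult[OF const[of c], of h'] by (intro CollectI bexI[of _ "\<lambda>x. c * h' x"]) auto
    qed
    show "(\<lambda>x. 1) \<in> ?V" using const[of 1] by (intro CollectI bexI[of _ "\<lambda>x. 1"]) auto
    show "Int_stable ?\<A>"
    proof (rule Int_stableI)
      fix A B assume "A \<in> ?\<A>" "B \<in> ?\<A>"
      then obtain h k where h: "h \<in> cylinder_functions T" "A = {x\<in>space M. h x = 1}" "\<forall>x. h x = 0 \<or> h x = 1"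
        and k: "k \<in> cylinder_functions T" "B = {x\<in>space M. k x = 1}" "\<forall>x. k x = 0 \<or> k x = 1" by blast
      have "A \<inter> B = {x\<in>space M. h x * k x = 1}"
      proof (intro set_eqI iffI)
        fix x assume "x \<in> {x\<in>space M. h x * k x = 1}"
        then show "x \<in> A \<inter> B" using h(2) k(2) spec[OF h(3), of x] spec[OF k(3), of x] by auto
      qed (use h k in auto)
      moreover have "\<forall>x. h x * k x = 0 \<or> h x * k x = 1"
      proof
        fix x show "h x * k x = 0 \<or> h x * k x = 1" using spec[OF h(3), of x] spec[OF k(3), of x] by auto
      qed
      ultimately show "A \<inter> B \<in> ?\<A>" using mult[OF h(1) k(1)] by (intro CollectI bexI[of _ "\<lambda>x. h x * k x"]) auto
    qed
    show "?\<A> \<subseteq> sets M"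
    proof
      fix A assume "A \<in> ?\<A>"
      then obtain h where h: "h \<in> cylinder_functions T" "A = {x\<in>space M. h x = 1}" by blast
      have [measurable]: "h \<in> borel_measurable M" by (rule meas[OF h(1)])
      show "A \<in> sets M" unfolding h(2) by measurable
    qed
    show "indicator A \<in> ?V" if A: "A \<in> ?\<A>" for A
    proof -
      obtain h where h: "h \<in> cylinder_functions T" "A = {x\<in>space M. h x = 1}" "\<forall>x. h x = 0 \<or> h x = 1" using A by blast
      have "indicator A x = h x" if "x \<in> space M" for x
        using spec[OF h(3), of x] that by (auto simp: h(2) indicator_def)
      then show ?thesis using h(1) by blast
    qed
    show "sets M \<subseteq> sigma_sets (space M) ?\<A>"
    proof
      fix A assume A: "A \<in> sets M"
      let ?N = "sigma (space M) ?\<A>"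
      have sub: "?\<A> \<subseteq> Pow (space M)" by blast
      have space: "space M = X \<inter> extensional T"
        using sets_eq_imp_space_eq[OF sets] by (auto simp: space_restrict_space space_PiM PiE_def)
      \<comment> \<open>Every coordinate map is measurable for the generated sigma-algebra. Hence so
        is the identity into the path space, which says that the generated sigma-algebra contains
        \<open>sets M\<close>.\<close>
      have "(\<lambda>x. x) \<in> measurable ?N (restrict_space (\<Pi>\<^sub>M t\<in>T. borel) X)"
      proof (rule measurable_restrict_space2)
        show "(\<lambda>x. x) \<in> space ?N \<rightarrow> X" using sub by (auto simp: space_measure_of space)
        show "(\<lambda>x. x) \<in> measurable ?N (\<Pi>\<^sub>M t\<in>T. borel)"
        proof (rule measurable_PiM_single')
          show "(\<lambda>x. x) \<in> space ?N \<rightarrow> (\<Pi>\<^sub>E t\<in>T. space borel)"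
            using sub by (auto simp: space_measure_of space PiE_def)
          fix t assume t: "t \<in> T"
          show "(\<lambda>x. x t) \<in> borel_measurable ?N"
          proof (rule measurableI)
            fix B :: "real set" assume B[measurable]: "B \<in> sets borel"
            let ?h = "\<lambda>x. indicator B (x t) :: real"
            have "?h \<in> cylinder_functions T"
              unfolding cylinder_functions_def using t
              by (intro CollectI exI[of _ "{t}"] exI[of _ "\<lambda>x. indicator B (x t)"]) auto
            moreover have "(\<lambda>x. x t) -` B \<inter> space ?N = {x\<in>space M. ?h x = 1}"
              using sub by (auto simp: space_measure_of indicator_def)
            moreover have "\<forall>x. ?h x = 0 \<or> ?h x = 1" by (simp add: indicator_def)
            ultimately have "(\<lambda>x. x t) -` B \<inter> space ?N \<in> ?\<A>" by (intro CollectI bexI[of _ ?h]) auto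
            then show "(\<lambda>x. x t) -` B \<inter> space ?N \<in> sets ?N" using sub by (simp add: sets_measure_of)
          qed simp
        qed
      qed
      from measurable_sets[OF this, of A] A sets sub show "A \<in> sigma_sets (space M) ?\<A>"
        using sets.sets_into_space[OF A] by (simp add: space_measure_of sets_measure_of inf_absorb1)
    qed
  qed fact+
  then show ?thesis
  proof -
    assume a: "L2_approximable M ?V f"
    show ?thesis unfolding L2_approximable_def
    proof (intro conjI f(1) allI impI)
      fix e :: real assume "e > 0"
      then obtain h where h: "h \<in> ?V" "(\<integral>\<^sup>+ x. ennreal ((f x - h x)\<^sup>2) \<partial>M) < ennreal e"
        using a unfolding L2_approximable_def by blast
      then obtain k where k: "k \<in> cylinder_functions T" "\<forall>x\<in>space M. h x = k x" by blast
      have "(\<integral>\<^sup>+ x. ennreal ((f x - h x)\<^sup>2) \<partial>M) = (\<integral>\<^sup>+ x. ennreal ((f x - k x)\<^sup>2) \<partial>M)"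
        using k(2) by (intro nn_integral_cong) auto
      then show "\<exists>h\<in>cylinder_functions T. (\<integral>\<^sup>+ x. ennreal ((f x - h x)\<^sup>2) \<partial>M) < ennreal e"
        using k(1) h(2) by auto
    qed
  qed
qed

section \<open>The jump part\<close>

text \<open>For indicators this is \<open>meas\<close>; the usual induction over nonnegative
  functions does the rest. The measures \<open>\<mu> \<omega>\<close> may have infinite
  mass.\<close>

lemma measurable_kernel_nn_integral:
  fixes f :: "'e \<Rightarrow> ennreal"
  assumes sets: "\<And>\<omega>. \<omega> \<in> space G \<Longrightarrow> sets (\<mu> \<omega>) = sets \<nu>"
    and meas: "\<And>A. A \<in> sets \<nu> \<Longrightarrow> (\<lambda>\<omega>. emeasure (\<mu> \<omega>) A) \<in> borel_measurable G"
    and f: "f \<in> borel_measurable \<nu>"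
  shows "(\<lambda>\<omega>. \<integral>\<^sup>+ x. f x \<partial>\<mu> \<omega>) \<in> borel_measurable G"
proof -
  have m: "h \<in> borel_measurable (\<mu> \<omega>)" if "h \<in> borel_measurable \<nu>" "\<omega> \<in> space G" for h :: "'e \<Rightarrow> ennreal" and \<omega>
    using that measurable_cong_sets[OF sets[OF that(2)] refl] by blast
  show ?thesis using f
  proof (induction rule: borel_measurable_induct)
    case (cong f g)
    have "(\<integral>\<^sup>+ x. f x \<partial>\<mu> \<omega>) = (\<integral>\<^sup>+ x. g x \<partial>\<mu> \<omega>)" if "\<omega> \<in> space G" for \<omega>
      using cong(3) sets_eq_imp_space_eq[OF sets[OF that]] by (intro nn_integral_cong) auto
    with cong(4) show ?case by (simp cong: measurable_cong)
  next
    case (set A)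
    have "(\<integral>\<^sup>+ x. indicator A x \<partial>\<mu> \<omega>) = emeasure (\<mu> \<omega>) A" if "\<omega> \<in> space G" for \<omega>
      using set sets[OF that] by simp
    with meas[OF set] show ?case by (simp cong: measurable_cong)
  next
    case (mult u c)
    have "(\<integral>\<^sup>+ x. c * u x \<partial>\<mu> \<omega>) = c * (\<integral>\<^sup>+ x. u x \<partial>\<mu> \<omega>)" if "\<omega> \<in> space G" for \<omega>
      using mult(2) that by (intro nn_integral_cmult m)
    with mult(4) show ?case by (simp cong: measurable_cong)
  next
    case (add u v)
    have "(\<integral>\<^sup>+ x. v x + u x \<partial>\<mu> \<omega>) = (\<integral>\<^sup>+ x. v x \<partial>\<mu> \<omega>) + (\<integral>\<^sup>+ x. u x \<partial>\<mu> \<omega>)" if "\<omega> \<in> space G" for \<omega>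
      using add that by (intro nn_integral_add m)
    with add show ?case by (simp cong: measurable_cong)
  next
    case (seq U)
    have "(\<integral>\<^sup>+ x. (SUP i. U i) x \<partial>\<mu> \<omega>) = (SUP i. \<integral>\<^sup>+ x. U i x \<partial>\<mu> \<omega>)" if "\<omega> \<in> space G" for \<omega>
      unfolding SUP_apply
      using seq that by (intro nn_integral_monotone_convergence_SUP m)
    moreover have "(\<lambda>\<omega>. SUP i. \<integral>\<^sup>+ x. U i x \<partial>\<mu> \<omega>) \<in> borel_measurable G"
      using seq by measurable
    ultimately show ?case by (simp cong: measurable_cong)
  qed
qed

lemma measurable_kernel_lebesgue_integral:
  fixes f :: "'e \<Rightarrow> real"
  assumes sets: "\<And>\<omega>. \<omega> \<in> space G \<Longrightarrow> sets (\<mu> \<omega>) = sets \<nu>"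
    and meas: "\<And>A. A \<in> sets \<nu> \<Longrightarrow> (\<lambda>\<omega>. emeasure (\<mu> \<omega>) A) \<in> borel_measurable G"
    and f[measurable]: "f \<in> borel_measurable \<nu>"
  shows "(\<lambda>\<omega>. LINT x|\<mu> \<omega>. f x) \<in> borel_measurable G"
proof -
  note nn = measurable_kernel_nn_integral[OF sets meas]
  have [measurable]: "(\<lambda>\<omega>. \<integral>\<^sup>+ x. ennreal (\<bar>f x\<bar>) \<partial>\<mu> \<omega>) \<in> borel_measurable G"
    "(\<lambda>\<omega>. \<integral>\<^sup>+ x. ennreal (f x) \<partial>\<mu> \<omega>) \<in> borel_measurable G"
    "(\<lambda>\<omega>. \<integral>\<^sup>+ x. ennreal (- f x) \<partial>\<mu> \<omega>) \<in> borel_measurable G"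
    by (auto intro!: nn)
  \<comment> \<open>The Bochner integral defaults to \<open>0\<close> when \<open>f\<close> is not
    integrable, and the set of such \<open>\<omega>\<close> is measurable as well.\<close>
  have "(LINT x|\<mu> \<omega>. f x) = (if (\<integral>\<^sup>+ x. ennreal (\<bar>f x\<bar>) \<partial>\<mu> \<omega>) < \<infinity>
      then enn2real (\<integral>\<^sup>+ x. ennreal (f x) \<partial>\<mu> \<omega>) - enn2real (\<integral>\<^sup>+ x. ennreal (- f x) \<partial>\<mu> \<omega>) else 0)"
    if "\<omega> \<in> space G" for \<omega>
  proof -
    have "f \<in> borel_measurable (\<mu> \<omega>)" using f measurable_cong_sets[OF sets[OF that] refl] by blast
    then have "integrable (\<mu> \<omega>) f \<longleftrightarrow> (\<integral>\<^sup>+ x. ennreal (\<bar>f x\<bar>) \<partial>\<mu> \<omega>) < \<infinity>"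
      by (simp add: integrable_iff_bounded)
    then show ?thesis by (auto simp: real_lebesgue_integral_def not_integrable_integral_eq)
  qed
  then show ?thesis by (subst measurable_cong) auto
qed

text \<open>The squared errors tend to zero in mean, so a subsequence of them tends to zero almost
  everywhere.\<close>

lemma tendsto_L2_AE_subseq:
  fixes z :: "'a \<Rightarrow> real" and V :: "nat \<Rightarrow> 'a \<Rightarrow> real"
  assumes [measurable]: "z \<in> borel_measurable M" "\<And>k. V k \<in> borel_measurable M"
    and lim: "(\<lambda>k. \<integral>\<^sup>+ \<omega>. ennreal ((z \<omega> - V k \<omega>)\<^sup>2) \<partial>M) \<longlonglongrightarrow> 0"
  obtains r :: "nat \<Rightarrow> nat" where "AE \<omega> in M. (\<lambda>k. V (r k) \<omega>) \<longlonglongrightarrow> z \<omega>"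
proof -
  let ?n = "\<lambda>k. \<integral>\<^sup>+ \<omega>. ennreal ((z \<omega> - V k \<omega>)\<^sup>2) \<partial>M"
  \<comment> \<open>Beyond \<open>K\<close> the nonnegative integrals are finite, so the squared
    errors are integrable there.\<close>
  obtain K where K: "\<And>k. k \<ge> K \<Longrightarrow> ?n k < 1"
    using order_tendstoD(2)[OF lim, of 1] by (auto simp: eventually_sequentially)
  have fin: "?n (k + K) < \<infinity>" for k using less_trans[OF K[of "k + K"] ennreal_one_less_top] by simp
  have int: "integrable M (\<lambda>\<omega>. (z \<omega> - V (k + K) \<omega>)\<^sup>2)" for k
    by (rule integrableI_bounded) (use fin[of k] in auto)
  have "(\<lambda>k. ?n (k + K)) \<longlonglongrightarrow> ennreal 0"
    using LIMSEQ_ignore_initial_segment[OF lim] by simp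
  then have "(\<lambda>k. enn2real (?n (k + K))) \<longlonglongrightarrow> 0"
    by (rule tendsto_enn2real) simp
  moreover have "(\<integral>\<omega>. norm ((z \<omega> - V (k + K) \<omega>)\<^sup>2) \<partial>M) = enn2real (?n (k + K))" for k
    by (subst integral_eq_nn_integral) auto
  ultimately have "(\<lambda>k. \<integral>\<omega>. norm ((z \<omega> - V (k + K) \<omega>)\<^sup>2) \<partial>M) \<longlonglongrightarrow> 0" by simp
  from tendsto_L1_AE_subseq[OF int this]
  obtain r :: "nat \<Rightarrow> nat" where r: "AE \<omega> in M. (\<lambda>k. (z \<omega> - V (r k + K) \<omega>)\<^sup>2) \<longlonglongrightarrow> 0" by auto
  have "AE \<omega> in M. (\<lambda>k. V (r k + K) \<omega>) \<longlonglongrightarrow> z \<omega>"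
    using r
  proof eventually_elim
    case (elim \<omega>)
    then have "(\<lambda>k. sqrt ((z \<omega> - V (r k + K) \<omega>)\<^sup>2)) \<longlonglongrightarrow> sqrt 0" by (rule tendsto_real_sqrt)
    then have "(\<lambda>k. z \<omega> - V (r k + K) \<omega>) \<longlonglongrightarrow> 0" by (simp add: tendsto_rabs_zero_iff)
    from tendsto_diff[OF tendsto_const[of "z \<omega>"] this] show ?case by simp
  qed
  then show thesis by (rule that)
qed

text \<open>This is the second sigma-algebra in \<open>indep_process_random_measure\<close>, so its
  independence of \<open>w\<close> is the hypothesis itself.\<close>

definition jump_algebra :: "'w measure \<Rightarrow> ('w \<Rightarrow> 'e measure) \<Rightarrow> 'e measure \<Rightarrow> 'w measure" where
  "jump_algebra M \<mu> \<nu> = vimage_algebra (space M) (\<lambda>\<omega>. \<lambda>A\<in>sets \<nu>. emeasure (\<mu> \<omega>) A) (PiM (sets \<nu>) (\<lambda>_. borel))"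

text \<open>The truncated compensated integrals depend on \<open>\<omega>\<close> only through the
  values of \<open>\<mu>\<close> on measurable sets, and \<open>z t\<close> is the almost sure limit
  of a subsequence of them. Equality holds off a null set because the jump sigma-algebra is not
  completed.\<close>

lemma compensated_jump_process_jump_algebra:
  assumes L: "measure_on_R0 L" and \<mu>: "poisson_random_measure M \<mu> (jump_compensator L)"
    and z: "compensated_jump_process M \<mu> L z" and t: "0 \<le> t"
  obtains z' where "z' \<in> borel_measurable (jump_algebra M \<mu> (jump_compensator L))" "AE \<omega> in M. z t \<omega> = z' \<omega>"
proof -
  let ?\<nu> = "jump_compensator L" and ?G = "jump_algebra M \<mu> (jump_compensator L)"
  have \<nu>[measurable_cong]: "sets ?\<nu> = sets (borel \<Otimes>\<^sub>M borel)"
    using L by (auto simp: jump_compensator_def measure_on_R0_def cong: sets_pair_measure_cong)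
  have sG[simp]: "space ?G = space M" by (simp add: jump_algebra_def)
  have sets\<mu>: "\<And>\<omega>. \<omega> \<in> space M \<Longrightarrow> sets (\<mu> \<omega>) = sets ?\<nu>" using \<mu> by (simp add: poisson_random_measure_def)
  have mM: "(\<lambda>\<omega>. emeasure (\<mu> \<omega>) A) \<in> borel_measurable M" if "A \<in> sets ?\<nu>" for A
    using \<mu> that by (simp add: poisson_random_measure_def)
  have mG: "(\<lambda>\<omega>. emeasure (\<mu> \<omega>) A) \<in> borel_measurable ?G" if A: "A \<in> sets ?\<nu>" for A
  proof -
    have "(\<lambda>\<omega>. \<lambda>A\<in>sets ?\<nu>. emeasure (\<mu> \<omega>) A) \<in> measurable ?G (PiM (sets ?\<nu>) (\<lambda>_. borel))"
      unfolding jump_algebra_def by (rule measurable_vimage_algebra1) (auto simp: space_PiM)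
    from measurable_compose[OF this measurable_component_singleton[OF A]] A show ?thesis by simp
  qed
  let ?A = "\<lambda>k. {0<..t} \<times> {x. 1 / real (Suc k) < \<bar>x\<bar>}"
  define V where "V k \<omega> = (LINT p:?A k|\<mu> \<omega>. snd p) - (LINT p:?A k|?\<nu>. snd p)" for k \<omega>
  have f: "(\<lambda>p. indicator (?A k) p *\<^sub>R snd p) \<in> borel_measurable ?\<nu>" for k
  proof -
    have "{x::real. 1 / real (Suc k) < \<bar>x\<bar>} \<in> sets borel" by measurable
    then have [measurable]: "?A k \<in> sets (borel \<Otimes>\<^sub>M borel)" by auto
    show ?thesis by measurable
  qed
  have VG[measurable]: "V k \<in> borel_measurable ?G" for k
    unfolding V_def set_lebesgue_integral_def
    by (intro borel_measurable_diff measurable_kernel_lebesgue_integral[OF _ mG f] borel_measurable_const) (use sets\<mu> in auto)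
  have VM[measurable]: "V k \<in> borel_measurable M" for k
    unfolding V_def set_lebesgue_integral_def
    by (intro borel_measurable_diff measurable_kernel_lebesgue_integral[OF _ mM f] borel_measurable_const) (use sets\<mu> in auto)
  have zM: "z t \<in> borel_measurable M" using z t by (simp add: compensated_jump_process_def)
  have lim: "((\<lambda>\<epsilon>. \<integral>\<^sup>+ \<omega>. ennreal ((z t \<omega>
              - ((LINT p:({0<..t} \<times> {x. \<epsilon> < \<bar>x\<bar>})|\<mu> \<omega>. snd p)
               - (LINT p:({0<..t} \<times> {x. \<epsilon> < \<bar>x\<bar>})|?\<nu>. snd p)))\<^sup>2) \<partial>M)
         \<longlongrightarrow> 0) (at_right 0)" using z t by (simp add: compensated_jump_process_def)
  \<comment> \<open>The mean-square limit at \<open>0\<close> from the right is sampled along the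
    truncation levels \<open>1 / real (Suc k)\<close>.\<close>
  have "filterlim (\<lambda>k. 1 / real (Suc k)) (at_right 0) sequentially"
    unfolding filterlim_at using LIMSEQ_inverse_real_of_nat by (auto simp: inverse_eq_divide)
  from filterlim_compose[OF lim this]
  have "(\<lambda>k. \<integral>\<^sup>+ \<omega>. ennreal ((z t \<omega> - V k \<omega>)\<^sup>2) \<partial>M) \<longlonglongrightarrow> 0" unfolding V_def .
  from tendsto_L2_AE_subseq[OF zM VM this]
  obtain r :: "nat \<Rightarrow> nat" where r: "AE \<omega> in M. (\<lambda>k. V (r k) \<omega>) \<longlonglongrightarrow> z t \<omega>" .
  show thesis
  proof (rule that)
    \<comment> \<open>\<open>lim\<close> is defined at every \<open>\<omega>\<close>, convergent or
      not, which provides a representative measurable on the whole space.\<close>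
    show "(\<lambda>\<omega>. lim (\<lambda>k. V (r k) \<omega>)) \<in> borel_measurable ?G" by measurable
    show "AE \<omega> in M. z t \<omega> = lim (\<lambda>k. V (r k) \<omega>)"
      using r by eventually_elim (simp add: limI)
  qed
qed

section \<open>Periodic signals and partitions\<close>

lemma periodic_nat:
  fixes f :: "real \<Rightarrow> real"
  assumes "\<And>t. f (t + 1) = f t"
  shows "f (t + real k) = f t"
proof (induction k)
  case (Suc k)
  have "t + real (Suc k) = (t + real k) + 1" by simp
  then show ?case using Suc assms by metis
qed simp

lemma periodic_has_integral:
  fixes f :: "real \<Rightarrow> real"
  assumes per: "\<And>t. f (t + 1) = f t" and f: "(f has_integral I) {0..1}"
  shows "(f has_integral real n * I) {0..real n}"
proof (induction n)
  case 0 show ?case using has_integral_refl(1)[of f 0] by (simp add: cbox_interval)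
next
  case (Suc n)
  have "((\<lambda>x. f (1 *\<^sub>R x + (- real n))) has_integral (1 / \<bar>1\<bar> ^ DIM(real)) *\<^sub>R I) ((\<lambda>x. (1/1) *\<^sub>R x + - ((1/1) *\<^sub>R (- real n))) ` cbox 0 1)"
    by (rule has_integral_affinity) (use f in \<open>simp_all add: cbox_interval\<close>)
  moreover have "(\<lambda>x. x + real n) ` {0..1::real} = {real n..real (Suc n)}"
    using image_add_atLeastAtMost'[of "real n" 0 1] by (simp add: add.commute)
  moreover have "f (x - real n) = f x" for x
    using periodic_nat[of f "x - real n" n] per by (metis diff_add_cancel)
  ultimately have "(f has_integral I) {real n..real (Suc n)}"
    by (simp add: cbox_interval)
  from has_integral_combine[OF _ _ Suc this] show ?case
    by (simp add: algebra_simps)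
qed

text \<open>The bound \<open>\<bar>f t\<bar> \<le> 1 + (f t)\<^sup>2\<close> gives integrability
  over one period. Translating periods and adding them is done with the gauge integral, which
  produces the factor \<open>n\<close>.\<close>

lemma square_integrable_01_periodic:
  fixes f :: "real \<Rightarrow> real"
  assumes per: "\<And>t. f (t + 1) = f t" and f: "square_integrable_01 f"
  shows "f absolutely_integrable_on {0..real n}"
    and "((\<lambda>t. (f t)\<^sup>2) has_integral real n * norm_sq_01 f) {0..real n}"
proof -
  have i2: "integrable (lebesgue_on {0..1}) (\<lambda>t. (f t)\<^sup>2)" and m: "f \<in> borel_measurable (lebesgue_on {0..1})"
    using f by (auto simp: square_integrable_01_def)
  have "((\<lambda>t. (f t)\<^sup>2) has_integral norm_sq_01 f) {0..1}"
    unfolding norm_sq_01_def by (rule has_integral_integral_lebesgue_on[OF i2]) simp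
  then show "((\<lambda>t. (f t)\<^sup>2) has_integral real n * norm_sq_01 f) {0..real n}"
    by (intro periodic_has_integral) (simp_all add: per)
  interpret finite_measure "lebesgue_on {0..1::real}"
    by (rule finite_measure_lebesgue_on) simp
  have i1: "integrable (lebesgue_on {0..1}) f"
  proof (rule Bochner_Integration.integrable_bound)
    show "integrable (lebesgue_on {0..1}) (\<lambda>t. 1 + (f t)\<^sup>2)" using i2 by simp
    show "AE t in lebesgue_on {0..1}. norm (f t) \<le> norm (1 + (f t)\<^sup>2)"
    proof (rule AE_I2)
      fix t
      have "0 \<le> (1 - \<bar>f t\<bar>)\<^sup>2 + (f t)\<^sup>2 + 1" by simp
      then have "\<bar>f t\<bar> \<le> 1 + (f t)\<^sup>2" by (simp add: power2_eq_square algebra_simps)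
      then show "norm (f t) \<le> norm (1 + (f t)\<^sup>2)" by simp
    qed
  qed fact
  have "f integrable_on {0..1}" "(\<lambda>t. \<bar>f t\<bar>) integrable_on {0..1}"
    using has_integral_integral_lebesgue_on[OF i1] has_integral_integral_lebesgue_on[of "{0..1}" "\<lambda>t. \<bar>f t\<bar>"] i1
    by (auto simp: has_integral_iff)
  then have "f integrable_on {0..real n}" "(\<lambda>t. \<bar>f t\<bar>) integrable_on {0..real n}"
    using periodic_has_integral[of f _ n, OF per] periodic_has_integral[of "\<lambda>t. \<bar>f t\<bar>" _ n] per
    unfolding integrable_on_def by (blast, metis)
  then show "f absolutely_integrable_on {0..real n}"
    by (simp add: absolutely_integrable_on_def)
qed

text \<open>With \<open>c\<close> the mean value of \<open>f\<close>, the integral of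
  \<open>(f t - c)\<^sup>2\<close> is nonnegative.\<close>

lemma integral_square_le:
  fixes f :: "real \<Rightarrow> real"
  assumes f: "f integrable_on {a..b}" "(\<lambda>t. (f t)\<^sup>2) integrable_on {a..b}" and ab: "a < b"
  shows "(integral {a..b} f)\<^sup>2 / (b - a) \<le> integral {a..b} (\<lambda>t. (f t)\<^sup>2)"
proof -
  define c where "c = integral {a..b} f / (b - a)"
  have "((\<lambda>t. (f t)\<^sup>2 - 2 * c * f t + c\<^sup>2) has_integral
      integral {a..b} (\<lambda>t. (f t)\<^sup>2) - 2 * c * integral {a..b} f + c\<^sup>2 * (b - a)) {a..b}"
    using f ab has_integral_const_real[of "c\<^sup>2" a b]
    by (intro has_integral_add has_integral_diff has_integral_mult_right integrable_integral) (auto simp: mult.commute)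
  then have "0 \<le> integral {a..b} (\<lambda>t. (f t)\<^sup>2) - 2 * c * integral {a..b} f + c\<^sup>2 * (b - a)"
  proof (rule has_integral_nonneg)
    fix t
    have "(f t)\<^sup>2 - 2 * c * f t + c\<^sup>2 = (f t - c)\<^sup>2" by (simp add: power2_eq_square algebra_simps)
    then show "0 \<le> (f t)\<^sup>2 - 2 * c * f t + c\<^sup>2" by simp
  qed
  moreover have "integral {a..b} f = c * (b - a)" using ab by (simp add: c_def)
  ultimately show ?thesis using ab by (simp add: power2_eq_square)
qed

text \<open>The left side is, up to the factor \<open>1 / \<sigma>\<^sub>1\<^sup>2\<close>, the
  Fisher information in the increments. Cauchy-Schwarz on every cell bounds it by a quantity free of
  the partition.\<close>

lemma partition_sum_integral_square_le:
  fixes f :: "real \<Rightarrow> real" and \<tau> :: "nat \<Rightarrow> real"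
  assumes f: "f integrable_on {\<tau> 0..b}" "(\<lambda>t. (f t)\<^sup>2) integrable_on {\<tau> 0..b}"
    and \<tau>: "\<And>i. i < m \<Longrightarrow> \<tau> i < \<tau> (Suc i)" "\<tau> m \<le> b"
  shows "(\<Sum>i<m. (integral {\<tau> i..\<tau> (Suc i)} f)\<^sup>2 / (\<tau> (Suc i) - \<tau> i)) \<le> integral {\<tau> 0..b} (\<lambda>t. (f t)\<^sup>2)"
proof -
  have mono: "\<tau> 0 \<le> \<tau> k" if "k \<le> m" for k
    using that
  proof (induction k)
    case (Suc k) then show ?case using \<tau>(1)[of k] by simp
  qed simp
  have *: "(\<Sum>i<k. (integral {\<tau> i..\<tau> (Suc i)} f)\<^sup>2 / (\<tau> (Suc i) - \<tau> i)) \<le> integral {\<tau> 0..\<tau> k} (\<lambda>t. (f t)\<^sup>2)"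
    if "k \<le> m" "\<tau> k \<le> b" for k
    using that
  proof (induction k)
    case (Suc k)
    have lt: "\<tau> k < \<tau> (Suc k)" and 0: "\<tau> 0 \<le> \<tau> k" using \<tau>(1)[of k] mono[of k] Suc.prems by auto
    have i: "f integrable_on {\<tau> k..\<tau> (Suc k)}" "(\<lambda>t. (f t)\<^sup>2) integrable_on {\<tau> k..\<tau> (Suc k)}"
       "(\<lambda>t. (f t)\<^sup>2) integrable_on {\<tau> 0..\<tau> (Suc k)}"
      using f Suc.prems lt 0 by (auto intro: integrable_on_subinterval)
    have "(\<Sum>i<Suc k. (integral {\<tau> i..\<tau> (Suc i)} f)\<^sup>2 / (\<tau> (Suc i) - \<tau> i))
        \<le> integral {\<tau> 0..\<tau> k} (\<lambda>t. (f t)\<^sup>2) + integral {\<tau> k..\<tau> (Suc k)} (\<lambda>t. (f t)\<^sup>2)"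
      using Suc lt integral_square_le[OF i(1,2) lt] by simp
    also have "\<dots> = integral {\<tau> 0..\<tau> (Suc k)} (\<lambda>t. (f t)\<^sup>2)"
      using 0 lt i(3) by (intro Henstock_Kurzweil_Integration.integral_combine) auto
    finally show ?case .
  qed simp
  have "integral {\<tau> 0..\<tau> m} (\<lambda>t. (f t)\<^sup>2) \<le> integral {\<tau> 0..b} (\<lambda>t. (f t)\<^sup>2)"
    using f \<tau>(2) by (intro integral_subset_le) (auto intro: integrable_on_subinterval)
  with *[of m] \<tau>(2) show ?thesis by simp
qed

text \<open>The endpoints are added to \<open>J\<close> and the resulting set is sorted. Starting at
  \<open>0\<close>, where \<open>w\<close> and the integrated signal vanish, lets sums of increments
  recover their values at every point of \<open>J\<close>.\<close>

lemma finite_set_partition: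
  fixes J :: "real set"
  assumes J: "finite J" "J \<subseteq> {0..b}" and b: "0 < b"
  obtains \<tau> :: "nat \<Rightarrow> real" and m where "\<tau> 0 = 0" "\<tau> m = b" "mono \<tau>" "\<And>i. i < m \<Longrightarrow> \<tau> i < \<tau> (Suc i)"
    "0 < m" "J \<subseteq> \<tau> ` {..m}"
proof -
  define K where "K = insert 0 (insert b J)"
  have K: "finite K" "K \<subseteq> {0..b}" "0 \<in> K" "b \<in> K" using J b by (auto simp: K_def)
  define xs where "xs = sorted_list_of_set K"
  have xs: "sorted_wrt (<) xs" "set xs = K" unfolding xs_def using K by auto
  define m where "m = length xs - 1"
  \<comment> \<open>Constant from \<open>m\<close> on, so that \<open>\<tau>\<close> is monotone on
    all of \<open>nat\<close> as the definition of Brownian motion asks.\<close>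
  define \<tau> where "\<tau> i = xs ! min i m" for i
  have ne: "xs \<noteq> []" using xs K by auto
  then have len: "length xs = Suc m" by (simp add: m_def)
  have lt: "xs ! i < xs ! j" if "i < j" "j \<le> m" for i j
    using sorted_wrt_nth_less[OF xs(1) that(1)] that len by simp
  have inK: "xs ! i \<in> K" if "i \<le> m" for i using that len xs(2) nth_mem[of i xs] by simp
  have idx: "\<exists>i\<le>m. xs ! i = x" if "x \<in> K" for x
    using that xs(2) len by (metis in_set_conv_nth less_Suc_eq_le)
  have \<tau>0: "\<tau> 0 = 0"
  proof -
    obtain i where i: "i \<le> m" "xs ! i = 0" using idx[OF K(3)] by blast
    have "0 \<le> xs ! 0" using inK[of 0] K(2) by auto
    then have "i = 0" using lt[of 0 i] i by (cases "i = 0") auto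
    then show ?thesis using i by (simp add: \<tau>_def)
  qed
  have \<tau>m: "\<tau> m = b"
  proof -
    obtain i where i: "i \<le> m" "xs ! i = b" using idx[OF K(4)] by blast
    have "xs ! m \<le> b" using inK[of m] K(2) by auto
    then have "i = m" using lt[of i m] i by (cases "i = m") auto
    then show ?thesis using i by (simp add: \<tau>_def)
  qed
  show thesis
  proof (rule that[of \<tau> m, OF \<tau>0 \<tau>m])
    show "mono \<tau>"
    proof (rule monoI)
      fix i j :: nat assume "i \<le> j"
      then show "\<tau> i \<le> \<tau> j" unfolding \<tau>_def
        using lt[of "min i m" "min j m"] by (cases "min i m = min j m") (auto simp: min_def split: if_splits)
    qed
    show "\<tau> i < \<tau> (Suc i)" if "i < m" for i using lt[of i "Suc i"] that by (simp add: \<tau>_def)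
    show "0 < m" using \<tau>0 \<tau>m b by (cases m) auto
    show "J \<subseteq> \<tau> ` {..m}"
    proof
      fix x assume "x \<in> J"
      then obtain i where "i \<le> m" "xs ! i = x" using idx[of x] by (auto simp: K_def)
      then show "x \<in> \<tau> ` {..m}" by (auto simp: \<tau>_def image_iff intro!: bexI[of _ i])
    qed
  qed
qed

section \<open>The regression model\<close>

lemma cadlag_on_restrict_add:
  assumes a: "continuous_on {0..b} a" and z: "cadlag_on {0..} z"
  shows "cadlag_on {0..b} (\<lambda>t\<in>{0..b}. a t + c * z t)"
  unfolding cadlag_on_def
proof (intro ballI conjI)
  fix t assume t: "t \<in> {0..b}"
  have at: "(a \<longlongrightarrow> a t) (at t within S)" if "S \<subseteq> {0..b}" for S
    using a t that unfolding continuous_on_def by (blast intro: tendsto_within_subset)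
  have eq: "((\<lambda>t\<in>{0..b}. a t + c * z t) \<longlongrightarrow> l) (at t within S) \<longleftrightarrow> ((\<lambda>t. a t + c * z t) \<longlongrightarrow> l) (at t within S)"
    if "S \<subseteq> {0..b}" for S l
    using that by (intro Lim_cong_within) auto
  have "(z \<longlongrightarrow> z t) (at t within ({0..} \<inter> {t<..}))"
    using z t unfolding cadlag_on_def by auto
  then have "(z \<longlongrightarrow> z t) (at t within ({0..b} \<inter> {t<..}))" by (rule tendsto_within_subset) auto
  then have "((\<lambda>t. a t + c * z t) \<longlongrightarrow> a t + c * z t) (at t within ({0..b} \<inter> {t<..}))"
    by (intro tendsto_intros at) auto
  then show "((\<lambda>t\<in>{0..b}. a t + c * z t) \<longlongrightarrow> (\<lambda>t\<in>{0..b}. a t + c * z t) t) (at t within ({0..b} \<inter> {t<..}))"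
    using t by (subst eq) auto
  obtain l where "(z \<longlongrightarrow> l) (at t within ({0..} \<inter> {..<t}))"
    using z t unfolding cadlag_on_def by auto
  then have "(z \<longlongrightarrow> l) (at t within ({0..b} \<inter> {..<t}))" by (rule tendsto_within_subset) auto
  then have "((\<lambda>t. a t + c * z t) \<longlongrightarrow> a t + c * l) (at t within ({0..b} \<inter> {..<t}))"
    by (intro tendsto_intros at) auto
  then show "\<exists>l. ((\<lambda>t\<in>{0..b}. a t + c * z t) \<longlongrightarrow> l) (at t within ({0..b} \<inter> {..<t}))"
    by (subst eq) auto
qed

locale levy_regression =
  fixes M :: "'w measure"
    and w z :: "real \<Rightarrow> 'w \<Rightarrow> real"
    and \<mu> :: "'w \<Rightarrow> (real \<times> real) measure"
    and L :: "real measure"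
    and \<sigma>\<^sub>1 \<sigma>\<^sub>2 y0 :: real
    and n :: nat
    and \<psi> :: "'d::finite \<Rightarrow> real \<Rightarrow> real"
  assumes pM: "prob_space M"
    and L: "measure_on_R0 L"
    and w: "brownian_motion M w"
    and \<mu>: "poisson_random_measure M \<mu> (jump_compensator L)"
    and indep: "indep_process_random_measure M w \<mu> (jump_compensator L)"
    and z: "compensated_jump_process M \<mu> L z"
    and \<sigma>\<^sub>1: "\<sigma>\<^sub>1 \<noteq> 0"
    and n: "n \<ge> 1"
    and \<psi>_periodic: "\<And>i t. \<psi> i (t + 1) = \<psi> i t"
    and \<psi>_L2: "\<And>i. square_integrable_01 (\<psi> i)"
begin

sublocale prob_space M by (rule pM)

definition path :: "real ^ 'd \<Rightarrow> 'w \<Rightarrow> real \<Rightarrow> real" where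
  "path \<theta> \<omega> = (\<lambda>t\<in>{0..real n}. observation y0 \<psi> (\<lambda>t \<omega>. \<sigma>\<^sub>1 * w t \<omega> + \<sigma>\<^sub>2 * z t \<omega>) \<theta> t \<omega>)"

text \<open>The coefficient of theta_i in the observation at time \<open>t\<close>. The gauge
  integral is used because it is additive over adjacent intervals.\<close>

definition drift :: "'d \<Rightarrow> real \<Rightarrow> real" where
  "drift i t = integral {0..t} (\<psi> i)"

lemma \<psi>_integrable:
  assumes "0 \<le> t" "t \<le> real n"
  shows "integrable (lebesgue_on {0..t}) (\<psi> i)"
proof -
  have "\<psi> i absolutely_integrable_on {0..real n}"
    by (rule square_integrable_01_periodic(1)[OF \<psi>_periodic \<psi>_L2])
  then have "\<psi> i absolutely_integrable_on {0..t}"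
    by (rule set_integrable_subset) (use assms in auto)
  then show ?thesis by (simp add: integrable_restrict_space set_integrable_def)
qed

lemma \<psi>_integrable_on: "\<psi> i integrable_on {0..real n}"
  using square_integrable_01_periodic(1)[OF \<psi>_periodic \<psi>_L2] by (rule absolutely_integrable_on_def[THEN iffD1, THEN conjunct1])

lemma path_eq:
  assumes "t \<in> {0..real n}"
  shows "path \<theta> \<omega> t = y0 + (\<Sum>i\<in>UNIV. \<theta> $ i * drift i t) + \<sigma>\<^sub>1 * w t \<omega> + \<sigma>\<^sub>2 * z t \<omega>"
proof -
  have "(LINT s|lebesgue_on {0..t}. signal \<psi> \<theta> s) = (\<Sum>i\<in>UNIV. \<theta> $ i * (LINT s|lebesgue_on {0..t}. \<psi> i s))"
    unfolding signal_def using assms \<psi>_integrable by (subst Bochner_Integration.integral_sum) auto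
  also have "\<dots> = (\<Sum>i\<in>UNIV. \<theta> $ i * drift i t)"
    unfolding drift_def using assms \<psi>_integrable by (intro sum.cong refl) (simp add: lebesgue_integral_eq_integral)
  finally show ?thesis using assms by (simp add: path_def observation_def)
qed

lemma drift_continuous: "continuous_on {0..real n} (drift i)"
  unfolding drift_def[abs_def] by (rule indefinite_integral_continuous_1[OF \<psi>_integrable_on])

lemma w_measurable[measurable (raw)]: "0 \<le> t \<Longrightarrow> w t \<in> borel_measurable M"
  using w by (simp add: brownian_motion_def)

lemma z_measurable: "0 \<le> t \<Longrightarrow> z t \<in> borel_measurable M"
  using z by (simp add: compensated_jump_process_def)

lemma path_cadlag:
  assumes "\<omega> \<in> space M"
  shows "cadlag_on {0..real n} (path \<theta> \<omega>)"
proof -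
  have c: "continuous_on {0..real n} (\<lambda>t. w t \<omega>)"
    using w assms unfolding brownian_motion_def by (auto intro: continuous_on_subset)
  have zc: "cadlag_on {0..} (\<lambda>t. z t \<omega>)"
    using z assms unfolding compensated_jump_process_def by auto
  have "cadlag_on {0..real n} (\<lambda>t\<in>{0..real n}. (y0 + (\<Sum>i\<in>UNIV. \<theta> $ i * drift i t) + \<sigma>\<^sub>1 * w t \<omega>) + \<sigma>\<^sub>2 * z t \<omega>)"
    by (rule cadlag_on_restrict_add[OF _ zc]) (intro continuous_intros drift_continuous c)
  also have "(\<lambda>t\<in>{0..real n}. (y0 + (\<Sum>i\<in>UNIV. \<theta> $ i * drift i t) + \<sigma>\<^sub>1 * w t \<omega>) + \<sigma>\<^sub>2 * z t \<omega>) = path \<theta> \<omega>"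
    using path_eq[of _ \<theta> \<omega>] by (auto simp: fun_eq_iff path_def restrict_def)
  finally show ?thesis .
qed

text \<open>Joint measurability in theta and \<open>\<omega>\<close> is what makes the mixture of
  the laws over the prior a measure on path space.\<close>

lemma path_measurable_pair: "(\<lambda>x. path (fst x) (snd x)) \<in> measurable (borel \<Otimes>\<^sub>M M) (skorokhod_space n)"
  unfolding skorokhod_space_def
proof (rule measurable_restrict_space2)
  show "(\<lambda>x. path (fst x) (snd x)) \<in> space (borel \<Otimes>\<^sub>M M) \<rightarrow> {x. cadlag_on {0..real n} x}"
    using path_cadlag by (auto simp: space_pair_measure)
  have [measurable]: "(\<lambda>\<theta>::real ^ 'd. \<theta> $ i) \<in> borel_measurable borel" for i
    by (intro borel_measurable_continuous_onI continuous_intros)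
  show "(\<lambda>x. path (fst x) (snd x)) \<in> measurable (borel \<Otimes>\<^sub>M M) (\<Pi>\<^sub>M t\<in>{0..real n}. borel)"
  proof (rule measurable_PiM_single')
    fix t assume t: "t \<in> {0..real n}"
    then have [measurable]: "w t \<in> borel_measurable M" "z t \<in> borel_measurable M"
      using w_measurable z_measurable by auto
    show "(\<lambda>x. path (fst x) (snd x) t) \<in> borel_measurable (borel \<Otimes>\<^sub>M M)"
      unfolding path_eq[OF t] by measurable
  qed (auto simp: path_def)
qed

lemma path_measurable: "path \<theta> \<in> measurable M (skorokhod_space n)"
  using measurable_compose[OF measurable_Pair1'[of \<theta> borel M] path_measurable_pair] by simp

lemma increments:
  fixes \<tau> :: "nat \<Rightarrow> real"
  assumes \<tau>: "0 \<le> \<tau> 0" "mono \<tau>" "\<And>i. i < m \<Longrightarrow> \<tau> i < \<tau> (Suc i)"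
  shows "indep_vars (\<lambda>_. borel) (\<lambda>i \<omega>. w (\<tau> (Suc i)) \<omega> - w (\<tau> i) \<omega>) {..<m}"
    and "\<And>i. i < m \<Longrightarrow> distributed M lborel (\<lambda>\<omega>. w (\<tau> (Suc i)) \<omega> - w (\<tau> i) \<omega>)
          (normal_density 0 (sqrt (\<tau> (Suc i) - \<tau> i)))"
proof -
  show "indep_vars (\<lambda>_. borel) (\<lambda>i \<omega>. w (\<tau> (Suc i)) \<omega> - w (\<tau> i) \<omega>) {..<m}"
    using w \<tau> unfolding brownian_motion_def by blast
  fix i assume i: "i < m"
  have "0 \<le> \<tau> i" using \<tau>(1) monoD[OF \<tau>(2), of 0 i] by simp
  then show "distributed M lborel (\<lambda>\<omega>. w (\<tau> (Suc i)) \<omega> - w (\<tau> i) \<omega>)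
          (normal_density 0 (sqrt (\<tau> (Suc i) - \<tau> i)))"
    using w \<tau>(3)[OF i] unfolding brownian_motion_def by blast
qed

abbreviation "G \<equiv> jump_algebra M \<mu> (jump_compensator L)"

lemma jump_algebra_subset: "sets G \<subseteq> events" "space G = space M"
  using indep unfolding indep_process_random_measure_def indep_sets2_eq jump_algebra_def by auto

text \<open>The second component is the identity, regarded as a map into the coarser sigma-algebra
  \<open>G\<close>. It carries all jump information at once, whatever functionals of the jumps occur
  later.\<close>

lemma increments_jump_independent:
  fixes \<tau> :: "nat \<Rightarrow> real"
  assumes \<tau>: "\<And>i. 0 \<le> \<tau> i"
  shows "distr M ((\<Pi>\<^sub>M i\<in>{..<m}. borel) \<Otimes>\<^sub>M G) (\<lambda>\<omega>. (\<lambda>i\<in>{..<m}. w (\<tau> (Suc i)) \<omega> - w (\<tau> i) \<omega>, \<omega>))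
     = distr M (\<Pi>\<^sub>M i\<in>{..<m}. borel) (\<lambda>\<omega>. \<lambda>i\<in>{..<m}. w (\<tau> (Suc i)) \<omega> - w (\<tau> i) \<omega>) \<Otimes>\<^sub>M distr M G (\<lambda>\<omega>. \<omega>)"
proof (rule distr_pair_indep_set)
  let ?W = "vimage_algebra (space M) (\<lambda>\<omega>. \<lambda>t\<in>{0..}. w t \<omega>) (PiM {0..} (\<lambda>_. borel))"
  show "indep_set (sets ?W) (sets G)"
    using indep unfolding indep_process_random_measure_def jump_algebra_def .
  have [measurable]: "w (\<tau> i) \<in> borel_measurable M" for i using \<tau> w_measurable by blast
  show "(\<lambda>\<omega>. \<lambda>i\<in>{..<m}. w (\<tau> (Suc i)) \<omega> - w (\<tau> i) \<omega>) \<in> measurable M (\<Pi>\<^sub>M i\<in>{..<m}. borel)" by measurable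
  show "(\<lambda>\<omega>. \<omega>) \<in> measurable M G"
    using jump_algebra_subset by (intro measurableI) (auto intro: subsetD)
  show "(\<lambda>\<omega>. \<omega>) -` b \<inter> space M \<in> sets G" if "b \<in> sets G" for b
    using sets.Int_space_eq2[OF that] that jump_algebra_subset(2) by simp
  have "(\<lambda>\<omega>. \<lambda>t\<in>{0..}. w t \<omega>) \<in> measurable ?W (PiM {0..} (\<lambda>_. borel))"
    by (rule measurable_vimage_algebra1) (auto simp: space_PiM)
  from measurable_compose[OF this measurable_component_singleton[of "\<tau> _"]]
  have [measurable]: "w (\<tau> i) \<in> borel_measurable ?W" for i using \<tau>[of i] by simp
  have X: "(\<lambda>\<omega>. \<lambda>i\<in>{..<m}. w (\<tau> (Suc i)) \<omega> - w (\<tau> i) \<omega>) \<in> measurable ?W (\<Pi>\<^sub>M i\<in>{..<m}. borel)"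
    by measurable
  show "(\<lambda>\<omega>. \<lambda>i\<in>{..<m}. w (\<tau> (Suc i)) \<omega> - w (\<tau> i) \<omega>) -` a \<inter> space M \<in> sets ?W"
    if "a \<in> sets (\<Pi>\<^sub>M i\<in>{..<m}. borel)" for a
    using measurable_sets[OF X that] by simp
qed

end

section \<open>Gaussian scores of increments and the bound for cylinder estimators\<close>

lemma ennreal_inverse_antimono:
  fixes a b :: ennreal
  shows "a \<le> b \<Longrightarrow> inverse b \<le> inverse a"
  including ennreal.lifting by transfer (rule ereal_inverse_antimono)

text \<open>In the application \<open>X i\<close> are Brownian increments, \<open>v i\<close> time
  steps, \<open>a i\<close> increments of the integrated signal and \<open>s\<close> is
  \<open>\<sigma>\<^sub>1\<close>. Then \<open>b\<close> is the linear functional in the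
  Cameron-Martin density and \<open>q\<close> its variance.\<close>

lemma gaussian_score_moments:
  fixes X :: "nat \<Rightarrow> 'w \<Rightarrow> real" and v a :: "nat \<Rightarrow> real" and s :: real and G :: "'w measure"
  assumes "prob_space M" and m: "0 < m" and v': "\<forall>i<m. 0 < v i" and s: "s \<noteq> 0"
    and X': "\<forall>i<m. distributed M lborel (X i) (normal_density 0 (sqrt (v i)))"
    and indep: "prob_space.indep_vars M (\<lambda>_. borel) X {..<m}"
    and G: "(\<lambda>\<omega>. \<omega>) \<in> measurable M G"
      "distr M ((\<Pi>\<^sub>M i\<in>{..<m}. borel) \<Otimes>\<^sub>M G) (\<lambda>\<omega>. (\<lambda>i\<in>{..<m}. X i \<omega>, \<omega>))
         = distr M (\<Pi>\<^sub>M i\<in>{..<m}. borel) (\<lambda>\<omega>. \<lambda>i\<in>{..<m}. X i \<omega>) \<Otimes>\<^sub>M distr M G (\<lambda>\<omega>. \<omega>)"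
  defines "b \<equiv> \<lambda>\<omega>. \<Sum>i<m. a i / (s * v i) * X i \<omega>" and "q \<equiv> \<Sum>i<m. (a i)\<^sup>2 / (s\<^sup>2 * v i)"
  shows "\<And>F t. F \<in> borel_measurable ((\<Pi>\<^sub>M i\<in>{..<m}. borel) \<Otimes>\<^sub>M G) \<Longrightarrow>
      (\<integral>\<^sup>+\<omega>. F (\<lambda>i\<in>{..<m}. X i \<omega> + t * a i / s, \<omega>) \<partial>M)
      = (\<integral>\<^sup>+\<omega>. F (\<lambda>i\<in>{..<m}. X i \<omega>, \<omega>) * ennreal (exp (t * b \<omega> - t\<^sup>2 * q / 2)) \<partial>M)" (is "PROP ?shift")
    and "\<And>t. (\<integral>\<^sup>+\<omega>. ennreal (exp (t * b \<omega> - t\<^sup>2 * q / 2)) \<partial>M) = 1"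
    and "\<And>t r. (\<integral>\<^sup>+\<omega>. ennreal ((b \<omega> - t * q + r)\<^sup>2 * exp (t * b \<omega> - t\<^sup>2 * q / 2)) \<partial>M) = ennreal (q + r\<^sup>2)"
proof -
  interpret prob_space M by fact
  have v: "\<And>i. i < m \<Longrightarrow> 0 < v i" using v' by blast
  have X: "\<And>i. i \<in> {..<m} \<Longrightarrow> distributed M lborel (X i) (normal_density 0 (sqrt (v i)))" using X' by blast
  have expo: "(\<Sum>i<m. t * a i / s * X i \<omega> / (sqrt (v i))\<^sup>2 - (t * a i / s)\<^sup>2 / (2 * (sqrt (v i))\<^sup>2)) = t * b \<omega> - t\<^sup>2 * q / 2" for t \<omega>
  proof -
    have "(\<Sum>i<m. t * a i / s * X i \<omega> / (sqrt (v i))\<^sup>2 - (t * a i / s)\<^sup>2 / (2 * (sqrt (v i))\<^sup>2))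
       = (\<Sum>i<m. t * (a i / (s * v i) * X i \<omega>) - t\<^sup>2 / 2 * ((a i)\<^sup>2 / (s\<^sup>2 * v i)))"
      using v s by (intro sum.cong refl) (simp add: less_imp_le power_mult_distrib power_divide)
    also have "\<dots> = t * b \<omega> - t\<^sup>2 * q / 2"
      unfolding b_def q_def sum_subtractf sum_distrib_left[symmetric] by simp
    finally show ?thesis .
  qed
  show shift: "PROP ?shift"
  proof -
    fix F :: "(nat \<Rightarrow> real) \<times> 'w \<Rightarrow> ennreal" and t
    assume F: "F \<in> borel_measurable ((\<Pi>\<^sub>M i\<in>{..<m}. borel) \<Otimes>\<^sub>M G)"
    have "(\<integral>\<^sup>+\<omega>. F (\<lambda>i\<in>{..<m}. X i \<omega> + t * a i / s, \<omega>) \<partial>M)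
      = (\<integral>\<^sup>+\<omega>. F (\<lambda>i\<in>{..<m}. X i \<omega>, \<omega>) *
         ennreal (exp (\<Sum>i<m. t * a i / s * X i \<omega> / (sqrt (v i))\<^sup>2 - (t * a i / s)\<^sup>2 / (2 * (sqrt (v i))\<^sup>2))) \<partial>M)"
      by (rule gaussian_shift[OF _ _ _ X indep G F]) (use m v in auto)
    then show "(\<integral>\<^sup>+\<omega>. F (\<lambda>i\<in>{..<m}. X i \<omega> + t * a i / s, \<omega>) \<partial>M)
      = (\<integral>\<^sup>+\<omega>. F (\<lambda>i\<in>{..<m}. X i \<omega>, \<omega>) * ennreal (exp (t * b \<omega> - t\<^sup>2 * q / 2)) \<partial>M)"
      unfolding expo .
  qed
  show "(\<integral>\<^sup>+\<omega>. ennreal (exp (t * b \<omega> - t\<^sup>2 * q / 2)) \<partial>M) = 1" for t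
    using shift[of "\<lambda>_. 1" t] by (simp add: emeasure_space_1)
  show "(\<integral>\<^sup>+\<omega>. ennreal ((b \<omega> - t * q + r)\<^sup>2 * exp (t * b \<omega> - t\<^sup>2 * q / 2)) \<partial>M) = ennreal (q + r\<^sup>2)" for t r
  proof -
    \<comment> \<open>Shifting the increments replaces \<open>b\<close> by \<open>b + t * q\<close>,
      which cancels the centring. What remains is the second moment of \<open>b + r\<close> under
      \<open>M\<close> without any weight.\<close>
    define F :: "(nat \<Rightarrow> real) \<times> 'w \<Rightarrow> ennreal"
      where "F p = ennreal (((\<Sum>i<m. a i / (s * v i) * fst p i) - t * q + r)\<^sup>2)" for p
    have F: "F \<in> borel_measurable ((\<Pi>\<^sub>M i\<in>{..<m}. borel) \<Otimes>\<^sub>M G)" unfolding F_def by measurable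
    have "(\<integral>\<^sup>+\<omega>. ennreal ((b \<omega> - t * q + r)\<^sup>2 * exp (t * b \<omega> - t\<^sup>2 * q / 2)) \<partial>M)
        = (\<integral>\<^sup>+\<omega>. F (\<lambda>i\<in>{..<m}. X i \<omega>, \<omega>) * ennreal (exp (t * b \<omega> - t\<^sup>2 * q / 2)) \<partial>M)"
      by (intro nn_integral_cong) (simp add: F_def b_def ennreal_mult'')
    also have "\<dots> = (\<integral>\<^sup>+\<omega>. F (\<lambda>i\<in>{..<m}. X i \<omega> + t * a i / s, \<omega>) \<partial>M)"
      by (rule shift[OF F, symmetric])
    also have "\<dots> = (\<integral>\<^sup>+\<omega>. ennreal (((\<Sum>i<m. a i / (s * v i) * X i \<omega>) + r)\<^sup>2) \<partial>M)"
    proof (rule nn_integral_cong)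
      fix \<omega>
      have "(\<Sum>i<m. a i / (s * v i) * (X i \<omega> + t * a i / s)) = (\<Sum>i<m. a i / (s * v i) * X i \<omega> + t * ((a i)\<^sup>2 / (s\<^sup>2 * v i)))"
        by (intro sum.cong refl) (simp add: power2_eq_square distrib_left mult_ac)
      also have "\<dots> = (\<Sum>i<m. a i / (s * v i) * X i \<omega>) + t * q"
        by (simp add: sum.distrib q_def sum_distrib_left)
      finally show "F (\<lambda>i\<in>{..<m}. X i \<omega> + t * a i / s, \<omega>) = ennreal (((\<Sum>i<m. a i / (s * v i) * X i \<omega>) + r)\<^sup>2)"
        by (simp add: F_def)
    qed
    also have "\<dots> = ennreal ((\<Sum>i<m. (a i / (s * v i) * sqrt (v i))\<^sup>2) + r\<^sup>2)"
      by (rule gaussian_linear_second_moment[OF _ _ X indep]) (use v in auto)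
    also have "(\<Sum>i<m. (a i / (s * v i) * sqrt (v i))\<^sup>2) = q"
    proof -
      have "(a i / (s * v i) * sqrt (v i))\<^sup>2 = (a i)\<^sup>2 / (s\<^sup>2 * v i)" if "i < m" for i
        using v[OF that] by (simp add: power_mult_distrib power_divide) (simp add: power2_eq_square)
      then show ?thesis unfolding q_def by (intro sum.cong refl) simp
    qed
    finally show ?thesis .
  qed
qed

context levy_regression
begin

lemma van_trees_cylinder:
  fixes u u' :: "'d \<Rightarrow> real \<Rightarrow> real" and g :: "real ^ 'd \<Rightarrow> real" and g' :: "real ^ 'd \<Rightarrow> real ^ 'd"
  assumes u: "\<And>i x. 0 \<le> u i x" "\<And>i. (\<integral>\<^sup>+ x. ennreal (u i x) \<partial>lborel) = 1"
      "\<And>i x. (u i has_real_derivative u' i x) (at x)" "\<And>i. continuous_on UNIV (u' i)"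
    and g: "\<And>\<theta>. (g has_derivative (\<lambda>h. g' \<theta> \<bullet> h)) (at \<theta>)" "continuous_on UNIV g'"
      "\<And>\<theta>. ((\<lambda>s. g (\<chi> k. if k = j then s else \<theta> $ k) * u j s) \<longlongrightarrow> 0) at_infinity"
      "integrable lborel (\<lambda>\<theta>. \<bar>g' \<theta> $ j\<bar> * prior_density u \<theta>)"
    and h: "h \<in> cylinder_functions {0..real n}"
  shows "ennreal ((LINT \<theta>|lborel. g' \<theta> $ j * prior_density u \<theta>)\<^sup>2)
         / (ennreal (real n * norm_sq_01 (\<psi> j) / \<sigma>\<^sub>1\<^sup>2) + prior_information (u j) (u' j))
     \<le> (\<integral>\<^sup>+\<theta>. (\<integral>\<^sup>+\<omega>. ennreal ((h (path \<theta> \<omega>) - g \<theta>)\<^sup>2) \<partial>M) * ennreal (prior_density u \<theta>) \<partial>lborel)"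
proof -
  obtain J k where J: "finite J" "J \<subseteq> {0..real n}" and k[measurable]: "k \<in> borel_measurable (\<Pi>\<^sub>M t\<in>J. borel)"
    and hk: "h = (\<lambda>x. k (restrict x J))"
    using h unfolding cylinder_functions_def by blast
  obtain \<tau> m where \<tau>: "\<tau> 0 = 0" "\<tau> m = real n" "mono \<tau>" "\<And>i. i < m \<Longrightarrow> \<tau> i < \<tau> (Suc i)"
    "0 < m" "J \<subseteq> \<tau> ` {..m}"
    using finite_set_partition[OF J] n by auto
  have \<tau>0: "0 \<le> \<tau> i" for i using monoD[OF \<tau>(3), of 0 i] \<tau>(1) by simp
  have "\<forall>t\<in>J. \<exists>i\<le>m. \<tau> i = t" using \<tau>(6) by auto
  then obtain idx where idx: "\<And>t. t \<in> J \<Longrightarrow> idx t \<le> m" "\<And>t. t \<in> J \<Longrightarrow> \<tau> (idx t) = t" by metis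
  \<comment> \<open>Versions measurable for the jumps are needed before independence of
    \<open>w\<close> can be applied. \<open>J\<close> is finite, so a single null set will
    do.\<close>
  have "\<forall>t\<in>J. \<exists>z'. z' \<in> borel_measurable G \<and> (AE \<omega> in M. z t \<omega> = z' \<omega>)"
    using compensated_jump_process_jump_algebra[OF L \<mu> z] J(2) by (metis atLeastAtMost_iff subsetD)
  then obtain z' where z'[measurable]: "\<And>t. t \<in> J \<Longrightarrow> z' t \<in> borel_measurable G"
    and zz': "\<And>t. t \<in> J \<Longrightarrow> AE \<omega> in M. z t \<omega> = z' t \<omega>" by metis
  let ?B = "\<Pi>\<^sub>M i\<in>{..<m}. borel :: real measure"
  define X where "X i \<omega> = w (\<tau> (Suc i)) \<omega> - w (\<tau> i) \<omega>" for i \<omega>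
  define v where "v i = \<tau> (Suc i) - \<tau> i" for i
  define a where "a i = drift j (\<tau> (Suc i)) - drift j (\<tau> i)" for i
  define b where "b \<omega> = (\<Sum>i<m. a i / (\<sigma>\<^sub>1 * v i) * X i \<omega>)" for \<omega>
  define q where "q = (\<Sum>i<m. (a i)\<^sup>2 / (\<sigma>\<^sub>1\<^sup>2 * v i))"
  have v: "0 < v i" if "i < m" for i using \<tau>(4)[OF that] by (simp add: v_def)
  have idG[measurable]: "(\<lambda>\<omega>. \<omega>) \<in> measurable M G"
    using jump_algebra_subset by (intro measurableI) (auto intro: subsetD)
  have v': "\<forall>i<m. 0 < v i" using v by blast
  have Xd: "\<forall>i<m. distributed M lborel (X i) (normal_density 0 (sqrt (v i)))"
    using increments(2)[of \<tau> m, OF \<tau>0 \<tau>(3,4)] by (simp add: X_def[abs_def] v_def)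
  have Xi: "indep_vars (\<lambda>_. borel) X {..<m}"
    using increments(1)[of \<tau> m, OF \<tau>0 \<tau>(3,4)] by (simp add: X_def[abs_def])
  have XG: "distr M (?B \<Otimes>\<^sub>M G) (\<lambda>\<omega>. (\<lambda>i\<in>{..<m}. X i \<omega>, \<omega>))
         = distr M ?B (\<lambda>\<omega>. \<lambda>i\<in>{..<m}. X i \<omega>) \<Otimes>\<^sub>M distr M G (\<lambda>\<omega>. \<omega>)"
    using increments_jump_independent[of \<tau> m, OF \<tau>0] by (simp add: X_def[abs_def])
  note gauss = gaussian_score_moments[where a=a, OF pM \<tau>(5) v' \<sigma>\<^sub>1 Xd Xi idG XG, folded b_def q_def]
  \<comment> \<open>Rebuilds the data at the times in \<open>J\<close> from a vector
    \<open>x\<close> of increments and the jumps; the sum up to \<open>idx t\<close> plays the role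
    of \<open>w t\<close>.\<close>
  define Y where "Y \<theta> x \<omega> = (\<lambda>t\<in>J. y0 + (\<Sum>i\<in>UNIV. \<theta> $ i * drift i t) + \<sigma>\<^sub>1 * (\<Sum>i<idx t. x i) + \<sigma>\<^sub>2 * z' t \<omega>)"
    for \<theta> :: "real ^ 'd" and x :: "nat \<Rightarrow> real" and \<omega>
  define \<theta>0 where "\<theta>0 \<theta> = (\<chi> i. if i = j then 0 else \<theta> $ i)" for \<theta> :: "real ^ 'd"
  \<comment> \<open>The estimator fed with data generated at theta_j equal to \<open>0\<close>. It
    ignores theta_j, as integration by parts requires.\<close>
  define kk where "kk \<theta> \<omega> = k (Y (\<theta>0 \<theta>) (\<lambda>i\<in>{..<m}. X i \<omega>) \<omega>)" for \<theta> \<omega>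
  have [measurable]: "(\<lambda>\<theta>::real ^ 'd. \<theta> $ i) \<in> borel_measurable borel" for i
    by (intro borel_measurable_continuous_onI continuous_intros)
  \<comment> \<open>The exceptional set stems from \<open>z\<close> alone, so it is the same for
    every theta.\<close>
  have wz: "AE \<omega> in M. \<forall>\<theta>. restrict (path \<theta> \<omega>) J = Y \<theta> (\<lambda>i\<in>{..<m}. X i \<omega>) \<omega>"
  proof -
    have "AE \<omega> in M. \<forall>t\<in>J. z t \<omega> = z' t \<omega>" using J(1) zz' by (simp add: AE_ball_countable countable_finite)
    then show ?thesis using AE_space
    proof eventually_elim
      case (elim \<omega>)
      have w0: "w 0 \<omega> = 0" using w elim(2) by (simp add: brownian_motion_def)
      have "path \<theta> \<omega> t = Y \<theta> (\<lambda>i\<in>{..<m}. X i \<omega>) \<omega> t" if t: "t \<in> J" for \<theta> t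
      proof -
        have "(\<Sum>i<idx t. (\<lambda>i\<in>{..<m}. X i \<omega>) i) = (\<Sum>i<idx t. w (\<tau> (Suc i)) \<omega> - w (\<tau> i) \<omega>)"
          using idx(1)[OF t] by (intro sum.cong) (auto simp: X_def)
        also have "\<dots> = w t \<omega>"
          by (subst sum_lessThan_telescope) (simp add: idx(2)[OF t] \<tau>(1) w0)
        finally show ?thesis
          using elim(1) t J(2) path_eq[of t \<theta> \<omega>] by (auto simp: Y_def)
      qed
      then show ?case by (auto simp: fun_eq_iff restrict_def Y_def)
    qed
  qed
  \<comment> \<open>Changing \<open>\<theta> $ j\<close> amounts to shifting the Brownian increments; this is where \<open>\<sigma>\<^sub>1 \<noteq> 0\<close> enters.\<close>
  have shiftY: "Y \<theta> (\<lambda>i\<in>{..<m}. X i \<omega>) \<omega> = Y (\<theta>0 \<theta>) (\<lambda>i\<in>{..<m}. X i \<omega> + \<theta> $ j * a i / \<sigma>\<^sub>1) \<omega>" for \<theta> \<omega>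
  proof -
    have "y0 + (\<Sum>i\<in>UNIV. \<theta> $ i * drift i t) + \<sigma>\<^sub>1 * (\<Sum>i<idx t. (\<lambda>i\<in>{..<m}. X i \<omega>) i) + \<sigma>\<^sub>2 * z' t \<omega>
        = y0 + (\<Sum>i\<in>UNIV. \<theta>0 \<theta> $ i * drift i t) + \<sigma>\<^sub>1 * (\<Sum>i<idx t. (\<lambda>i\<in>{..<m}. X i \<omega> + \<theta> $ j * a i / \<sigma>\<^sub>1) i) + \<sigma>\<^sub>2 * z' t \<omega>"
      if t: "t \<in> J" for t
    proof -
      have lt: "i < m" if "i < idx t" for i using that idx(1)[OF t] by simp
      have "drift j 0 = 0" by (simp add: drift_def)
      then have "(\<Sum>i<idx t. a i) = drift j t"
        unfolding a_def by (subst sum_lessThan_telescope) (simp add: idx(2)[OF t] \<tau>(1))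
      moreover have "(\<Sum>i<idx t. \<theta> $ j * a i / \<sigma>\<^sub>1) = \<theta> $ j / \<sigma>\<^sub>1 * (\<Sum>i<idx t. a i)"
        by (simp add: sum_distrib_left)
      ultimately have "\<sigma>\<^sub>1 * (\<Sum>i<idx t. \<theta> $ j * a i / \<sigma>\<^sub>1) = \<theta> $ j * drift j t" using \<sigma>\<^sub>1 by simp
      moreover have "(\<Sum>i<idx t. (\<lambda>i\<in>{..<m}. X i \<omega> + \<theta> $ j * a i / \<sigma>\<^sub>1) i)
          = (\<Sum>i<idx t. (\<lambda>i\<in>{..<m}. X i \<omega>) i) + (\<Sum>i<idx t. \<theta> $ j * a i / \<sigma>\<^sub>1)"
        unfolding sum.distrib[symmetric] using lt by (intro sum.cong) auto
      moreover have "(\<Sum>i\<in>UNIV. \<theta> $ i * drift i t) = \<theta> $ j * drift j t + (\<Sum>i\<in>UNIV. \<theta>0 \<theta> $ i * drift i t)"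
        by (subst (1 2) sum.remove[of UNIV j]) (auto simp: \<theta>0_def intro!: sum.cong)
      ultimately show ?thesis by (simp add: algebra_simps)
    qed
    then show ?thesis unfolding Y_def by (intro restrict_ext)
  qed
  have Ymeas: "(\<lambda>p. Y (f p) (fst (r p)) (snd (r p))) \<in> measurable N (\<Pi>\<^sub>M t\<in>J. borel)"
    if [measurable]: "f \<in> borel_measurable N" "r \<in> measurable N (?B \<Otimes>\<^sub>M G)" for f r and N :: "'k measure"
    unfolding Y_def
  proof (rule measurable_restrict)
    fix t assume t: "t \<in> J"
    have [measurable]: "z' t \<in> borel_measurable G" by (rule z'[OF t])
    have [measurable]: "(\<lambda>p. fst (r p) i) \<in> borel_measurable N" if "i < idx t" for i
    proof -
      have [measurable]: "(\<lambda>p. fst (r p)) \<in> measurable N ?B" by measurable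
      have "i \<in> {..<m}" using that idx(1)[OF t] by simp
      from measurable_component_singleton[OF this]
      have "(\<lambda>x. x i) \<in> borel_measurable ?B" .
      from measurable_compose[OF _ this] show ?thesis by measurable
    qed
    have "(\<lambda>p. \<Sum>i<idx t. fst (r p) i) \<in> borel_measurable N" by (intro borel_measurable_sum) auto
    then show "(\<lambda>p. y0 + (\<Sum>i\<in>UNIV. f p $ i * drift i t) + \<sigma>\<^sub>1 * (\<Sum>i<idx t. fst (r p) i) + \<sigma>\<^sub>2 * z' t (snd (r p))) \<in> borel_measurable N"
      by measurable
  qed
  have [measurable]: "X i \<in> borel_measurable M" for i
    unfolding X_def[abs_def] using \<tau>0 by measurable
  have \<theta>0[measurable]: "\<theta>0 \<in> borel_measurable borel"
  proof (subst borel_measurable_euclidean_space, intro ballI)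
    fix e :: "real ^ 'd" assume "e \<in> Basis"
    then obtain i where e: "e = axis i 1" by (auto simp: Basis_vec_def)
    show "(\<lambda>x. \<theta>0 x \<bullet> e) \<in> borel_measurable borel"
      by (cases "i = j") (simp_all add: \<theta>0_def e inner_axis)
  qed
  have XM: "(\<lambda>x. (\<lambda>i\<in>{..<m}. X i (snd x), snd x)) \<in> measurable (borel \<Otimes>\<^sub>M M) (?B \<Otimes>\<^sub>M G)"
    using measurable_compose[OF measurable_snd idG] by measurable
  have kkm: "(\<lambda>x. kk (fst x) (snd x)) \<in> borel_measurable (borel \<Otimes>\<^sub>M M)"
    unfolding kk_def
    using measurable_compose[OF Ymeas[OF _ XM, of "\<lambda>x. \<theta>0 (fst x)"] k] by simp
  \<comment> \<open>Data generated at theta are data generated at \<open>\<theta>0 \<theta>\<close>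
    with shifted increments; undoing the shift costs the likelihood ratio at theta_j.\<close>
  have risk: "(\<integral>\<^sup>+\<omega>. ennreal ((h (path \<theta> \<omega>) - g \<theta>)\<^sup>2) \<partial>M)
      = (\<integral>\<^sup>+\<omega>. ennreal ((kk \<theta> \<omega> - g \<theta>)\<^sup>2 * exp (\<theta> $ j * b \<omega> - (\<theta> $ j)\<^sup>2 * q / 2)) \<partial>M)" for \<theta>
  proof -
    define F where "F p = ennreal ((k (Y (\<theta>0 \<theta>) (fst p) (snd p)) - g \<theta>)\<^sup>2)" for p
    have F: "F \<in> borel_measurable (?B \<Otimes>\<^sub>M G)"
      unfolding F_def using measurable_compose[OF Ymeas[of "\<lambda>_. \<theta>0 \<theta>" "?B \<Otimes>\<^sub>M G" "\<lambda>p. p"] k] by simp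
    have "(\<integral>\<^sup>+\<omega>. ennreal ((h (path \<theta> \<omega>) - g \<theta>)\<^sup>2) \<partial>M) = (\<integral>\<^sup>+\<omega>. F (\<lambda>i\<in>{..<m}. X i \<omega> + \<theta> $ j * a i / \<sigma>\<^sub>1, \<omega>) \<partial>M)"
    proof (rule nn_integral_cong_AE)
      show "AE \<omega> in M. ennreal ((h (path \<theta> \<omega>) - g \<theta>)\<^sup>2) = F (\<lambda>i\<in>{..<m}. X i \<omega> + \<theta> $ j * a i / \<sigma>\<^sub>1, \<omega>)"
        using wz by eventually_elim (simp add: hk F_def shiftY)
    qed
    also have "\<dots> = (\<integral>\<^sup>+\<omega>. F (\<lambda>i\<in>{..<m}. X i \<omega>, \<omega>) * ennreal (exp (\<theta> $ j * b \<omega> - (\<theta> $ j)\<^sup>2 * q / 2)) \<partial>M)"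
      by (rule gauss(1)[OF F])
    also have "\<dots> = (\<integral>\<^sup>+\<omega>. ennreal ((kk \<theta> \<omega> - g \<theta>)\<^sup>2 * exp (\<theta> $ j * b \<omega> - (\<theta> $ j)\<^sup>2 * q / 2)) \<partial>M)"
      by (simp add: F_def kk_def ennreal_mult'')
    finally show ?thesis .
  qed
  have q_nonneg: "0 \<le> q" unfolding q_def using v by (intro sum_nonneg) (simp add: less_imp_le)
  have b0: "b \<omega> = 0" if "q = 0" for \<omega>
  proof -
    have "\<forall>i\<in>{..<m}. (a i)\<^sup>2 / (\<sigma>\<^sub>1\<^sup>2 * v i) = 0"
      using that v unfolding q_def by (subst (asm) sum_nonneg_eq_0_iff) (auto simp: less_imp_le)
    then have "a i = 0" if "i < m" for i using v[OF that] \<sigma>\<^sub>1 that by auto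
    then show ?thesis by (simp add: b_def)
  qed
  have bM: "b \<in> borel_measurable M" unfolding b_def[abs_def] by measurable
  have "ennreal ((LINT \<theta>|lborel. g' \<theta> $ j * prior_density u \<theta>)\<^sup>2) / (ennreal q + prior_information (u j) (u' j))
     \<le> (\<integral>\<^sup>+\<theta>. (\<integral>\<^sup>+\<omega>. ennreal ((kk \<theta> \<omega> - g \<theta>)\<^sup>2 * exp (\<theta> $ j * b \<omega> - (\<theta> $ j)\<^sup>2 * q / 2)) \<partial>M)
          * ennreal (prior_density u \<theta>) \<partial>lborel)"
  proof (rule van_trees_inequality[OF pM kkm _ bM q_nonneg b0 gauss(2,3) u g])
    fix s s' f \<omega>
    have "\<theta>0 (vec_insert j (s, f)) = \<theta>0 (vec_insert j (s', f))"
      by (simp add: vec_eq_iff \<theta>0_def vec_insert_nth)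
    then show "kk (vec_insert j (s, f)) \<omega> = kk (vec_insert j (s', f)) \<omega>" by (simp add: kk_def)
  qed
  also have "\<dots> = (\<integral>\<^sup>+\<theta>. (\<integral>\<^sup>+\<omega>. ennreal ((h (path \<theta> \<omega>) - g \<theta>)\<^sup>2) \<partial>M) * ennreal (prior_density u \<theta>) \<partial>lborel)"
    unfolding risk ..
  finally have main: "ennreal ((LINT \<theta>|lborel. g' \<theta> $ j * prior_density u \<theta>)\<^sup>2) / (ennreal q + prior_information (u j) (u' j)) \<le> \<dots>" .
  \<comment> \<open>The quotient decreases in its denominator, so replacing the information of the
    partition by this upper bound only weakens the estimate and removes the dependence on
    \<open>h\<close>.\<close>
  have "q \<le> real n * norm_sq_01 (\<psi> j) / \<sigma>\<^sub>1\<^sup>2"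
  proof -
    have sq: "((\<lambda>t. (\<psi> j t)\<^sup>2) has_integral real n * norm_sq_01 (\<psi> j)) {0..real n}"
      by (rule square_integrable_01_periodic(2)[OF \<psi>_periodic \<psi>_L2])
    have "(a i)\<^sup>2 / (\<sigma>\<^sub>1\<^sup>2 * v i) = (integral {\<tau> i..\<tau> (Suc i)} (\<psi> j))\<^sup>2 / (\<tau> (Suc i) - \<tau> i) / \<sigma>\<^sub>1\<^sup>2" if i: "i < m" for i
    proof -
      have "\<tau> (Suc i) \<le> real n" using monoD[OF \<tau>(3), of "Suc i" m] \<tau>(2) i by simp
      then have "integral {0..\<tau> i} (\<psi> j) + integral {\<tau> i..\<tau> (Suc i)} (\<psi> j) = integral {0..\<tau> (Suc i)} (\<psi> j)"
        using \<tau>(4)[OF i] \<tau>0[of i] integrable_on_subinterval[OF \<psi>_integrable_on, of 0 "\<tau> (Suc i)" j]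
        by (intro Henstock_Kurzweil_Integration.integral_combine) auto
      then have "a i = integral {\<tau> i..\<tau> (Suc i)} (\<psi> j)" by (simp add: a_def drift_def)
      then show ?thesis by (simp add: v_def mult.commute)
    qed
    then have "q = (\<Sum>i<m. (integral {\<tau> i..\<tau> (Suc i)} (\<psi> j))\<^sup>2 / (\<tau> (Suc i) - \<tau> i)) / \<sigma>\<^sub>1\<^sup>2"
      by (simp add: q_def sum_divide_distrib)
    also have "\<dots> \<le> integral {\<tau> 0..real n} (\<lambda>t. (\<psi> j t)\<^sup>2) / \<sigma>\<^sub>1\<^sup>2"
      using \<psi>_integrable_on[of j] sq \<tau>(1,2,4)
      by (intro divide_right_mono partition_sum_integral_square_le) (auto simp: has_integral_integrable)
    also have "integral {\<tau> 0..real n} (\<lambda>t. (\<psi> j t)\<^sup>2) = real n * norm_sq_01 (\<psi> j)"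
      using integral_unique[OF sq] \<tau>(1) by simp
    finally show ?thesis .
  qed
  then have "ennreal q + prior_information (u j) (u' j)
      \<le> ennreal (real n * norm_sq_01 (\<psi> j) / \<sigma>\<^sub>1\<^sup>2) + prior_information (u j) (u' j)"
    by (intro add_right_mono ennreal_leI)
  then have "ennreal ((LINT \<theta>|lborel. g' \<theta> $ j * prior_density u \<theta>)\<^sup>2)
         / (ennreal (real n * norm_sq_01 (\<psi> j) / \<sigma>\<^sub>1\<^sup>2) + prior_information (u j) (u' j))
      \<le> ennreal ((LINT \<theta>|lborel. g' \<theta> $ j * prior_density u \<theta>)\<^sup>2) / (ennreal q + prior_information (u j) (u' j))"
    unfolding divide_ennreal_def by (intro mult_left_mono ennreal_inverse_antimono) auto
  with main show ?thesis by (rule order.trans[rotated])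
qed

end

text \<open>A weighted Young inequality. The factor of \<open>x\<^sup>2\<close> can be brought
  arbitrarily close to \<open>1\<close>, which a factor \<open>2\<close> would not allow, so a small
  perturbation of the estimator loses nothing in the limit.\<close>

lemma square_diff_perturb:
  fixes x y :: real
  assumes "0 < d"
  shows "(x + y)\<^sup>2 \<le> (1 + d) * x\<^sup>2 + (1 + 1 / d) * y\<^sup>2"
proof -
  have "0 \<le> (d * x - y)\<^sup>2 / d" using assms by simp
  also have "\<dots> = d * x\<^sup>2 - 2 * x * y + y\<^sup>2 / d"
    using assms by (simp add: power2_eq_square field_simps)
  finally show ?thesis by (simp add: power2_eq_square algebra_simps)
qed

section \<open>Passage from cylinder functions to square integrable estimators\<close>

context levy_regression
begin

text \<open>The marginal law of the data when theta is drawn from the prior. Distances in its L2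
  space control the change of the Bayes risk for all theta together.\<close>

definition bayes_law :: "('d \<Rightarrow> real \<Rightarrow> real) \<Rightarrow> (real \<Rightarrow> real) measure" where
  "bayes_law u = distr (density (lborel \<Otimes>\<^sub>M M) (\<lambda>x. ennreal (prior_density u (fst x))))
     (skorokhod_space n) (\<lambda>x. path (fst x) (snd x))"

lemma bayes_expectation_path:
  assumes "\<And>\<theta>. H \<theta> \<in> borel_measurable (skorokhod_space n)"
  shows "bayes_expectation (observation_law M n y0 \<psi> (\<lambda>t \<omega>. \<sigma>\<^sub>1 * w t \<omega> + \<sigma>\<^sub>2 * z t \<omega>)) U (\<lambda>x \<theta>. H \<theta> x)
     = (\<integral>\<^sup>+\<theta>. (\<integral>\<^sup>+\<omega>. H \<theta> (path \<theta> \<omega>) \<partial>M) * ennreal (U \<theta>) \<partial>lborel)"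
proof -
  have "observation_law M n y0 \<psi> (\<lambda>t \<omega>. \<sigma>\<^sub>1 * w t \<omega> + \<sigma>\<^sub>2 * z t \<omega>) \<theta> = distr M (skorokhod_space n) (path \<theta>)" for \<theta>
    unfolding observation_law_def path_def[abs_def] ..
  then show ?thesis
    unfolding bayes_expectation_def using assms path_measurable by (simp add: nn_integral_distr)
qed

lemma nn_integral_bayes_law:
  fixes u :: "'d \<Rightarrow> real \<Rightarrow> real"
  assumes [measurable]: "prior_density u \<in> borel_measurable borel" "f \<in> borel_measurable (skorokhod_space n)"
  shows "(\<integral>\<^sup>+x. f x \<partial>bayes_law u) = (\<integral>\<^sup>+\<theta>. (\<integral>\<^sup>+\<omega>. f (path \<theta> \<omega>) \<partial>M) * ennreal (prior_density u \<theta>) \<partial>lborel)"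
proof -
  note path_measurable_pair[measurable]
  have "(\<integral>\<^sup>+x. f x \<partial>bayes_law u)
      = (\<integral>\<^sup>+x. ennreal (prior_density u (fst x)) * f (path (fst x) (snd x)) \<partial>(lborel \<Otimes>\<^sub>M M))"
    unfolding bayes_law_def
    by (subst nn_integral_distr, measurable, subst nn_integral_density) (auto cong: measurable_cong_sets)
  also have "\<dots> = (\<integral>\<^sup>+\<theta>. \<integral>\<^sup>+\<omega>. ennreal (prior_density u \<theta>) * f (path \<theta> \<omega>) \<partial>M \<partial>lborel)"
    by (subst nn_integral_fst[symmetric]) (auto cong: measurable_cong_sets)
  also have "\<dots> = (\<integral>\<^sup>+\<theta>. (\<integral>\<^sup>+\<omega>. f (path \<theta> \<omega>) \<partial>M) * ennreal (prior_density u \<theta>) \<partial>lborel)"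
    by (intro nn_integral_cong, subst nn_integral_cmult)
      (auto intro: measurable_compose[OF path_measurable] simp: mult.commute)
  finally show ?thesis .
qed

lemma van_trees_path:
  fixes u u' :: "'d \<Rightarrow> real \<Rightarrow> real" and g :: "real ^ 'd \<Rightarrow> real" and g' :: "real ^ 'd \<Rightarrow> real ^ 'd"
  assumes u: "\<And>i x. 0 \<le> u i x" "\<And>i. (\<integral>\<^sup>+ x. ennreal (u i x) \<partial>lborel) = 1"
      "\<And>i x. (u i has_real_derivative u' i x) (at x)" "\<And>i. continuous_on UNIV (u' i)"
    and g: "\<And>\<theta>. (g has_derivative (\<lambda>h. g' \<theta> \<bullet> h)) (at \<theta>)" "continuous_on UNIV g'"
      "\<And>\<theta>. ((\<lambda>s. g (\<chi> k. if k = j then s else \<theta> $ k) * u j s) \<longlongrightarrow> 0) at_infinity"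
      "integrable lborel (\<lambda>\<theta>. \<bar>g' \<theta> $ j\<bar> * prior_density u \<theta>)"
    and f[measurable]: "f \<in> borel_measurable (skorokhod_space n)"
    and f2: "(\<integral>\<^sup>+\<theta>. (\<integral>\<^sup>+\<omega>. ennreal ((f (path \<theta> \<omega>))\<^sup>2) \<partial>M) * ennreal (prior_density u \<theta>) \<partial>lborel) < \<infinity>"
  shows "ennreal ((LINT \<theta>|lborel. g' \<theta> $ j * prior_density u \<theta>)\<^sup>2)
         / (ennreal (real n * norm_sq_01 (\<psi> j) / \<sigma>\<^sub>1\<^sup>2) + prior_information (u j) (u' j))
     \<le> (\<integral>\<^sup>+\<theta>. (\<integral>\<^sup>+\<omega>. ennreal ((f (path \<theta> \<omega>) - g \<theta>)\<^sup>2) \<partial>M) * ennreal (prior_density u \<theta>) \<partial>lborel)"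
    (is "?C \<le> ?R f")
proof (rule ennreal_le_epsilon)
  \<comment> \<open>It suffices to lose an arbitrary \<open>e > 0\<close>, and the risk may be taken
    finite.\<close>
  fix e :: real assume e: "0 < e" and fin: "?R f < top"
  have [measurable]: "u i \<in> borel_measurable borel" for i
    using u(3) by (intro borel_measurable_continuous_onI continuous_at_imp_continuous_on ballI) (rule DERIV_isCont)
  have [measurable]: "(\<lambda>\<theta>::real ^ 'd. \<theta> $ i) \<in> borel_measurable borel" for i
    by (intro borel_measurable_continuous_onI continuous_intros)
  have U[measurable]: "prior_density u \<in> borel_measurable borel"
    unfolding prior_density_def by measurable
  have gm[measurable]: "g \<in> borel_measurable borel"
    using g(1) by (intro borel_measurable_continuous_onI continuous_at_imp_continuous_on ballI) (rule has_derivative_continuous)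
  note path_measurable_pair[measurable]
  have pm[measurable]: "(\<lambda>\<omega>. h (path \<theta> \<omega>)) \<in> borel_measurable M"
    if "h \<in> borel_measurable (skorokhod_space n)" for h :: "(real \<Rightarrow> real) \<Rightarrow> real" and \<theta>
    using measurable_compose[OF path_measurable that] .
  have int_m[measurable]: "(\<lambda>\<theta>. \<integral>\<^sup>+\<omega>. ennreal ((F (path \<theta> \<omega>) \<theta>)\<^sup>2) \<partial>M) \<in> borel_measurable borel"
    if "(\<lambda>x. F (path (fst x) (snd x)) (fst x)) \<in> borel_measurable (borel \<Otimes>\<^sub>M M)" for F
    using that by (intro borel_measurable_nn_integral) (simp add: split_beta')
  obtain r where r: "?R f = ennreal r" "0 \<le> r" using fin by (cases "?R f") auto
  \<comment> \<open>Chosen so that inflating the risk \<open>r\<close> by the factor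
    \<open>1 + d\<close> costs at most \<open>e / 2\<close>; \<open>r + 1\<close> avoids division by
    zero.\<close>
  define d where "d = e / (2 * (r + 1))"
  have d: "0 < d" using e r by (simp add: d_def)
  have dr: "d * r \<le> e / 2"
  proof -
    have "d * (r + 1) = e / 2" using r by (simp add: d_def field_simps)
    then show ?thesis using d by (simp add: distrib_left)
  qed
  \<comment> \<open>The approximation error gets multiplied by \<open>1 + 1 / d\<close> and must
    then amount to \<open>e / 2\<close>.\<close>
  define \<epsilon> where "\<epsilon> = e / 2 / (1 + 1 / d)"
  have "0 < 1 + 1 / d" using d by (simp add: add_pos_pos)
  then have \<epsilon>: "0 < \<epsilon>" "(1 + 1 / d) * \<epsilon> = e / 2"
    unfolding \<epsilon>_def using e by (simp_all only: divide_pos_pos zero_less_numeral) (metis less_irrefl nonzero_mult_div_cancel_left times_divide_eq_right)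
  have sets: "sets (bayes_law u) = sets (skorokhod_space n)" by (simp add: bayes_law_def)
  have "L2_approximable (bayes_law u) (cylinder_functions {0..real n}) f"
  proof (rule cylinder_functions_L2_dense)
    show "sets (bayes_law u) = sets (restrict_space (\<Pi>\<^sub>M t\<in>{0..real n}. borel) {x. cadlag_on {0..real n} x})"
      unfolding sets skorokhod_space_def ..
    show "f \<in> borel_measurable (bayes_law u)" using f measurable_cong_sets[OF sets refl] by blast
    show "(\<integral>\<^sup>+x. ennreal ((f x)\<^sup>2) \<partial>bayes_law u) < \<infinity>"
      using f2 by (subst nn_integral_bayes_law) auto
    show "finite_measure (bayes_law u)"
    proof (rule finite_measureI)
      have "emeasure (bayes_law u) (space (bayes_law u)) = (\<integral>\<^sup>+x. 1 \<partial>bayes_law u)" by simp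
      also have "\<dots> = (\<integral>\<^sup>+\<theta>. 1 * ennreal (prior_density u \<theta>) \<partial>lborel)"
        by (subst nn_integral_bayes_law) (auto simp: emeasure_space_1)
      also have "\<dots> = (\<integral>\<^sup>+s. 1 * ennreal (u j s) \<partial>lborel)"
        by (rule nn_integral_prior_marginal[where h="\<lambda>_. 1"]) (use u in auto)
      finally show "emeasure (bayes_law u) (space (bayes_law u)) \<noteq> \<infinity>" using u(2) by simp
    qed
  qed
  then obtain h where h: "h \<in> cylinder_functions {0..real n}"
    and hf: "(\<integral>\<^sup>+x. ennreal ((f x - h x)\<^sup>2) \<partial>bayes_law u) < ennreal \<epsilon>"
    using \<epsilon>(1) unfolding L2_approximable_def by blast
  have hm[measurable]: "h \<in> borel_measurable (skorokhod_space n)"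
    unfolding skorokhod_space_def by (rule measurable_restrict_space1[OF cylinder_functions_measurable[OF h]])
  have "?C \<le> ?R h" by (rule van_trees_cylinder[OF u g h])
  also have "\<dots> \<le> (\<integral>\<^sup>+\<theta>. ennreal (1 + d) * ((\<integral>\<^sup>+\<omega>. ennreal ((f (path \<theta> \<omega>) - g \<theta>)\<^sup>2) \<partial>M) * ennreal (prior_density u \<theta>))
      + ennreal (1 + 1 / d) * ((\<integral>\<^sup>+\<omega>. ennreal ((f (path \<theta> \<omega>) - h (path \<theta> \<omega>))\<^sup>2) \<partial>M) * ennreal (prior_density u \<theta>)) \<partial>lborel)"
  proof (rule nn_integral_mono)
    fix \<theta> :: "real ^ 'd"
    have "(\<integral>\<^sup>+\<omega>. ennreal ((h (path \<theta> \<omega>) - g \<theta>)\<^sup>2) \<partial>M)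
      \<le> (\<integral>\<^sup>+\<omega>. ennreal (1 + d) * ennreal ((f (path \<theta> \<omega>) - g \<theta>)\<^sup>2)
          + ennreal (1 + 1 / d) * ennreal ((f (path \<theta> \<omega>) - h (path \<theta> \<omega>))\<^sup>2) \<partial>M)"
    proof (rule nn_integral_mono)
      fix \<omega>
      have "(h (path \<theta> \<omega>) - g \<theta>)\<^sup>2 \<le> (1 + d) * (f (path \<theta> \<omega>) - g \<theta>)\<^sup>2 + (1 + 1 / d) * (f (path \<theta> \<omega>) - h (path \<theta> \<omega>))\<^sup>2"
        using square_diff_perturb[OF d, of "f (path \<theta> \<omega>) - g \<theta>" "h (path \<theta> \<omega>) - f (path \<theta> \<omega>)"]
        by (simp add: power2_commute)
      then have "ennreal ((h (path \<theta> \<omega>) - g \<theta>)\<^sup>2)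
          \<le> ennreal ((1 + d) * (f (path \<theta> \<omega>) - g \<theta>)\<^sup>2 + (1 + 1 / d) * (f (path \<theta> \<omega>) - h (path \<theta> \<omega>))\<^sup>2)"
        by (rule ennreal_leI)
      also have "\<dots> = ennreal (1 + d) * ennreal ((f (path \<theta> \<omega>) - g \<theta>)\<^sup>2)
          + ennreal (1 + 1 / d) * ennreal ((f (path \<theta> \<omega>) - h (path \<theta> \<omega>))\<^sup>2)"
        using d by (subst ennreal_plus) (auto simp: ennreal_mult'' simp del: ennreal_plus)
      finally show "ennreal ((h (path \<theta> \<omega>) - g \<theta>)\<^sup>2) \<le> \<dots>" .
    qed
    also have "\<dots> = ennreal (1 + d) * (\<integral>\<^sup>+\<omega>. ennreal ((f (path \<theta> \<omega>) - g \<theta>)\<^sup>2) \<partial>M)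
          + ennreal (1 + 1 / d) * (\<integral>\<^sup>+\<omega>. ennreal ((f (path \<theta> \<omega>) - h (path \<theta> \<omega>))\<^sup>2) \<partial>M)"
      by (simp add: nn_integral_add nn_integral_cmult pm[OF f] pm[OF hm])
    finally have "(\<integral>\<^sup>+\<omega>. ennreal ((h (path \<theta> \<omega>) - g \<theta>)\<^sup>2) \<partial>M) * ennreal (prior_density u \<theta>)
        \<le> (ennreal (1 + d) * (\<integral>\<^sup>+\<omega>. ennreal ((f (path \<theta> \<omega>) - g \<theta>)\<^sup>2) \<partial>M)
          + ennreal (1 + 1 / d) * (\<integral>\<^sup>+\<omega>. ennreal ((f (path \<theta> \<omega>) - h (path \<theta> \<omega>))\<^sup>2) \<partial>M)) * ennreal (prior_density u \<theta>)"
      by (rule mult_right_mono) simp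
    then show "(\<integral>\<^sup>+\<omega>. ennreal ((h (path \<theta> \<omega>) - g \<theta>)\<^sup>2) \<partial>M) * ennreal (prior_density u \<theta>)
        \<le> ennreal (1 + d) * ((\<integral>\<^sup>+\<omega>. ennreal ((f (path \<theta> \<omega>) - g \<theta>)\<^sup>2) \<partial>M) * ennreal (prior_density u \<theta>))
          + ennreal (1 + 1 / d) * ((\<integral>\<^sup>+\<omega>. ennreal ((f (path \<theta> \<omega>) - h (path \<theta> \<omega>))\<^sup>2) \<partial>M) * ennreal (prior_density u \<theta>))"
      by (simp only: distrib_right mult.assoc)
  qed
  also have "\<dots> = ennreal (1 + d) * ?R f
      + ennreal (1 + 1 / d) * (\<integral>\<^sup>+\<theta>. (\<integral>\<^sup>+\<omega>. ennreal ((f (path \<theta> \<omega>) - h (path \<theta> \<omega>))\<^sup>2) \<partial>M) * ennreal (prior_density u \<theta>) \<partial>lborel)"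
  proof -
    have [measurable]: "(\<lambda>\<theta>. \<integral>\<^sup>+\<omega>. ennreal ((f (path \<theta> \<omega>) - g \<theta>)\<^sup>2) \<partial>M) \<in> borel_measurable borel"
      by (rule int_m) measurable
    have [measurable]: "(\<lambda>\<theta>. \<integral>\<^sup>+\<omega>. ennreal ((f (path \<theta> \<omega>) - h (path \<theta> \<omega>))\<^sup>2) \<partial>M) \<in> borel_measurable borel"
      by (rule int_m) measurable
    show ?thesis by (simp add: nn_integral_add nn_integral_cmult)
  qed
  also have "(\<integral>\<^sup>+\<theta>. (\<integral>\<^sup>+\<omega>. ennreal ((f (path \<theta> \<omega>) - h (path \<theta> \<omega>))\<^sup>2) \<partial>M) * ennreal (prior_density u \<theta>) \<partial>lborel)
      = (\<integral>\<^sup>+x. ennreal ((f x - h x)\<^sup>2) \<partial>bayes_law u)"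
    by (subst nn_integral_bayes_law) auto
  also have "ennreal (1 + d) * ?R f + ennreal (1 + 1 / d) * (\<integral>\<^sup>+x. ennreal ((f x - h x)\<^sup>2) \<partial>bayes_law u)
      \<le> ennreal (1 + d) * ?R f + ennreal (1 + 1 / d) * ennreal \<epsilon>"
    by (intro add_left_mono mult_left_mono less_imp_le[OF hf]) simp
  also have "\<dots> = ennreal ((1 + d) * r + (1 + 1 / d) * \<epsilon>)"
    using d r \<epsilon>(1) unfolding r(1) by (subst ennreal_plus) (auto simp: ennreal_mult simp del: ennreal_plus)
  also have "\<dots> \<le> ennreal (r + e)"
    using dr \<epsilon>(2) by (intro ennreal_leI) (simp add: algebra_simps)
  also have "\<dots> = ?R f + ennreal e" using r e by simp
  finally show "?C \<le> ?R f + ennreal e" .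
qed

end

theorem lemma8p1:
  fixes M :: "'w measure"
    and w z \<xi> :: "real \<Rightarrow> 'w \<Rightarrow> real"
    and \<mu> :: "'w \<Rightarrow> (real \<times> real) measure"
    and L :: "real measure"
    and \<sigma>\<^sub>1 \<sigma>\<^sub>2 y0 :: real
    and n :: nat
    and \<psi> :: "'d::finite \<Rightarrow> real \<Rightarrow> real"
    and P :: "real ^ 'd \<Rightarrow> (real \<Rightarrow> real) measure"
    and u u' :: "'d \<Rightarrow> real \<Rightarrow> real"
    and g :: "real ^ 'd \<Rightarrow> real"
    and g' :: "real ^ 'd \<Rightarrow> real ^ 'd"
    and ghat :: "(real \<Rightarrow> real) \<Rightarrow> real"
    and j :: 'd
  assumes "prob_space M"
    and levy: "measure_on_R0 L"
      "(\<integral>\<^sup>+ x. ennreal (x ^ 2) \<partial>L) = 1"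
      "(\<integral>\<^sup>+ x. ennreal (x ^ 6) \<partial>L) < \<infinity>"
    and w: "brownian_motion M w"
    and \<mu>: "poisson_random_measure M \<mu> (jump_compensator L)"
    and indep: "indep_process_random_measure M w \<mu> (jump_compensator L)"
    and z: "compensated_jump_process M \<mu> L z"
    and \<xi>: "\<xi> = (\<lambda>t \<omega>. \<sigma>\<^sub>1 * w t \<omega> + \<sigma>\<^sub>2 * z t \<omega>)"
    and "\<sigma>\<^sub>1 \<noteq> 0"
    and "n \<ge> 1"
    and \<psi>_periodic: "\<And>i t. \<psi> i (t + 1) = \<psi> i t"
    and \<psi>_L2: "\<And>i. square_integrable_01 (\<psi> i)"
    and \<psi>_orthogonal: "\<And>i k. i \<noteq> k \<Longrightarrow> inner_01 (\<psi> i) (\<psi> k) = 0"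
    and P: "P = observation_law M n y0 \<psi> \<xi>"
    and u_density: "\<And>i x. 0 \<le> u i x" "\<And>i. (\<integral>\<^sup>+ x. ennreal (u i x) \<partial>lborel) = 1"
    and u_C1: "\<And>i x. (u i has_real_derivative u' i x) (at x)"
      "\<And>i. continuous_on UNIV (u' i)"
    and g_C1: "\<And>\<theta>. (g has_derivative (\<lambda>h. g' \<theta> \<bullet> h)) (at \<theta>)"
      "continuous_on UNIV g'"
    and g_decay: "\<And>i \<theta>. ((\<lambda>s. g (\<chi> k. if k = i then s else \<theta> $ k) * u i s) \<longlongrightarrow> 0) at_infinity"
    and g'_integrable: "\<And>i. integrable lborel (\<lambda>\<theta>. \<bar>g' \<theta> $ i\<bar> * prior_density u \<theta>)"
    and ghat_measurable: "ghat \<in> borel_measurable (skorokhod_space n)"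
    and ghat_L2: "bayes_expectation P (prior_density u) (\<lambda>x \<theta>. ennreal ((ghat x)\<^sup>2)) < \<infinity>"
  shows "bayes_expectation P (prior_density u) (\<lambda>x \<theta>. ennreal ((ghat x - g \<theta>)\<^sup>2))
     \<ge> ennreal ((LINT \<theta>|lborel. g' \<theta> $ j * prior_density u \<theta>)\<^sup>2)
         / (ennreal (real n * norm_sq_01 (\<psi> j) / \<sigma>\<^sub>1\<^sup>2) + prior_information (u j) (u' j))"
proof -
  interpret levy_regression M w z \<mu> L \<sigma>\<^sub>1 \<sigma>\<^sub>2 y0 n \<psi>
    by (rule levy_regression.intro) fact+
  note [measurable] = ghat_measurable
  \<comment> \<open>Stated for a general \<open>c\<close>: with \<open>g\<close> it is the risk,
    with the zero function it is the square integrability hypothesis on \<open>ghat\<close>.\<close>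
  have E: "bayes_expectation P (prior_density u) (\<lambda>x \<theta>. ennreal ((ghat x - c \<theta>)\<^sup>2))
    = (\<integral>\<^sup>+\<theta>. (\<integral>\<^sup>+\<omega>. ennreal ((ghat (path \<theta> \<omega>) - c \<theta>)\<^sup>2) \<partial>M) * ennreal (prior_density u \<theta>) \<partial>lborel)" for c
    unfolding P \<xi> by (rule bayes_expectation_path[where H="\<lambda>\<theta> x. ennreal ((ghat x - c \<theta>)\<^sup>2)"]) measurable
  show ?thesis
    unfolding E
    by (rule van_trees_path[OF u_density u_C1 g_C1 g_decay g'_integrable ghat_measurable])
      (use ghat_L2 E[of "\<lambda>_. 0"] in simp)
qed

end
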